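(* Let $P$ be an irreducible stochastic matrix of (finite) size $d$. Then the Cuntz-Pimsner algebra $\mathcal{O}(P)$ is $*$-isomorphic to $M_d(\mathbb{C})\otimes C(\mathbb{T})$, where $\mathbb{T}$ is the unit circle.
   Context: Conventions: $\mathbb{N}=\{0,1,2,\dots\}$. A stochastic matrix over a finite set $\Omega$ is a matrix $P=[P_{ij}]_{i,j\in\Omega}$ with nonnegative entries and all row sums equal to $1$; its size is $|\Omega|$. $P^{(n)}_{ij}$ denotes the $(i,j)$ entry of $P^n$ (with $P^0=I$), and $E(P^n)=\{(i,j): P^{(n)}_{ij}>0\}$. $P$ is irreducible if for all $i,j\in\Omega$ there is $n\ge 1$ with $P^{(n)}_{ij}>0$. Subproduct system and shifts: $\mathrm{Arv}(P)_n$ is the space of $\Omega\times\Omega$ complex matrices $A$ with $A_{ij}=0$ whenever $(i,j)\notin E(P^n)$. It is a C*-correspondence over $\ell^\infty(\Omega)$ (identified with the diagonal matrices $=\mathrm{Arv}(P)_0$), with left and right actions by multiplication by diagonal matrices and inner product $\langle A,B\rangle=\mathrm{Diag}(A^*B)$ (the diagonal of $A^*B$). $\mathcal{F}_{\mathrm{Arv}(P)}=\bigoplus_{n\in\mathbb{N}}\mathrm{Arv}(P)_n$ is the Hilbert C*-module direct sum, $\mathcal{L}(\mathcal{F}_{\mathrm{Arv}(P)})$ its adjointable operators, and $Q_n$ is the projection onto $\mathrm{Arv}(P)_n$. For $A\in \mathrm{Arv}(P)_n$, $S^{(n)}_A\in\mathcal{L}(\mathcal{F}_{\mathrm{Arv}(P)})$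 is the operator mapping each $\mathrm{Arv}(P)_m$ into $\mathrm{Arv}(P)_{n+m}$ by $$(S^{(n)}_A B)_{ij}=\big(P^{(n+m)}_{ij}\big)^{-1/2}\sum_{k\in\Omega}\sqrt{P^{(n)}_{ik}P^{(m)}_{kj}}\,A_{ik}B_{kj}\ \text{ if } (i,j)\in E(P^{n+m}),\qquad (S^{(n)}_A B)_{ij}=0\ \text{ otherwise.}$$ Algebras: the Toeplitz algebra $\mathcal{T}(P)$ is the C*-subalgebra of $\mathcal{L}(\mathcal{F}_{\mathrm{Arv}(P)})$ generated by $\ell^\infty(\Omega)$ and all $S^{(n)}_A$, $n\in\mathbb{N}$, $A\in\mathrm{Arv}(P)_n$. The set $\mathcal{J}(\mathcal{T}(P))=\{T\in\mathcal{T}(P):\lim_n\|TQ_n\|=0\}$ is a closed two-sided ideal of $\mathcal{T}(P)$, and the Cuntz-Pimsner algebra is $\mathcal{O}(P)=\mathcal{T}(P)/\mathcal{J}(\mathcal{T}(P))$. *)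

theory Defs
  imports "HOL-Analysis.Analysis" "HOL-Algebra.QuotRing" "HOL-Algebra.Module"
begin

section \<open>Algebras with a star operation and a norm\<close>

text \<open>
  A C*-algebra is given by its carrier and its operations. The ring operations are those of
  HOL-Algebra, so that ideals, quotient rings and ring isomorphisms are the library ones. A unit
  is part of the record; all algebras below are unital.
\<close>

record 'a cstar = "(complex, 'a) module" +
  star :: "'a \<Rightarrow> 'a"
  nrm :: "'a \<Rightarrow> real"

definition cstar_subalgebra :: "'a cstar \<Rightarrow> 'a set \<Rightarrow> bool" where
  "cstar_subalgebra A X \<longleftrightarrow>
     X \<subseteq> carrier A \<and> \<zero>\<^bsub>A\<^esub> \<in> X \<and>
     (\<forall>x\<in>X. \<forall>y\<in>X. x \<oplus>\<^bsub>A\<^esub> y \<in> X \<and> x \<otimes>\<^bsub>A\<^esub> y \<in> X) \<and>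
     (\<forall>c. \<forall>x\<in>X. c \<odot>\<^bsub>A\<^esub> x \<in> X) \<and>
     (\<forall>x\<in>X. star A x \<in> X) \<and>
     (\<forall>s. \<forall>x\<in>carrier A. (\<forall>n. s n \<in> X) \<longrightarrow>
        (\<lambda>n. nrm A (s n \<oplus>\<^bsub>A\<^esub> (-1) \<odot>\<^bsub>A\<^esub> x)) \<longlonglongrightarrow> 0 \<longrightarrow> x \<in> X)"

definition cstar_generated :: "'a cstar \<Rightarrow> 'a set \<Rightarrow> 'a set" where
  "cstar_generated A G = \<Inter>{X. cstar_subalgebra A X \<and> G \<subseteq> X}"

definition cstar_quot :: "'a cstar \<Rightarrow> 'a set \<Rightarrow> 'a set cstar" where
  "cstar_quot A I =
     \<lparr>carrier = carrier (A Quot I), mult = mult (A Quot I), one = one (A Quot I),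
      zero = zero (A Quot I), add = add (A Quot I),
      smult = (\<lambda>c X. \<Union>x\<in>X. I +>\<^bsub>A\<^esub> (c \<odot>\<^bsub>A\<^esub> x)),
      star = (\<lambda>X. \<Union>x\<in>X. I +>\<^bsub>A\<^esub> star A x),
      nrm = (\<lambda>X. INF x\<in>X. nrm A x)\<rparr>"

text \<open>
  A \<open>*\<close>-isomorphism is purely algebraic; between C*-algebras it is automatically isometric.
\<close>

definition star_iso :: "'a cstar \<Rightarrow> 'b cstar \<Rightarrow> ('a \<Rightarrow> 'b) set" where
  "star_iso A B =
     {h \<in> ring_iso A B. \<forall>x\<in>carrier A.
        (\<forall>c. h (c \<odot>\<^bsub>A\<^esub> x) = c \<odot>\<^bsub>B\<^esub> h x) \<and> h (star A x) = star B (h x)}"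

definition star_isomorphic :: "'a cstar \<Rightarrow> 'b cstar \<Rightarrow> bool" where
  "star_isomorphic A B \<longleftrightarrow> star_iso A B \<noteq> {}"


section \<open>Matrix algebras, function algebras and their tensor product\<close>

definition ctranspose :: "complex ^ 'm ^ 'n \<Rightarrow> complex ^ 'n ^ 'm" where
  "ctranspose A = (\<chi> i j. cnj (A $ j $ i))"

definition cscale :: "complex \<Rightarrow> complex ^ 'm ^ 'n \<Rightarrow> complex ^ 'm ^ 'n" where
  "cscale c A = (\<chi> i j. c * A $ i $ j)"

definition mat_alg :: "(complex ^ 'd ^ 'd) cstar" where
  "mat_alg =
     \<lparr>carrier = UNIV, mult = (**), one = mat 1, zero = 0, add = (+), smult = cscale,
      star = ctranspose, nrm = (\<lambda>A. onorm ((*v) A))\<rparr>"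

definition complex_alg :: "complex cstar" where
  "complex_alg =
     \<lparr>carrier = UNIV, mult = (*), one = 1, zero = 0, add = (+), smult = (*),
      star = cnj, nrm = cmod\<rparr>"

text \<open>
  The algebra \<open>\<ell>\<^sup>\<infinity>(X, A)\<close> of bounded functions from \<open>X\<close> to \<open>A\<close>.
  Functions on \<open>X\<close> are extensional: they have the value \<open>undefined\<close> outside \<open>X\<close>.
\<close>

definition linf_alg :: "'x set \<Rightarrow> 'a cstar \<Rightarrow> ('x \<Rightarrow> 'a) cstar" where
  "linf_alg X A =
     \<lparr>carrier = {f \<in> X \<rightarrow>\<^sub>E carrier A. bdd_above ((\<lambda>x. nrm A (f x)) ` X)},
      mult = (\<lambda>f g. \<lambda>x\<in>X. f x \<otimes>\<^bsub>A\<^esub> g x), one = (\<lambda>x\<in>X. \<one>\<^bsub>A\<^esub>),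
      zero = (\<lambda>x\<in>X. \<zero>\<^bsub>A\<^esub>), add = (\<lambda>f g. \<lambda>x\<in>X. f x \<oplus>\<^bsub>A\<^esub> g x),
      smult = (\<lambda>c f. \<lambda>x\<in>X. c \<odot>\<^bsub>A\<^esub> f x), star = (\<lambda>f. \<lambda>x\<in>X. star A (f x)),
      nrm = (\<lambda>f. SUP x\<in>X. nrm A (f x))\<rparr>"

definition cont_alg :: "('x::topological_space) set \<Rightarrow> ('x \<Rightarrow> complex) cstar" where
  "cont_alg X = (linf_alg X complex_alg)
     \<lparr>carrier := {f \<in> carrier (linf_alg X complex_alg). continuous_on X f}\<rparr>"

text \<open>
  The spatial tensor product of a C*-algebra \<open>A\<close> with a C*-algebra \<open>B\<close> of bounded functions on
  \<open>X\<close>. Represent \<open>A\<close> faithfully on a Hilbert space \<open>H\<close>, and \<open>B\<close> faithfully on \<open>\<ell>\<^sup>2(X)\<close> by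
  multiplication operators. On the Hilbert space tensor product \<open>\<ell>\<^sup>2(X, H)\<close>, the operator
  \<open>a \<otimes> f\<close> is multiplication by the function \<open>x \<mapsto> f(x) a\<close>, and the norm of a bounded multiplication
  operator is the supremum norm. The tensor product is hence the C*-subalgebra of
  \<open>\<ell>\<^sup>\<infinity>(X, A)\<close> generated by the functions \<open>x \<mapsto> f(x) a\<close>. (For nuclear \<open>A\<close>, such as a matrix
  algebra, this is the only C*-tensor product.)
\<close>

definition elem_tensor :: "'x set \<Rightarrow> 'a cstar \<Rightarrow> 'a \<Rightarrow> ('x \<Rightarrow> complex) \<Rightarrow> 'x \<Rightarrow> 'a" where
  "elem_tensor X A a f = (\<lambda>x\<in>X. f x \<odot>\<^bsub>A\<^esub> a)"

definition tensor_alg :: "'x set \<Rightarrow> 'a cstar \<Rightarrow> ('x \<Rightarrow> complex) cstar \<Rightarrow> ('x \<Rightarrow> 'a) cstar" where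
  "tensor_alg X A B = (linf_alg X A)
     \<lparr>carrier := cstar_generated (linf_alg X A)
        {elem_tensor X A a f | a f. a \<in> carrier A \<and> f \<in> carrier B}\<rparr>"

definition mat_tensor_circle :: "(complex \<Rightarrow> complex ^ 'd ^ 'd) cstar" where
  "mat_tensor_circle = tensor_alg (sphere 0 1) mat_alg (cont_alg (sphere 0 1))"


section \<open>Stochastic matrices\<close>

definition stochastic :: "real ^ 'n ^ 'n \<Rightarrow> bool" where
  "stochastic P \<longleftrightarrow> (\<forall>i j. 0 \<le> P $ i $ j) \<and> (\<forall>i. (\<Sum>j\<in>UNIV. P $ i $ j) = 1)"

text \<open>
  The library power \<open>P ^ n\<close> on vector types is componentwise, so matrix powers are defined here.
\<close>

primrec mpow :: "real ^ 'n ^ 'n \<Rightarrow> nat \<Rightarrow> real ^ 'n ^ 'n" where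
  "mpow P 0 = mat 1"
| "mpow P (Suc n) = P ** mpow P n"

definition edges :: "real ^ 'n ^ 'n \<Rightarrow> ('n \<times> 'n) set" where
  "edges M = {(i, j). 0 < M $ i $ j}"

definition irreducible_mat :: "real ^ 'n ^ 'n \<Rightarrow> bool" where
  "irreducible_mat P \<longleftrightarrow> (\<forall>i j. \<exists>n\<ge>1. 0 < mpow P n $ i $ j)"


section \<open>The subproduct system and its Fock module\<close>

text \<open>Elements of \<open>\<ell>\<^sup>\<infinity>(\<Omega>)\<close> are vectors indexed by the finite type \<open>'n\<close> of states.\<close>

definition diag_mat :: "complex ^ 'n \<Rightarrow> complex ^ 'n ^ 'n" where
  "diag_mat f = (\<chi> i j. if i = j then f $ i else 0)"

definition linf_norm :: "complex ^ 'n \<Rightarrow> real" where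
  "linf_norm f = (SUP i. cmod (f $ i))"

definition Arv :: "real ^ 'n ^ 'n \<Rightarrow> nat \<Rightarrow> (complex ^ 'n ^ 'n) set" where
  "Arv P n = {A. \<forall>i j. (i, j) \<notin> edges (mpow P n) \<longrightarrow> A $ i $ j = 0}"

definition arv_inner :: "complex ^ 'n ^ 'n \<Rightarrow> complex ^ 'n ^ 'n \<Rightarrow> complex ^ 'n" where
  "arv_inner A B = (\<chi> j. (ctranspose A ** B) $ j $ j)"

text \<open>
  The Hilbert module direct sum: sequences for which the inner products sum up in
  \<open>\<ell>\<^sup>\<infinity>(\<Omega>)\<close>. The latter is finite-dimensional, so that the topology of \<^typ>\<open>complex ^ 'n\<close> is the
  norm topology.
\<close>

definition Fock :: "real ^ 'n ^ 'n \<Rightarrow> (nat \<Rightarrow> complex ^ 'n ^ 'n) set" where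
  "Fock P = {\<xi>. (\<forall>n. \<xi> n \<in> Arv P n) \<and> summable (\<lambda>n. arv_inner (\<xi> n) (\<xi> n))}"

definition fock_inner ::
    "(nat \<Rightarrow> complex ^ 'n ^ 'n) \<Rightarrow> (nat \<Rightarrow> complex ^ 'n ^ 'n) \<Rightarrow> complex ^ 'n" where
  "fock_inner \<xi> \<eta> = (\<Sum>n. arv_inner (\<xi> n) (\<eta> n))"

definition fock_norm :: "(nat \<Rightarrow> complex ^ 'n ^ 'n) \<Rightarrow> real" where
  "fock_norm \<xi> = sqrt (linf_norm (fock_inner \<xi> \<xi>))"

type_synonym 'n fock_op = "(nat \<Rightarrow> complex ^ 'n ^ 'n) \<Rightarrow> nat \<Rightarrow> complex ^ 'n ^ 'n"

definition is_adjoint :: "real ^ 'n ^ 'n \<Rightarrow> 'n fock_op \<Rightarrow> 'n fock_op \<Rightarrow> bool" where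
  "is_adjoint P T S \<longleftrightarrow> S \<in> Fock P \<rightarrow>\<^sub>E Fock P \<and>
     (\<forall>\<xi>\<in>Fock P. \<forall>\<eta>\<in>Fock P. fock_inner (T \<xi>) \<eta> = fock_inner \<xi> (S \<eta>))"

text \<open>
  The adjointable operators. Adjointability implies that an operator is linear, a right module
  map, and bounded. Operators are extensional, which makes them and their adjoints unique.
\<close>

definition fock_op_alg :: "real ^ 'n ^ 'n \<Rightarrow> 'n fock_op cstar" where
  "fock_op_alg P =
     \<lparr>carrier = {T \<in> Fock P \<rightarrow>\<^sub>E Fock P. \<exists>S. is_adjoint P T S},
      mult = compose (Fock P), one = (\<lambda>\<xi>\<in>Fock P. \<xi>), zero = (\<lambda>\<xi>\<in>Fock P. \<lambda>n. 0),
      add = (\<lambda>T S. \<lambda>\<xi>\<in>Fock P. \<lambda>n. T \<xi> n + S \<xi> n),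
      smult = (\<lambda>c T. \<lambda>\<xi>\<in>Fock P. \<lambda>n. cscale c (T \<xi> n)),
      star = (\<lambda>T. THE S. is_adjoint P T S),
      nrm = (\<lambda>T. SUP \<xi>\<in>{\<xi>\<in>Fock P. fock_norm \<xi> \<le> 1}. fock_norm (T \<xi>))\<rparr>"

definition left_action :: "real ^ 'n ^ 'n \<Rightarrow> complex ^ 'n \<Rightarrow> 'n fock_op" where
  "left_action P f = (\<lambda>\<xi>\<in>Fock P. \<lambda>n. diag_mat f ** \<xi> n)"

definition level_proj :: "real ^ 'n ^ 'n \<Rightarrow> nat \<Rightarrow> 'n fock_op" where
  "level_proj P n = (\<lambda>\<xi>\<in>Fock P. \<lambda>m. if m = n then \<xi> m else 0)"

text \<open>The matrix \<open>S\<^sup>(\<^sup>n\<^sup>)\<^sub>A B\<close> for \<open>A\<close> of level \<open>n\<close> and \<open>B\<close> of level \<open>m\<close>.\<close>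

definition arv_prod :: "real ^ 'n ^ 'n \<Rightarrow> nat \<Rightarrow> nat \<Rightarrow>
    complex ^ 'n ^ 'n \<Rightarrow> complex ^ 'n ^ 'n \<Rightarrow> complex ^ 'n ^ 'n" where
  "arv_prod P n m A B = (\<chi> i j.
     if (i, j) \<in> edges (mpow P (n + m))
     then (\<Sum>k\<in>UNIV. complex_of_real (sqrt (mpow P n $ i $ k * mpow P m $ k $ j))
             * A $ i $ k * B $ k $ j) / complex_of_real (sqrt (mpow P (n + m) $ i $ j))
     else 0)"

definition shift :: "real ^ 'n ^ 'n \<Rightarrow> nat \<Rightarrow> complex ^ 'n ^ 'n \<Rightarrow> 'n fock_op" where
  "shift P n A = (\<lambda>\<xi>\<in>Fock P. \<lambda>k. if n \<le> k then arv_prod P n (k - n) A (\<xi> (k - n)) else 0)"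


section \<open>The Toeplitz and Cuntz-Pimsner algebras\<close>

definition toeplitz_alg :: "real ^ 'n ^ 'n \<Rightarrow> 'n fock_op cstar" where
  "toeplitz_alg P = (fock_op_alg P)
     \<lparr>carrier := cstar_generated (fock_op_alg P)
        (range (left_action P) \<union> {shift P n A | n A. A \<in> Arv P n})\<rparr>"

definition toeplitz_ideal :: "real ^ 'n ^ 'n \<Rightarrow> 'n fock_op set" where
  "toeplitz_ideal P = {T \<in> carrier (toeplitz_alg P).
     (\<lambda>n. nrm (toeplitz_alg P) (T \<otimes>\<^bsub>toeplitz_alg P\<^esub> level_proj P n)) \<longlonglongrightarrow> 0}"

definition cuntz_pimsner_alg :: "real ^ 'n ^ 'n \<Rightarrow> 'n fock_op set cstar" where
  "cuntz_pimsner_alg P = cstar_quot (toeplitz_alg P) (toeplitz_ideal P)"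

end

theory Submission
  imports Defs "HOL-Algebra.Subrings"
begin

text \<open>
  Let \<open>r\<close> be the period of \<open>P\<close> and let \<open>c\<close> assign to each state its cyclic class, so that for large
  \<open>n\<close> an edge \<open>(i, j)\<close> of \<open>P\<^sup>n\<close> exists iff \<open>n \<equiv> c j - c i (mod r)\<close>. Write \<open>e(k, m)\<close> for the
  \<open>(k, b)\<close> matrix unit at level \<open>m\<close>. The shift of the matrix unit \<open>(i, k)\<close> at level \<open>n\<close> sends \<open>e(k, m)\<close>
  to \<open>e(i, n + m)\<close> with a weight that tends to \<open>sqrt (P\<^sup>n i k)\<close> as \<open>m\<close> grows, by convergence of the
  chain to equilibrium. The weight is bounded away from \<open>0\<close>, so polar decomposition puts the
  unweighted shift into the Toeplitz algebra, and with it the operator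
  \<open>e(k, m) \<mapsto> e(i, m + r l + c k - c i)\<close> for every integer \<open>l\<close>, which is to have the symbol
  \<open>z\<^sup>l\<close> times the matrix unit \<open>(i, k)\<close>. Every element of the Toeplitz algebra has a continuous matrix
  symbol: up to any \<open>\<epsilon>\<close> it agrees on high levels with the operator of a trigonometric polynomial
  near the symbol. The norm of the operator of a polynomial is comparable to the supremum of the
  polynomial: a discrete Fourier transform gives the upper bound, and wave packets on high levels
  the lower one. Hence the symbol map is a \<open>*\<close>-homomorphism onto the continuous matrix functions, with
  kernel \<open>J(T(P))\<close>.
\<close>


section \<open>Markov chains: periodicity and convergence\<close>

text \<open>The ideal tests an operator one level at a time, and \<open>T Q_n -> 0\<close> does not
  by itself control \<open>T\<close> on vectors spread over many high levels. Two notions bridge the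
  gap. \<open>tail\<close> bounds \<open>T\<close> on all vectors supported above some level;
  polynomial approximation is measured with it. \<open>locally_bounded\<close> does so only for
  vectors occupying at most \<open>N\<close> levels, above a threshold depending on
  \<open>N\<close>; level-wise smallness yields it by adding up \<open>N\<close> small
  contributions. A wave packet occupies \<open>N\<close> levels, so the weaker notion already bounds
  the symbol, and a vanishing symbol gives back the stronger one. Since \<open>tail\<close>
  restricts inputs only, its behaviour under adjoints is unclear, and a symbol is recorded for an
  operator together with its adjoint. Estimates use \<open>hnorm\<close>, the Hilbert space norm
  obtained by summing the columns of the module inner product. As there are finitely many states, it
  is equivalent to the module norm, and estimates may lose factors depending only on the number of
  states: these affect neither limits nor the ideal nor an algebraic isomorphism.\<close>

lemma mpow_add: "mpow P (m + n) = mpow P m ** mpow P n"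
  by (induction m) (simp_all add: matrix_mul_assoc)

lemma mpow_add_nth: "mpow P (m + n) $ i $ j = (\<Sum>k\<in>UNIV. mpow P m $ i $ k * mpow P n $ k $ j)"
  by (simp add: mpow_add matrix_matrix_mult_def)

lemma stochastic_mpow:
  assumes "stochastic P"
  shows "stochastic (mpow P n)"
proof (induction n)
  case 0
  show ?case
    by (auto simp: stochastic_def mat_def)
next
  case (Suc n)
  have "(\<Sum>j\<in>UNIV. \<Sum>k\<in>UNIV. P $ i $ k * mpow P n $ k $ j) = 1" for i
    by (subst sum.swap)
      (use Suc assms in \<open>simp add: stochastic_def flip: sum_distrib_left\<close>)
  then show ?case
    using Suc assms
    by (auto simp: stochastic_def matrix_matrix_mult_def intro!: sum_nonneg)
qed

lemma mpow_nonneg: "stochastic P \<Longrightarrow> 0 \<le> mpow P n $ i $ j"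
  using stochastic_mpow unfolding stochastic_def by blast

lemma mpow_sum: "stochastic P \<Longrightarrow> (\<Sum>j\<in>UNIV. mpow P n $ i $ j) = 1"
  using stochastic_mpow unfolding stochastic_def by blast

lemma mpow_trans:
  assumes "stochastic P" "0 < mpow P m $ i $ k" "0 < mpow P n $ k $ j"
  shows "0 < mpow P (m + n) $ i $ j"
proof -
  have "0 < mpow P m $ i $ k * mpow P n $ k $ j"
    using assms by simp
  also have "\<dots> \<le> mpow P (m + n) $ i $ j"
    unfolding mpow_add_nth
    by (rule member_le_sum) (auto simp: mpow_nonneg[OF assms(1)])
  finally show ?thesis .
qed

section \<open>Walk lengths and cyclic classes\<close>

text \<open>\<open>r\<close> is the smallest gap between two elements of \<open>A\<close>. If some
  \<open>n\<close> in \<open>A\<close> left a remainder modulo \<open>r\<close>, then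
  \<open>n div r * (m + r)\<close> and \<open>n + n div r * m\<close> would both lie in
  \<open>A\<close> and differ by that remainder, a smaller gap. One pair \<open>m\<close>,
  \<open>m + r\<close> realising the gap then generates all large multiples of
  \<open>r\<close>.\<close>

lemma additive_set_structure:
  fixes A :: "nat set"
  assumes add: "\<And>m n. m \<in> A \<Longrightarrow> n \<in> A \<Longrightarrow> m + n \<in> A" and zero: "0 \<in> A"
    and a: "a \<in> A" "0 < a"
  obtains r K where "0 < r" "\<And>n. n \<in> A \<Longrightarrow> r dvd n" "\<And>x. K \<le> x \<Longrightarrow> x * r \<in> A"
proof -
  have mult: "q * n \<in> A" if "n \<in> A" for q n
    by (induction q) (use that zero add in auto)
  define r where "r = (LEAST r. 0 < r \<and> (\<exists>m\<in>A. m + r \<in> A))"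
  have "0 < r \<and> (\<exists>m\<in>A. m + r \<in> A)"
    unfolding r_def by (rule LeastI[of _ a]) (use a zero in \<open>auto intro: bexI[of _ 0]\<close>)
  then obtain m where r: "0 < r" and m: "m \<in> A" "m + r \<in> A"
    by blast
  have dvd: "r dvd n" if "n \<in> A" for n
  proof (rule ccontr)
    assume "\<not> r dvd n"
    then have "0 < n mod r"
      by (simp add: dvd_eq_mod_eq_0)
    moreover have "n div r * (m + r) + n mod r = n + n div r * m"
      by (simp add: algebra_simps)
    then have "\<exists>k\<in>A. k + n mod r \<in> A"
      using mult[OF m(2), of "n div r"] add[OF that mult[OF m(1)]] by metis
    ultimately have "r \<le> n mod r"
      unfolding r_def by (intro Least_le) auto
    then show False
      using mod_less_divisor[OF r, of n] by linarith
  qed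
  obtain q where q: "m = r * q"
    using dvd[OF m(1)] by blast
  have "x * r \<in> A" if "q * q \<le> x" for x
  proof (cases "q = 0")
    case True
    then show ?thesis
      using mult m q by simp
  next
    case False
    \<comment> \<open>\<open>x * r\<close> is to be a sum of \<open>y\<close> terms,
      \<open>s\<close> of them equal to \<open>m + r\<close> and the others to \<open>m\<close>; the
      bound \<open>q * q \<le> x\<close> ensures \<open>s \<le> y\<close>.\<close>
    define y s where "y = x div q" and "s = x mod q"
    have x: "x = q * y + s" and "s < q"
      using False by (simp_all add: y_def s_def)
    moreover have "q \<le> y"
      unfolding y_def using that False by (simp add: less_eq_div_iff_mult_less_eq)
    ultimately obtain t where "y = s + t"
      using le_Suc_ex less_le_trans less_imp_le by metis
    then have "x * r = t * m + s * (m + r)"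
      by (simp add: x q algebra_simps)
    then show ?thesis
      using add mult m by simp
  qed
  then show thesis
    using that r dvd by blast
qed

text \<open>The class of \<open>i\<close> is the length \<open>f i\<close> of some walk from a base
  state \<open>s\<close> to \<open>i\<close>. Lengths of closed walks at \<open>s\<close> form an
  additive set, and its period \<open>r\<close> makes the class independent of the chosen walk
  modulo \<open>r\<close>.\<close>

lemma irreducible_periodic:
  fixes P :: "real ^ 'n ^ 'n"
  assumes P: "stochastic P" "irreducible_mat P"
  obtains r :: nat and c :: "'n \<Rightarrow> int" and N where "0 < r"
    "\<And>n i j. 0 < mpow P n $ i $ j \<Longrightarrow> int r dvd int n - (c j - c i)"
    "\<And>n i j. N \<le> n \<Longrightarrow> int r dvd int n - (c j - c i) \<Longrightarrow> 0 < mpow P n $ i $ j"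
proof -
  note trans = mpow_trans[OF P(1)]
  fix s :: 'n
  define A where "A = {n. 0 < mpow P n $ s $ s}"
  obtain a where a: "1 \<le> a" "0 < mpow P a $ s $ s"
    using P(2) unfolding irreducible_mat_def by blast
  obtain r K where r: "0 < r" and dvd: "\<And>n. n \<in> A \<Longrightarrow> r dvd n"
    and K: "\<And>x. K \<le> x \<Longrightarrow> x * r \<in> A"
  proof (rule additive_set_structure[of A a])
    show "m + n \<in> A" if "m \<in> A" "n \<in> A" for m n
      using trans that unfolding A_def by blast
  qed (use a in \<open>auto simp: A_def mat_def\<close>)
  have ex: "\<exists>n. 0 < mpow P n $ i $ j" for i j
    using P(2) unfolding irreducible_mat_def by blast
  obtain f where f: "\<And>i. 0 < mpow P (f i) $ s $ i"
    using ex[of s] by metis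
  obtain b where b: "\<And>i. 0 < mpow P (b i) $ i $ s"
    using ex[of _ s] by metis
  \<comment> \<open>The closed walk through \<open>i\<close> makes \<open>b i\<close> congruent to
    \<open>- f i\<close>, so walks back to \<open>s\<close> carry the same class information with
    opposite sign.\<close>
  have bf: "int r dvd int (b i) + int (f i)" for i
    using dvd[of "f i + b i"] trans[OF f b, of i] unfolding A_def
    by (metis add.commute mem_Collect_eq of_nat_add of_nat_dvd_iff)
  \<comment> \<open>Room to go from \<open>i\<close> to \<open>s\<close>, to loop there for at least
    \<open>K * r\<close> steps, and to leave for \<open>j\<close>.\<close>
  define N where "N = K * r + Max (range b) + Max (range f)"
  show thesis
  proof (rule that[of r "\<lambda>i. int (f i)" N])
    show "0 < r"
      by fact
    fix n i j
    show "int r dvd int n - (int (f j) - int (f i))" if n: "0 < mpow P n $ i $ j"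
    proof -
      have "f i + n + b j \<in> A"
        unfolding A_def using trans trans[OF f n] b by blast
      then have "int r dvd int (f i) + int n + int (b j)"
        using dvd by (metis of_nat_add of_nat_dvd_iff)
      from dvd_diff[OF this bf[of j]] show ?thesis
        by (simp add: algebra_simps)
    qed
    show "0 < mpow P n $ i $ j" if n: "N \<le> n" "int r dvd int n - (int (f j) - int (f i))"
    proof -
      have le: "b i \<le> Max (range b)" "f j \<le> Max (range f)"
        by auto
      then have nn: "K * r \<le> n - b i - f j" "b i + f j \<le> n"
        using n(1) unfolding N_def by linarith+
      have "int (n - b i - f j) = int n - (int (f j) - int (f i)) - (int (b i) + int (f i))"
        using nn by simp
      then have "r dvd n - b i - f j"
        using dvd_diff[OF n(2) bf[of i]] by (metis of_nat_dvd_iff)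
      then obtain x where x: "n - b i - f j = x * r"
        by (metis dvd_def mult.commute)
      then have "K \<le> x"
        using nn r by simp
      then have "0 < mpow P (x * r) $ s $ s"
        using K unfolding A_def by blast
      then have "0 < mpow P (b i + x * r + f j) $ i $ j"
        using trans b f by blast
      moreover have "b i + x * r + f j = n"
        using nn x by linarith
      ultimately show ?thesis
        by simp
    qed
  qed
qed

section \<open>Convergence to equilibrium\<close>

text \<open>Irreducibility is kept in the form in which it is used: from length \<open>N0\<close>
  on, the edges are exactly those allowed by a congruence. Only differences of the class function
  \<open>c\<close> occur.\<close>

locale chain =
  fixes P :: "real ^ 'n ^ 'n" and r :: nat and c :: "'n \<Rightarrow> int" and N0 :: nat
  assumes stoch: "stochastic P" and r_pos: "0 < r"
    and class_dvd: "\<And>n i j. 0 < mpow P n $ i $ j \<Longrightarrow> int r dvd int n - (c j - c i)"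
    and class_pos: "\<And>n i j. N0 \<le> n \<Longrightarrow> int r dvd int n - (c j - c i) \<Longrightarrow> 0 < mpow P n $ i $ j"
begin

lemma edges_iff: "(i, j) \<in> edges (mpow P n) \<longleftrightarrow> 0 < mpow P n $ i $ j"
  by (simp add: edges_def)

lemma edge_trans:
  "(i, k) \<in> edges (mpow P m) \<Longrightarrow> (k, j) \<in> edges (mpow P n) \<Longrightarrow> (i, j) \<in> edges (mpow P (m + n))"
  using mpow_trans[OF stoch] by (simp add: edges_iff)

text \<open>Column \<open>b\<close> of \<open>P^(n+m)\<close> averages column \<open>b\<close> of
  \<open>P^m\<close> with the weights of row \<open>i\<close> of \<open>P^n\<close>. These weights
  live on states of the class for which the interval is assumed, so an interval once reached is kept
  by all later powers.\<close>

lemma mpow_average: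
  assumes "\<And>k. int r dvd int m - (c b - c k) \<Longrightarrow> mpow P m $ k $ b \<in> {lo..hi}"
    and i: "int r dvd int (n + m) - (c b - c i)"
  shows "mpow P (n + m) $ i $ b \<in> {lo..hi}"
proof -
  have k: "mpow P m $ k $ b \<in> {lo..hi}" if "0 < mpow P n $ i $ k" for k
  proof (rule assms(1))
    show "int r dvd int m - (c b - c k)"
      using dvd_diff[OF i class_dvd[OF that]] by (simp add: algebra_simps)
  qed
  have "mpow P n $ i $ k * lo \<le> mpow P n $ i $ k * mpow P m $ k $ b \<and>
     mpow P n $ i $ k * mpow P m $ k $ b \<le> mpow P n $ i $ k * hi" for k
    using k[of k] mpow_nonneg[OF stoch, of n i k]
    by (cases "mpow P n $ i $ k = 0") (auto intro!: mult_left_mono)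
  then have "(\<Sum>k\<in>UNIV. mpow P n $ i $ k * lo) \<le> mpow P (n + m) $ i $ b"
    "mpow P (n + m) $ i $ b \<le> (\<Sum>k\<in>UNIV. mpow P n $ i $ k * hi)"
    unfolding mpow_add_nth by (auto intro!: sum_mono)
  then show ?thesis
    by (simp add: mpow_sum[OF stoch] flip: sum_distrib_right)
qed

text \<open>Doeblin's contraction: within \<open>N\<close> steps every state of a cyclic class gives weight at least
  \<open>\<epsilon>\<close> to one fixed state of the target class, so the oscillation shrinks by \<open>1 - \<epsilon>\<close>.\<close>

lemma mpow_contract:
  obtains \<epsilon> N where "0 < \<epsilon>" "\<epsilon> \<le> 1" "\<And>b q. \<exists>lo hi. \<epsilon> \<le> lo \<and> hi - lo \<le> (1 - \<epsilon>) ^ q \<and>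
    (\<forall>m\<ge>(q + 1) * N. \<forall>k. int r dvd int m - (c b - c k) \<longrightarrow> mpow P m $ k $ b \<in> {lo..hi})"
proof -
  \<comment> \<open>A multiple of \<open>r\<close>, so that \<open>N\<close> steps preserve cyclic
    classes, and at least \<open>N0\<close>, so that every state of the class is reachable in
    \<open>N\<close> steps.\<close>
  define N where "N = r * (N0 + 1)"
  have N: "N0 \<le> N" "int r dvd int N"
    using mult_le_mono1[of 1 r "N0 + 1"] r_pos unfolding N_def by auto
  \<comment> \<open>The added \<open>1\<close> keeps the set nonempty and gives
    \<open>\<epsilon> \<le> 1\<close>.\<close>
  define W where "W = insert 1 {mpow P N $ i $ k |i k. 0 < mpow P N $ i $ k}"
  define \<epsilon> where "\<epsilon> = Min W"
  have "W \<subseteq> insert 1 ((\<lambda>(i, k). mpow P N $ i $ k) ` UNIV)"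
    unfolding W_def by auto
  then have finW: "finite W"
    by (rule finite_subset) simp
  moreover have "w > 0" if "w \<in> W" for w
    using that unfolding W_def by auto
  moreover have W1: "1 \<in> W"
    by (simp add: W_def)
  ultimately have eps: "0 < \<epsilon>" "\<epsilon> \<le> 1"
    unfolding \<epsilon>_def using Min_in[of W] Min_le[of W 1] by blast+
  have eps_le: "\<epsilon> \<le> mpow P N $ i $ k" if "int r dvd c k - c i" for i k
  proof -
    have "0 < mpow P N $ i $ k"
      by (rule class_pos) (use N that in auto)
    then show ?thesis
      unfolding \<epsilon>_def using finW by (intro Min_le) (auto simp: W_def)
  qed
  have le1: "mpow P m $ k $ b \<le> 1" for m k b
    using member_le_sum[of b UNIV "\<lambda>b. mpow P m $ k $ b"]
    by (simp add: mpow_nonneg[OF stoch] mpow_sum[OF stoch])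
  have ex: "\<exists>lo hi. \<epsilon> \<le> lo \<and> hi - lo \<le> (1 - \<epsilon>) ^ q \<and>
    (\<forall>k. int r dvd int ((q + 1) * N) - (c b - c k) \<longrightarrow> mpow P ((q + 1) * N) $ k $ b \<in> {lo..hi})" for q b
  proof (induction q)
    case 0
    have "\<epsilon> \<le> mpow P N $ k $ b" if "int r dvd int N - (c b - c k)" for k
      using eps_le[of b k] dvd_diff[OF N(2) that] by simp
    then show ?case
      using le1 eps by (intro exI[of _ \<epsilon>] exI[of _ 1]) auto
  next
    case (Suc q)
    define m where "m = (q + 1) * N"
    have mN: "(Suc q + 1) * N = N + m"
      by (simp add: m_def)
    from Suc obtain lo hi where lh: "\<epsilon> \<le> lo" "hi - lo \<le> (1 - \<epsilon>) ^ q"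
      and u: "\<And>k. int r dvd int m - (c b - c k) \<Longrightarrow> mpow P m $ k $ b \<in> {lo..hi}"
      unfolding m_def by blast
    show ?case
    proof (cases "\<exists>k. int r dvd int m - (c b - c k)")
      case False
      have "\<not> int r dvd int (N + m) - (c b - c k)" for k
        using False dvd_diff[OF _ N(2)] by (metis add_diff_cancel_left' add_diff_eq diff_diff_eq of_nat_add)
      then show ?thesis
        using eps unfolding mN by (intro exI[of _ \<epsilon>]) auto
    next
      case True
      then obtain k0 where k0: "int r dvd int m - (c b - c k0)"
        by blast
      \<comment> \<open>The reserved mass \<open>\<epsilon>\<close> sits at the same state
        \<open>k0\<close> whatever the starting state \<open>i\<close>, so it contributes the same
        amount \<open>\<epsilon> * v\<close> to every entry and nothing to the oscillation.\<close>
      define v where "v = mpow P m $ k0 $ b"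
      have v: "lo \<le> v" "v \<le> hi"
        using u[OF k0] by (auto simp: v_def)
      have "mpow P (N + m) $ i $ b \<in> {(1 - \<epsilon>) * lo + \<epsilon> * v..(1 - \<epsilon>) * hi + \<epsilon> * v}"
        if i: "int r dvd int (N + m) - (c b - c i)" for i
      proof -
        define p where "p k = mpow P N $ i $ k" for k
        have "int r dvd c k0 - c i"
          using dvd_diff[OF N(2) dvd_diff[OF i k0]] by (simp add: algebra_simps)
        then have pk0: "\<epsilon> \<le> p k0"
          unfolding p_def by (rule eps_le)
        \<comment> \<open>What is left of row \<open>i\<close> is nonnegative of total mass
          \<open>1 - \<epsilon>\<close>; this is the factor by which the interval shrinks.\<close>
        define p' where "p' k = p k - (if k = k0 then \<epsilon> else 0)" for k
        have p': "0 \<le> p' k" for k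
          using pk0 mpow_nonneg[OF stoch] by (simp add: p'_def p_def)
        have sum_p': "(\<Sum>k\<in>UNIV. p' k) = 1 - \<epsilon>"
          by (simp add: p'_def sum_subtractf p_def mpow_sum[OF stoch])
        have bd: "mpow P m $ k $ b \<in> {lo..hi}" if "p' k \<noteq> 0" for k
        proof -
          have "0 < p k"
            using p'[of k] that eps by (auto simp: p'_def split: if_splits)
          then have "int r dvd int N - (c k - c i)"
            unfolding p_def by (rule class_dvd)
          from u[of k] dvd_diff[OF i this] show ?thesis
            by (simp add: algebra_simps)
        qed
        have "p' k * lo \<le> p' k * mpow P m $ k $ b \<and> p' k * mpow P m $ k $ b \<le> p' k * hi" for k
          using bd[of k] p'[of k] by (cases "p' k = 0") (auto intro!: mult_left_mono)
        then have "(\<Sum>k\<in>UNIV. p' k * lo) \<le> (\<Sum>k\<in>UNIV. p' k * mpow P m $ k $ b)"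
          "(\<Sum>k\<in>UNIV. p' k * mpow P m $ k $ b) \<le> (\<Sum>k\<in>UNIV. p' k * hi)"
          by (auto intro!: sum_mono)
        moreover have "mpow P (N + m) $ i $ b = (\<Sum>k\<in>UNIV. p' k * mpow P m $ k $ b) + \<epsilon> * v"
          unfolding mpow_add_nth p'_def p_def v_def
          by (simp add: left_diff_distrib sum_subtractf if_distrib[of "\<lambda>x. x * _"] cong: if_cong)
        ultimately show ?thesis
          by (simp add: sum_p' flip: sum_distrib_right)
      qed
      moreover have "\<epsilon> \<le> (1 - \<epsilon>) * lo + \<epsilon> * v"
        using lh(1) mult_left_mono[OF v(1), of \<epsilon>] eps unfolding left_diff_distrib by linarith
      moreover have "(1 - \<epsilon>) * hi + \<epsilon> * v - ((1 - \<epsilon>) * lo + \<epsilon> * v) \<le> (1 - \<epsilon>) ^ Suc q"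
        using mult_left_mono[OF lh(2), of "1 - \<epsilon>"] eps by (simp add: algebra_simps)
      ultimately show ?thesis
        unfolding mN by blast
    qed
  qed
  have "\<exists>lo hi. \<epsilon> \<le> lo \<and> hi - lo \<le> (1 - \<epsilon>) ^ q \<and>
    (\<forall>m\<ge>(q + 1) * N. \<forall>k. int r dvd int m - (c b - c k) \<longrightarrow> mpow P m $ k $ b \<in> {lo..hi})" for b q
  proof -
    obtain lo hi where lh: "\<epsilon> \<le> lo" "hi - lo \<le> (1 - \<epsilon>) ^ q"
      and u: "\<And>k. int r dvd int ((q + 1) * N) - (c b - c k) \<Longrightarrow> mpow P ((q + 1) * N) $ k $ b \<in> {lo..hi}"
      using ex by blast
    have "mpow P m $ k $ b \<in> {lo..hi}" if "(q + 1) * N \<le> m" "int r dvd int m - (c b - c k)" for m k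
      using mpow_average[OF u, where n = "m - (q + 1) * N"] that by simp
    then show ?thesis
      using lh by blast
  qed
  then show thesis
    using that eps by blast
qed

text \<open>The interval belongs to the column \<open>b\<close> alone: it contains the entries of
  all later powers from all admissible starting states, hence both entries compared here. Its length
  drops below \<open>e * \<epsilon>\<close> while its left end stays at least
  \<open>\<epsilon>\<close>, so the quotient is near \<open>1\<close>, uniformly in
  \<open>b\<close>.\<close>

lemma mpow_ratio:
  assumes ik: "(i, k) \<in> edges (mpow P n)" and "0 < e"
  shows "\<exists>M. \<forall>m\<ge>M. \<forall>b. (k, b) \<in> edges (mpow P m) \<longrightarrow>
    \<bar>mpow P m $ k $ b / mpow P (n + m) $ i $ b - 1\<bar> < e"
proof -
  obtain \<epsilon> N where eps: "0 < \<epsilon>" "\<epsilon> \<le> 1" and ex: "\<And>b q. \<exists>lo hi. \<epsilon> \<le> lo \<and> hi - lo \<le> (1 - \<epsilon>) ^ q \<and>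
    (\<forall>m\<ge>(q + 1) * N. \<forall>k. int r dvd int m - (c b - c k) \<longrightarrow> mpow P m $ k $ b \<in> {lo..hi})"
    using mpow_contract by metis
  obtain q where q: "(1 - \<epsilon>) ^ q < e * \<epsilon>"
    using real_arch_pow_inv[of "e * \<epsilon>" "1 - \<epsilon>"] eps \<open>0 < e\<close> by auto
  show ?thesis
  proof (intro exI[of _ "(q + 1) * N"] allI impI)
    fix m b
    assume m: "(q + 1) * N \<le> m" and kb: "(k, b) \<in> edges (mpow P m)"
    obtain lo hi where lh: "\<epsilon> \<le> lo" "hi - lo \<le> (1 - \<epsilon>) ^ q"
      and u: "\<And>m k. (q + 1) * N \<le> m \<Longrightarrow> int r dvd int m - (c b - c k) \<Longrightarrow> mpow P m $ k $ b \<in> {lo..hi}"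
      using ex by blast
    define x y where "x = mpow P m $ k $ b" and "y = mpow P (n + m) $ i $ b"
    have "0 < mpow P m $ k $ b" "0 < mpow P (n + m) $ i $ b"
      using kb edge_trans[OF ik kb] by (simp_all add: edges_iff)
    then have "x \<in> {lo..hi}" "y \<in> {lo..hi}"
      unfolding x_def y_def by (rule_tac u; use m class_dvd in force)+
    then have xy: "\<bar>x - y\<bar> \<le> hi - lo" "\<epsilon> \<le> y"
      using lh(1) by auto
    have "x / y - 1 = (x - y) / y"
      using xy eps by (simp add: diff_divide_distrib)
    then have "\<bar>x / y - 1\<bar> = \<bar>x - y\<bar> / y"
      using xy eps by simp
    also have "\<dots> \<le> \<bar>x - y\<bar> / \<epsilon>"
      using xy eps by (intro divide_left_mono) auto
    also have "\<dots> < e"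
      using q lh(2) xy(1) eps by (simp add: divide_less_eq)
    finally show "\<bar>mpow P m $ k $ b / mpow P (n + m) $ i $ b - 1\<bar> < e"
      by (simp add: x_def y_def)
  qed
qed

end


section \<open>The Fock space\<close>

lemma cscale_nth [simp]: "cscale c A $ i $ j = c * A $ i $ j"
  by (simp add: cscale_def)

lemma arv_inner_nth: "arv_inner A B $ j = (\<Sum>i\<in>UNIV. cnj (A $ i $ j) * B $ i $ j)"
  by (simp add: arv_inner_def ctranspose_def matrix_matrix_mult_def)

text \<open>The norm of nested vectors is the Frobenius norm. The sum is arranged by columns because
  the module inner product is taken column by column.\<close>

lemma norm_matrix_sq:
  fixes A :: "complex ^ 'm ^ 'n"
  shows "(norm A)\<^sup>2 = (\<Sum>j\<in>UNIV. \<Sum>i\<in>UNIV. (cmod (A $ i $ j))\<^sup>2)"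
  by (subst sum.swap) (simp add: norm_vec_def L2_set_def sum_nonneg)

lemma norm_column_le:
  fixes A :: "complex ^ 'm ^ 'n"
  shows "L2_set (\<lambda>i. cmod (A $ i $ j)) UNIV \<le> norm A"
proof -
  have "(\<Sum>i\<in>UNIV. (cmod (A $ i $ j))\<^sup>2) \<le> (norm A)\<^sup>2"
    unfolding norm_matrix_sq by (rule member_le_sum) (auto intro: sum_nonneg)
  then show ?thesis
    unfolding L2_set_def by (simp add: real_le_lsqrt)
qed

lemma norm_entry_le:
  fixes A :: "complex ^ 'm ^ 'n"
  shows "cmod (A $ i $ j) \<le> norm A"
  using Finite_Cartesian_Product.norm_nth_le[of "A $ i" j] Finite_Cartesian_Product.norm_nth_le[of A i] by linarith

lemma norm_cscale: "norm (cscale c A) = cmod c * norm A"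
proof -
  have "(norm (cscale c A))\<^sup>2 = (cmod c * norm A)\<^sup>2"
    unfolding norm_matrix_sq power_mult_distrib
    by (simp add: norm_mult power_mult_distrib sum_distrib_left)
  then show ?thesis
    by (simp add: power2_eq_iff_nonneg)
qed

lemma arv_inner_self_nth: "arv_inner A A $ j = of_real (\<Sum>i\<in>UNIV. (cmod (A $ i $ j))\<^sup>2)"
  by (simp add: arv_inner_nth complex_norm_square mult.commute del: of_real_power)

lemma norm_arv_inner_nth: "cmod (arv_inner A B $ j) \<le> norm A * norm B"
proof -
  have "cmod (arv_inner A B $ j) \<le> (\<Sum>i\<in>UNIV. \<bar>cmod (A $ i $ j)\<bar> * \<bar>cmod (B $ i $ j)\<bar>)"
    unfolding arv_inner_nth by (rule order_trans[OF norm_sum]) (simp add: norm_mult)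
  also have "\<dots> \<le> L2_set (\<lambda>i. cmod (A $ i $ j)) UNIV * L2_set (\<lambda>i. cmod (B $ i $ j)) UNIV"
    by (rule L2_set_mult_ineq)
  also have "\<dots> \<le> norm A * norm B"
    by (intro mult_mono norm_column_le) auto
  finally show ?thesis .
qed

lemma summable_vecI:
  fixes f :: "nat \<Rightarrow> complex ^ 'n"
  assumes "\<And>j. summable (\<lambda>m. f m $ j)"
  shows "summable f"
proof -
  have "(\<lambda>n. \<Sum>m<n. f m) \<longlonglongrightarrow> (\<chi> j. \<Sum>m. f m $ j)"
    by (rule vec_tendstoI) (use summable_LIMSEQ[OF assms] in simp)
  then show ?thesis
    unfolding summable_def sums_def by blast
qed

lemma summable_vec_nth:
  fixes f :: "nat \<Rightarrow> complex ^ 'n"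
  shows "summable f \<Longrightarrow> summable (\<lambda>m. f m $ j)"
  using bounded_linear.summable[OF bounded_linear_vec_nth] .

lemma suminf_vec_nth:
  fixes f :: "nat \<Rightarrow> complex ^ 'n"
  shows "summable f \<Longrightarrow> suminf f $ j = (\<Sum>m. f m $ j)"
  using bounded_linear.suminf[OF bounded_linear_vec_nth] .

text \<open>The module series has finitely many columns, each with nonnegative terms, so its
  convergence amounts to square summability of Frobenius norms.\<close>

lemma Fock_iff: "\<xi> \<in> Fock P \<longleftrightarrow> (\<forall>n. \<xi> n \<in> Arv P n) \<and> summable (\<lambda>n. (norm (\<xi> n))\<^sup>2)"
proof -
  have "summable (\<lambda>n. arv_inner (\<xi> n) (\<xi> n)) \<longleftrightarrow> summable (\<lambda>n. (norm (\<xi> n))\<^sup>2)"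
  proof
    assume s: "summable (\<lambda>n. arv_inner (\<xi> n) (\<xi> n))"
    have "summable (\<lambda>n. \<Sum>i\<in>UNIV. (cmod (\<xi> n $ i $ j))\<^sup>2)" for j
      using summable_vec_nth[OF s, of j] unfolding arv_inner_self_nth summable_complex_of_real .
    then show "summable (\<lambda>n. (norm (\<xi> n))\<^sup>2)"
      unfolding norm_matrix_sq by (rule summable_sum)
  next
    assume s: "summable (\<lambda>n. (norm (\<xi> n))\<^sup>2)"
    show "summable (\<lambda>n. arv_inner (\<xi> n) (\<xi> n))"
      by (rule summable_vecI, rule summable_comparison_test'[OF s])
        (use norm_arv_inner_nth in \<open>simp add: power2_eq_square\<close>)
  qed
  then show ?thesis
    by (simp add: Fock_def)
qed

lemma Fock_Arv: "\<xi> \<in> Fock P \<Longrightarrow> \<xi> n \<in> Arv P n"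
  by (simp add: Fock_def)

lemma Arv_eq0: "A \<in> Arv P n \<Longrightarrow> (i, j) \<notin> edges (mpow P n) \<Longrightarrow> A $ i $ j = 0"
  by (simp add: Arv_def)

lemma Fock_eq0: "\<xi> \<in> Fock P \<Longrightarrow> (i, j) \<notin> edges (mpow P n) \<Longrightarrow> \<xi> n $ i $ j = 0"
  by (meson Arv_eq0 Fock_Arv)

section \<open>The Hilbert space norm of the Fock module\<close>

text \<open>This adds the columns of the module inner product instead of taking the largest one.
  Being an l2 norm, it can be estimated on finite sets of levels.\<close>

definition hnorm :: "(nat \<Rightarrow> complex ^ 'n ^ 'n) \<Rightarrow> real" where
  "hnorm \<xi> = sqrt (\<Sum>m. (norm (\<xi> m))\<^sup>2)"

lemma hnorm_sq:
  "\<xi> \<in> Fock P \<Longrightarrow> (hnorm \<xi>)\<^sup>2 = (\<Sum>m. (norm (\<xi> m))\<^sup>2)"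
  unfolding hnorm_def Fock_iff by (subst real_sqrt_pow2) (auto intro: suminf_nonneg)

lemma hnorm_nonneg [simp]: "\<xi> \<in> Fock P \<Longrightarrow> 0 \<le> hnorm \<xi>"
  unfolding hnorm_def Fock_iff by (auto intro: suminf_nonneg)

lemma sum_le_hnorm:
  assumes "\<xi> \<in> Fock P" "finite M"
  shows "(\<Sum>m\<in>M. (norm (\<xi> m))\<^sup>2) \<le> (hnorm \<xi>)\<^sup>2"
  unfolding hnorm_sq[OF assms(1)] using assms by (intro sum_le_suminf) (auto simp: Fock_iff)

lemma norm_le_hnorm:
  assumes "\<xi> \<in> Fock P"
  shows "norm (\<xi> m) \<le> hnorm \<xi>"
proof -
  have "(norm (\<xi> m))\<^sup>2 \<le> (hnorm \<xi>)\<^sup>2"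
    using sum_le_hnorm[OF assms, of "{m}"] by simp
  then show ?thesis
    using assms by (simp add: power2_le_iff_abs_le)
qed

lemma L2_le_hnorm:
  assumes "\<xi> \<in> Fock P" "finite M"
  shows "L2_set (\<lambda>m. norm (\<xi> m)) M \<le> hnorm \<xi>"
  unfolding L2_set_def using sum_le_hnorm[OF assms] assms by (intro real_le_lsqrt) auto

lemma FockI:
  assumes "\<And>m. \<xi> m \<in> Arv P m" "\<And>M. (\<Sum>m<M. (norm (\<xi> m))\<^sup>2) \<le> C"
  shows "\<xi> \<in> Fock P"
  unfolding Fock_iff using assms(1) summableI_nonneg_bounded[OF _ assms(2)] by simp

lemma hnorm_leI:
  assumes "\<xi> \<in> Fock P" "0 \<le> C" "\<And>M. (\<Sum>m<M. (norm (\<xi> m))\<^sup>2) \<le> C\<^sup>2"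
  shows "hnorm \<xi> \<le> C"
proof -
  have "(\<Sum>m. (norm (\<xi> m))\<^sup>2) \<le> C\<^sup>2"
    using assms by (intro suminf_le_const) (auto simp: Fock_iff)
  then show ?thesis
    unfolding hnorm_def using assms by (intro real_le_lsqrt) (auto simp: Fock_iff intro: suminf_nonneg)
qed

lemma hnorm_leI_L2:
  assumes "\<xi> \<in> Fock P" "\<And>M. L2_set (\<lambda>m. norm (\<xi> m)) {..<M} \<le> C"
  shows "hnorm \<xi> \<le> C"
proof (rule hnorm_leI[OF assms(1)])
  show C: "0 \<le> C"
    using assms(2)[of 0] by simp
  show "(\<Sum>m<M. (norm (\<xi> m))\<^sup>2) \<le> C\<^sup>2" for M
    using assms(2)[of M] unfolding L2_set_def
    by (metis C real_sqrt_le_iff real_sqrt_abs abs_of_nonneg)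
qed

lemma Arv_add: "A \<in> Arv P n \<Longrightarrow> B \<in> Arv P n \<Longrightarrow> A + B \<in> Arv P n"
  by (auto simp: Arv_def)

lemma Arv_cscale: "A \<in> Arv P n \<Longrightarrow> cscale c A \<in> Arv P n"
  by (auto simp: Arv_def)

lemma Arv_0 [simp]: "0 \<in> Arv P n"
  by (auto simp: Arv_def)

lemma Fock_0 [simp]: "(\<lambda>m. 0) \<in> Fock P"
  by (simp add: Fock_iff)

lemma hnorm_0 [simp]: "hnorm (\<lambda>m. 0) = 0"
  by (simp add: hnorm_def)

lemma Fock_add:
  assumes "\<xi> \<in> Fock P" "\<eta> \<in> Fock P"
  shows "(\<lambda>m. \<xi> m + \<eta> m) \<in> Fock P" "hnorm (\<lambda>m. \<xi> m + \<eta> m) \<le> hnorm \<xi> + hnorm \<eta>"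
proof -
  have L: "L2_set (\<lambda>m. norm (\<xi> m + \<eta> m)) {..<M} \<le> hnorm \<xi> + hnorm \<eta>" for M
  proof -
    have "L2_set (\<lambda>m. norm (\<xi> m + \<eta> m)) {..<M} \<le> L2_set (\<lambda>m. norm (\<xi> m) + norm (\<eta> m)) {..<M}"
      by (intro L2_set_mono norm_triangle_ineq) auto
    also have "\<dots> \<le> L2_set (\<lambda>m. norm (\<xi> m)) {..<M} + L2_set (\<lambda>m. norm (\<eta> m)) {..<M}"
      by (rule L2_set_triangle_ineq)
    also have "\<dots> \<le> hnorm \<xi> + hnorm \<eta>"
      using assms by (intro add_mono L2_le_hnorm) auto
    finally show ?thesis .
  qed
  show F: "(\<lambda>m. \<xi> m + \<eta> m) \<in> Fock P"
  proof (rule FockI)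
    show "(\<Sum>m<M. (norm (\<xi> m + \<eta> m))\<^sup>2) \<le> (hnorm \<xi> + hnorm \<eta>)\<^sup>2" for M
      using L[of M] unfolding L2_set_def
      by (rule sqrt_le_D)
  qed (use assms in \<open>simp add: Arv_add Fock_Arv\<close>)
  show "hnorm (\<lambda>m. \<xi> m + \<eta> m) \<le> hnorm \<xi> + hnorm \<eta>"
    by (rule hnorm_leI_L2[OF F L])
qed

lemma Fock_cscale:
  assumes "\<xi> \<in> Fock P"
  shows "(\<lambda>m. cscale a (\<xi> m)) \<in> Fock P"
  using assms by (auto simp: Fock_iff Arv_cscale norm_cscale power_mult_distrib intro: summable_mult)

lemma hnorm_cscale:
  assumes "\<xi> \<in> Fock P"
  shows "hnorm (\<lambda>m. cscale a (\<xi> m)) = cmod a * hnorm \<xi>"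
  using assms
  by (simp add: hnorm_def norm_cscale power_mult_distrib suminf_mult Fock_iff real_sqrt_mult)

lemma cscale_minus1: "cscale (- 1) A = - A"
  by (simp add: vec_eq_iff)

lemma Fock_diff:
  assumes "\<xi> \<in> Fock P" "\<eta> \<in> Fock P"
  shows "(\<lambda>m. \<xi> m - \<eta> m) \<in> Fock P" "hnorm (\<lambda>m. \<xi> m - \<eta> m) \<le> hnorm \<xi> + hnorm \<eta>"
  using Fock_add[OF assms(1) Fock_cscale[OF assms(2), of "- 1"]] hnorm_cscale[OF assms(2), of "- 1"]
  by (simp_all add: cscale_minus1)

lemma hnorm_eq_0:
  assumes "\<xi> \<in> Fock P" "hnorm \<xi> \<le> 0"
  shows "\<xi> m = 0"
proof -
  have "norm (\<xi> m) \<le> 0"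
    using norm_le_hnorm[OF assms(1), of m] assms(2) by linarith
  then show ?thesis
    by simp
qed

section \<open>The module inner product\<close>

lemma summable_fock_inner:
  assumes "\<xi> \<in> Fock P" "\<eta> \<in> Fock P"
  shows "summable (\<lambda>m. arv_inner (\<xi> m) (\<eta> m))"
proof (rule summable_vecI)
  fix j
  have "summable (\<lambda>m. (norm (\<xi> m))\<^sup>2 + (norm (\<eta> m))\<^sup>2)"
    using assms by (intro summable_add) (auto simp: Fock_iff)
  moreover have "cmod (arv_inner (\<xi> m) (\<eta> m) $ j) \<le> (norm (\<xi> m))\<^sup>2 + (norm (\<eta> m))\<^sup>2" for m
    using norm_arv_inner_nth[of "\<xi> m" "\<eta> m" j] sum_squares_bound[of "norm (\<xi> m)" "norm (\<eta> m)"]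
      mult_nonneg_nonneg[OF norm_ge_zero norm_ge_zero, of "\<xi> m" "\<eta> m"] by linarith
  ultimately show "summable (\<lambda>m. arv_inner (\<xi> m) (\<eta> m) $ j)"
    by (rule summable_comparison_test')
qed

lemma fock_inner_nth:
  assumes "\<xi> \<in> Fock P" "\<eta> \<in> Fock P"
  shows "fock_inner \<xi> \<eta> $ j = (\<Sum>m. arv_inner (\<xi> m) (\<eta> m) $ j)"
  unfolding fock_inner_def by (rule suminf_vec_nth[OF summable_fock_inner[OF assms]])

lemma fock_inner_le:
  assumes "\<xi> \<in> Fock P" "\<eta> \<in> Fock P"
  shows "cmod (fock_inner \<xi> \<eta> $ j) \<le> hnorm \<xi> * hnorm \<eta>"
proof (rule tendsto_upperbound)
  have "(\<lambda>M. \<Sum>m<M. arv_inner (\<xi> m) (\<eta> m) $ j) \<longlonglongrightarrow> fock_inner \<xi> \<eta> $ j"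
    unfolding fock_inner_nth[OF assms]
    by (rule summable_LIMSEQ[OF summable_vec_nth[OF summable_fock_inner[OF assms]]])
  then show "(\<lambda>M. cmod (\<Sum>m<M. arv_inner (\<xi> m) (\<eta> m) $ j)) \<longlonglongrightarrow> cmod (fock_inner \<xi> \<eta> $ j)"
    by (rule tendsto_norm)
  have "cmod (\<Sum>m<M. arv_inner (\<xi> m) (\<eta> m) $ j) \<le> hnorm \<xi> * hnorm \<eta>" for M
  proof -
    have "cmod (\<Sum>m<M. arv_inner (\<xi> m) (\<eta> m) $ j) \<le> (\<Sum>m<M. \<bar>norm (\<xi> m)\<bar> * \<bar>norm (\<eta> m)\<bar>)"
      by (rule order_trans[OF norm_sum]) (auto intro!: sum_mono norm_arv_inner_nth)
    also have "\<dots> \<le> L2_set (\<lambda>m. norm (\<xi> m)) {..<M} * L2_set (\<lambda>m. norm (\<eta> m)) {..<M}"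
      by (rule L2_set_mult_ineq)
    also have "\<dots> \<le> hnorm \<xi> * hnorm \<eta>"
      using assms by (intro mult_mono L2_le_hnorm) auto
    finally show ?thesis .
  qed
  then show "\<forall>\<^sub>F M in sequentially. cmod (\<Sum>m<M. arv_inner (\<xi> m) (\<eta> m) $ j) \<le> hnorm \<xi> * hnorm \<eta>"
    by simp
qed simp

lemma fock_inner_cnj:
  assumes "\<xi> \<in> Fock P" "\<eta> \<in> Fock P"
  shows "fock_inner \<eta> \<xi> $ j = cnj (fock_inner \<xi> \<eta> $ j)"
proof -
  have "arv_inner (\<eta> m) (\<xi> m) $ j = cnj (arv_inner (\<xi> m) (\<eta> m) $ j)" for m
    by (simp add: arv_inner_nth mult.commute)
  then show ?thesis
    using bounded_linear.suminf[OF bounded_linear_cnj summable_vec_nth[OF summable_fock_inner[OF assms], of j]]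
    unfolding fock_inner_nth[OF assms] fock_inner_nth[OF assms(2,1)] by simp
qed

lemma fock_inner_add_right:
  assumes "\<xi> \<in> Fock P" "\<eta> \<in> Fock P" "\<zeta> \<in> Fock P"
  shows "fock_inner \<xi> (\<lambda>m. \<eta> m + \<zeta> m) = fock_inner \<xi> \<eta> + fock_inner \<xi> \<zeta>"
proof -
  have "arv_inner (\<xi> m) (\<eta> m + \<zeta> m) = arv_inner (\<xi> m) (\<eta> m) + arv_inner (\<xi> m) (\<zeta> m)" for m
    by (simp add: vec_eq_iff arv_inner_nth algebra_simps sum.distrib)
  then show ?thesis
    unfolding fock_inner_def
    using suminf_add[OF summable_fock_inner[OF assms(1,2)] summable_fock_inner[OF assms(1,3)]]
    by simp
qed

lemma fock_inner_cscale_right: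
  assumes "\<xi> \<in> Fock P" "\<eta> \<in> Fock P"
  shows "fock_inner \<xi> (\<lambda>m. cscale a (\<eta> m)) $ j = a * fock_inner \<xi> \<eta> $ j"
proof -
  have "arv_inner (\<xi> m) (cscale a (\<eta> m)) $ j = a * arv_inner (\<xi> m) (\<eta> m) $ j" for m
    by (simp add: arv_inner_nth sum_distrib_left mult_ac)
  then show ?thesis
    using assms
    by (simp add: fock_inner_nth[OF assms] fock_inner_nth[OF assms(1) Fock_cscale]
        suminf_mult summable_vec_nth summable_fock_inner)
qed

lemma fock_inner_add_left:
  assumes "\<xi> \<in> Fock P" "\<eta> \<in> Fock P" "\<zeta> \<in> Fock P"
  shows "fock_inner (\<lambda>m. \<eta> m + \<zeta> m) \<xi> = fock_inner \<eta> \<xi> + fock_inner \<zeta> \<xi>"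
  unfolding vec_eq_iff
  by (simp add: fock_inner_cnj[OF assms(1) Fock_add(1)[OF assms(2,3)]] fock_inner_cnj[OF assms(1,2)]
      fock_inner_cnj[OF assms(1,3)] fock_inner_add_right[OF assms])

lemma fock_inner_cscale_left:
  assumes "\<xi> \<in> Fock P" "\<eta> \<in> Fock P"
  shows "fock_inner (\<lambda>m. cscale a (\<eta> m)) \<xi> $ j = cnj a * fock_inner \<eta> \<xi> $ j"
  by (simp add: fock_inner_cnj[OF assms(1) Fock_cscale[OF assms(2)]] fock_inner_cnj[OF assms]
      fock_inner_cscale_right[OF assms])

text \<open>Inner products with these matrix units read off coordinates. This separates points of
  the Fock module and, through an adjoint, makes the coordinates of \<open>T \<xi>\<close>
  continuous in \<open>\<xi>\<close>.\<close>

definition unit_vec :: "nat \<Rightarrow> 'n \<Rightarrow> 'n \<Rightarrow> nat \<Rightarrow> complex ^ 'n ^ 'n" where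
  "unit_vec m i j = (\<lambda>n. \<chi> a b. if n = m \<and> a = i \<and> b = j then 1 else 0)"

lemma unit_vec_Fock:
  assumes "(i, j) \<in> edges (mpow P m)"
  shows "unit_vec m i j \<in> Fock P"
proof -
  have "(norm (unit_vec m i j n))\<^sup>2 = 0" if "n \<notin> {m}" for n
    using that by (auto simp: unit_vec_def norm_matrix_sq)
  then have "summable (\<lambda>n. (norm (unit_vec m i j n))\<^sup>2)"
    by (intro summable_finite[of "{m}"]) auto
  moreover have "unit_vec m i j n \<in> Arv P n" for n
    using assms by (auto simp: Arv_def unit_vec_def)
  ultimately show ?thesis
    by (simp add: Fock_iff)
qed

lemma fock_inner_unit_vec:
  assumes "\<xi> \<in> Fock P" "(i, j) \<in> edges (mpow P m)"
  shows "fock_inner (unit_vec m i j) \<xi> $ j = \<xi> m $ i $ j"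
proof -
  have *: "arv_inner (unit_vec m i j n) (\<xi> n) $ j = (if n = m then \<xi> m $ i $ j else 0)" for n
    by (auto simp: unit_vec_def arv_inner_nth if_distrib[of cnj] if_distrib[of "\<lambda>x. x * _"] cong: if_cong)
  show ?thesis
    unfolding fock_inner_nth[OF unit_vec_Fock[OF assms(2)] assms(1)] *
    by (rule sums_unique[symmetric, OF sums_single])
qed

lemma Fock_eqI:
  assumes "\<xi> \<in> Fock P" "\<eta> \<in> Fock P" "\<And>\<zeta>. \<zeta> \<in> Fock P \<Longrightarrow> fock_inner \<zeta> \<xi> = fock_inner \<zeta> \<eta>"
  shows "\<xi> = \<eta>"
proof -
  have "\<xi> m $ i $ j = \<eta> m $ i $ j" for m i j
  proof (cases "(i, j) \<in> edges (mpow P m)")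
    case True
    then show ?thesis
      using assms fock_inner_unit_vec unit_vec_Fock by metis
  next
    case False
    then show ?thesis
      using assms Fock_eq0 by metis
  qed
  then show ?thesis
    by (auto simp: vec_eq_iff)
qed

section \<open>Completeness of the Fock module\<close>

text \<open>The limit is taken level by level. The Cauchy estimate holds on every finite set of
  levels, passes to the limit there, and only afterwards is the number of levels let go to
  infinity.\<close>

lemma Fock_complete:
  assumes X: "\<And>n. X n \<in> Fock P"
    and cauchy: "\<And>e. 0 < e \<Longrightarrow> \<exists>N. \<forall>m\<ge>N. \<forall>n\<ge>N. hnorm (\<lambda>l. X m l - X n l) \<le> e"
  shows "\<exists>x\<in>Fock P. (\<forall>l. (\<lambda>n. X n l) \<longlonglongrightarrow> x l) \<and> (\<lambda>n. hnorm (\<lambda>l. X n l - x l)) \<longlonglongrightarrow> 0"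
proof -
  note D = Fock_diff[OF X X]
  have "Cauchy (\<lambda>n. X n l)" for l
    unfolding Cauchy_def
  proof (intro allI impI)
    fix e :: real
    assume "0 < e"
    then obtain N where N: "\<And>m n. m \<ge> N \<Longrightarrow> n \<ge> N \<Longrightarrow> hnorm (\<lambda>l. X m l - X n l) \<le> e / 2"
      using cauchy[of "e / 2"] by auto
    have "dist (X m l) (X n l) < e" if "m \<ge> N" "n \<ge> N" for m n
      using norm_le_hnorm[OF D(1)[of m n], of l] N[OF that] \<open>0 < e\<close> by (simp add: dist_norm)
    then show "\<exists>M. \<forall>m\<ge>M. \<forall>n\<ge>M. dist (X m l) (X n l) < e"
      by blast
  qed
  then obtain x where x: "\<And>l. (\<lambda>n. X n l) \<longlonglongrightarrow> x l"
    unfolding Cauchy_convergent_iff convergent_def by metis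
  have xA: "x l \<in> Arv P l" for l
  proof -
    have "x l $ i $ j = 0" if "(i, j) \<notin> edges (mpow P l)" for i j
    proof -
      have "(\<lambda>n. X n l $ i $ j) \<longlonglongrightarrow> x l $ i $ j"
        by (intro tendsto_vec_nth x)
      moreover have "(\<lambda>n. X n l $ i $ j) = (\<lambda>n. 0)"
        using Fock_eq0[OF X that] by auto
      ultimately show ?thesis
        by (simp add: LIMSEQ_const_iff)
    qed
    then show ?thesis
      by (simp add: Arv_def)
  qed
  have bd: "L2_set (\<lambda>l. norm (X n l - x l)) {..<M} \<le> e"
    if "\<And>m. m \<ge> N \<Longrightarrow> hnorm (\<lambda>l. X n l - X m l) \<le> e" for n N M e
  proof (rule tendsto_upperbound)
    show "(\<lambda>m. L2_set (\<lambda>l. norm (X n l - X m l)) {..<M}) \<longlonglongrightarrow> L2_set (\<lambda>l. norm (X n l - x l)) {..<M}"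
      unfolding L2_set_def by (intro tendsto_intros x)
    show "\<forall>\<^sub>F m in sequentially. L2_set (\<lambda>l. norm (X n l - X m l)) {..<M} \<le> e"
      using eventually_ge_at_top[of N]
      by eventually_elim (rule order_trans[OF L2_le_hnorm[OF D(1)] that], simp_all)
  qed simp
  obtain N where N: "\<And>m. m \<ge> N \<Longrightarrow> hnorm (\<lambda>l. X N l - X m l) \<le> 1"
    using cauchy[of 1] by auto
  have "(\<lambda>l. X N l - x l) \<in> Fock P"
  proof (rule FockI)
    show "X N l - x l \<in> Arv P l" for l
      using Fock_Arv[OF X[of N], of l] xA[of l] by (auto simp: Arv_def)
    show "(\<Sum>l<M. (norm (X N l - x l))\<^sup>2) \<le> 1\<^sup>2" for M
      using bd[of N N 1 M, OF N] unfolding L2_set_def by (rule sqrt_le_D)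
  qed
  from Fock_diff(1)[OF X[of N] this] have xF: "x \<in> Fock P"
    by simp
  have "(\<lambda>n. hnorm (\<lambda>l. X n l - x l)) \<longlonglongrightarrow> 0"
  proof (rule LIMSEQ_I)
    fix e :: real
    assume "0 < e"
    then obtain N where N: "\<And>m n. m \<ge> N \<Longrightarrow> n \<ge> N \<Longrightarrow> hnorm (\<lambda>l. X m l - X n l) \<le> e / 2"
      using cauchy[of "e / 2"] by auto
    have "hnorm (\<lambda>l. X n l - x l) \<le> e / 2" if "n \<ge> N" for n
      by (rule hnorm_leI_L2[OF Fock_diff(1)[OF X xF]]) (rule bd[of N n], rule N[OF that])
    then show "\<exists>N. \<forall>n\<ge>N. norm (hnorm (\<lambda>l. X n l - x l) - 0) < e"
      using \<open>0 < e\<close> hnorm_nonneg[OF Fock_diff(1)[OF X xF]] by (intro exI[of _ N]) fastforce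
  qed
  then show ?thesis
    using xF x by blast
qed


section \<open>Adjointable operators\<close>

abbreviation ops :: "real ^ 'n ^ 'n \<Rightarrow> 'n fock_op set" where
  "ops P \<equiv> carrier (fock_op_alg P)"

lemma ops_iff: "T \<in> ops P \<longleftrightarrow> T \<in> Fock P \<rightarrow>\<^sub>E Fock P \<and> (\<exists>S. is_adjoint P T S)"
  by (simp add: fock_op_alg_def)

lemma ops_Fock [simp]: "T \<in> ops P \<Longrightarrow> \<xi> \<in> Fock P \<Longrightarrow> T \<xi> \<in> Fock P"
  by (auto simp: ops_iff)

lemma ops_eqI:
  assumes "T \<in> Fock P \<rightarrow>\<^sub>E Fock P" "S \<in> Fock P \<rightarrow>\<^sub>E Fock P" "\<And>\<xi>. \<xi> \<in> Fock P \<Longrightarrow> T \<xi> = S \<xi>"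
  shows "T = S"
  using assms by (intro PiE_ext) auto

lemma op_add_apply: "\<xi> \<in> Fock P \<Longrightarrow> (T \<oplus>\<^bsub>fock_op_alg P\<^esub> S) \<xi> = (\<lambda>n. T \<xi> n + S \<xi> n)"
  and op_mult_apply: "\<xi> \<in> Fock P \<Longrightarrow> (T \<otimes>\<^bsub>fock_op_alg P\<^esub> S) \<xi> = T (S \<xi>)"
  and op_smult_apply: "\<xi> \<in> Fock P \<Longrightarrow> (a \<odot>\<^bsub>fock_op_alg P\<^esub> T) \<xi> = (\<lambda>n. cscale a (T \<xi> n))"
  and op_zero_apply: "\<xi> \<in> Fock P \<Longrightarrow> \<zero>\<^bsub>fock_op_alg P\<^esub> \<xi> = (\<lambda>n. 0)"
  and op_one_apply: "\<xi> \<in> Fock P \<Longrightarrow> \<one>\<^bsub>fock_op_alg P\<^esub> \<xi> = \<xi>"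
  by (simp_all add: fock_op_alg_def compose_def)

lemmas op_apply = op_add_apply op_mult_apply op_smult_apply op_zero_apply op_one_apply

lemma op_PiE:
  "T \<in> Fock P \<rightarrow>\<^sub>E Fock P \<Longrightarrow> S \<in> Fock P \<rightarrow>\<^sub>E Fock P \<Longrightarrow> T \<oplus>\<^bsub>fock_op_alg P\<^esub> S \<in> Fock P \<rightarrow>\<^sub>E Fock P"
  "T \<in> Fock P \<rightarrow>\<^sub>E Fock P \<Longrightarrow> S \<in> Fock P \<rightarrow>\<^sub>E Fock P \<Longrightarrow> T \<otimes>\<^bsub>fock_op_alg P\<^esub> S \<in> Fock P \<rightarrow>\<^sub>E Fock P"
  "T \<in> Fock P \<rightarrow>\<^sub>E Fock P \<Longrightarrow> a \<odot>\<^bsub>fock_op_alg P\<^esub> T \<in> Fock P \<rightarrow>\<^sub>E Fock P"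
  "\<zero>\<^bsub>fock_op_alg P\<^esub> \<in> Fock P \<rightarrow>\<^sub>E Fock P"
  "\<one>\<^bsub>fock_op_alg P\<^esub> \<in> Fock P \<rightarrow>\<^sub>E Fock P"
  by (auto simp: fock_op_alg_def compose_def intro!: Fock_add(1) Fock_cscale)

lemma is_adjoint_iff:
  assumes "T \<in> Fock P \<rightarrow>\<^sub>E Fock P"
  shows "is_adjoint P T S \<longleftrightarrow> S \<in> Fock P \<rightarrow>\<^sub>E Fock P \<and>
     (\<forall>\<xi>\<in>Fock P. \<forall>\<eta>\<in>Fock P. \<forall>j. fock_inner (T \<xi>) \<eta> $ j = fock_inner \<xi> (S \<eta>) $ j)"
  by (simp add: is_adjoint_def vec_eq_iff)

lemma is_adjoint_sym:
  assumes "is_adjoint P T S" "T \<in> Fock P \<rightarrow>\<^sub>E Fock P"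
  shows "is_adjoint P S T"
proof -
  have S: "S \<in> Fock P \<rightarrow>\<^sub>E Fock P"
    and eq: "\<And>\<xi> \<eta>. \<xi> \<in> Fock P \<Longrightarrow> \<eta> \<in> Fock P \<Longrightarrow> fock_inner (T \<xi>) \<eta> = fock_inner \<xi> (S \<eta>)"
    using assms(1) by (auto simp: is_adjoint_def)
  have "fock_inner (S \<xi>) \<eta> $ j = fock_inner \<xi> (T \<eta>) $ j" if "\<xi> \<in> Fock P" "\<eta> \<in> Fock P" for \<xi> \<eta> j
  proof -
    have "S \<xi> \<in> Fock P" "T \<eta> \<in> Fock P"
      using that S assms(2) by auto
    then show ?thesis
      using that eq by (simp add: fock_inner_cnj[of _ P \<xi>] fock_inner_cnj[of \<eta> P])
  qed
  then show ?thesis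
    using S assms(2) by (simp add: is_adjoint_iff)
qed

lemma is_adjoint_ops:
  assumes "is_adjoint P T S" "T \<in> Fock P \<rightarrow>\<^sub>E Fock P"
  shows "T \<in> ops P" "S \<in> ops P"
  using assms is_adjoint_sym[OF assms] by (auto simp: ops_iff is_adjoint_def)

lemma is_adjoint_unique:
  assumes "is_adjoint P T S" "is_adjoint P T S'"
  shows "S = S'"
proof (rule ops_eqI)
  show "S \<in> Fock P \<rightarrow>\<^sub>E Fock P" "S' \<in> Fock P \<rightarrow>\<^sub>E Fock P"
    using assms by (auto simp: is_adjoint_def)
  then show "S \<xi> = S' \<xi>" if "\<xi> \<in> Fock P" for \<xi>
    using assms that by (intro Fock_eqI[of _ P]) (auto simp: is_adjoint_def)
qed

lemma star_eqI: "is_adjoint P T S \<Longrightarrow> star (fock_op_alg P) T = S"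
  using is_adjoint_unique by (auto simp: fock_op_alg_def intro!: the_equality)

lemma ops_star:
  assumes "T \<in> ops P"
  shows "is_adjoint P T (star (fock_op_alg P) T)" "is_adjoint P (star (fock_op_alg P) T) T"
    "star (fock_op_alg P) T \<in> ops P"
proof -
  obtain S where S: "is_adjoint P T S" and T: "T \<in> Fock P \<rightarrow>\<^sub>E Fock P"
    using assms by (auto simp: ops_iff)
  show "is_adjoint P T (star (fock_op_alg P) T)" "is_adjoint P (star (fock_op_alg P) T) T"
    "star (fock_op_alg P) T \<in> ops P"
    unfolding star_eqI[OF S] using S is_adjoint_sym[OF S T] is_adjoint_ops(2)[OF S T] by auto
qed

text \<open>The vector \<open>T \<xi>\<close> is determined by its inner products, and the adjoint
  moves \<open>T\<close> to the other argument, where linearity in \<open>\<xi>\<close> is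
  visible.\<close>

lemma op_linear:
  assumes "T \<in> ops P" "\<xi> \<in> Fock P"
  shows "\<eta> \<in> Fock P \<Longrightarrow> T (\<lambda>m. \<xi> m + \<eta> m) = (\<lambda>m. T \<xi> m + T \<eta> m)"
    and "T (\<lambda>m. cscale a (\<xi> m)) = (\<lambda>m. cscale a (T \<xi> m))"
proof -
  obtain S where adj: "is_adjoint P S T" and S: "S \<in> Fock P \<rightarrow>\<^sub>E Fock P"
    using ops_star(2,3)[OF assms(1)] ops_iff by blast
  have eq: "fock_inner \<zeta> (T \<xi>) = fock_inner (S \<zeta>) \<xi>" "S \<zeta> \<in> Fock P"
    if "\<xi> \<in> Fock P" "\<zeta> \<in> Fock P" for \<zeta> \<xi>
    using adj that S by (auto simp: is_adjoint_def)
  show "T (\<lambda>m. \<xi> m + \<eta> m) = (\<lambda>m. T \<xi> m + T \<eta> m)" if "\<eta> \<in> Fock P"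
    by (rule Fock_eqI[of _ P])
      (use assms that in \<open>simp_all add: Fock_add eq fock_inner_add_right[of _ P]\<close>)
  show "T (\<lambda>m. cscale a (\<xi> m)) = (\<lambda>m. cscale a (T \<xi> m))"
    by (rule Fock_eqI[of _ P])
      (use assms in \<open>simp_all add: Fock_cscale eq vec_eq_iff fock_inner_cscale_right[of _ P]\<close>)
qed

lemma op_zero:
  assumes "T \<in> ops P"
  shows "T (\<lambda>m. 0) = (\<lambda>m. 0)"
proof -
  have *: "cscale 0 A = 0" for A :: "complex ^ 'n ^ 'n"
    by (simp add: vec_eq_iff)
  show ?thesis
    using op_linear(2)[OF assms Fock_0, of 0] by (simp add: *)
qed

lemma op_diff:
  assumes "T \<in> ops P" "\<xi> \<in> Fock P" "\<eta> \<in> Fock P"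
  shows "T (\<lambda>m. \<xi> m - \<eta> m) = (\<lambda>m. T \<xi> m - T \<eta> m)"
  using op_linear(1)[OF assms(1,2) Fock_cscale[OF assms(3)], of "- 1"]
    op_linear(2)[OF assms(1,3), of "- 1"] by (simp add: cscale_minus1)

lemma is_adjoint_add:
  assumes "is_adjoint P T S" "is_adjoint P T' S'" "T \<in> ops P" "T' \<in> ops P"
  shows "is_adjoint P (T \<oplus>\<^bsub>fock_op_alg P\<^esub> T') (S \<oplus>\<^bsub>fock_op_alg P\<^esub> S')"
proof -
  have "S \<in> ops P" "S' \<in> ops P"
    using assms is_adjoint_ops(2) ops_iff by blast+
  then have "S \<in> ops P \<and> S' \<in> ops P \<and> S \<in> Fock P \<rightarrow>\<^sub>E Fock P \<and> S' \<in> Fock P \<rightarrow>\<^sub>E Fock P"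
    using ops_iff by blast
  then show ?thesis
    using assms unfolding is_adjoint_def
    by (auto simp: op_PiE op_apply fock_inner_add_right[of _ P] fock_inner_add_left[of _ P])
qed

lemma is_adjoint_smult:
  assumes "is_adjoint P T S" "T \<in> ops P"
  shows "is_adjoint P (a \<odot>\<^bsub>fock_op_alg P\<^esub> T) (cnj a \<odot>\<^bsub>fock_op_alg P\<^esub> S)"
proof -
  have "S \<in> ops P"
    using assms is_adjoint_ops(2) ops_iff by blast+
  then show ?thesis
    using assms unfolding is_adjoint_def
    by (auto simp: op_PiE op_apply vec_eq_iff fock_inner_cscale_right[of _ P] fock_inner_cscale_left[of _ P])
qed

lemma is_adjoint_mult:
  assumes "is_adjoint P T S" "is_adjoint P T' S'" "T \<in> ops P" "T' \<in> ops P"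
  shows "is_adjoint P (T \<otimes>\<^bsub>fock_op_alg P\<^esub> T') (S' \<otimes>\<^bsub>fock_op_alg P\<^esub> S)"
proof -
  have "S \<in> ops P" "S' \<in> ops P"
    using assms is_adjoint_ops(2) ops_iff by blast+
  then have "S \<in> ops P \<and> S' \<in> ops P \<and> S \<in> Fock P \<rightarrow>\<^sub>E Fock P \<and> S' \<in> Fock P \<rightarrow>\<^sub>E Fock P"
    using ops_iff by blast
  then show ?thesis
    using assms unfolding is_adjoint_def
    by (auto simp: op_PiE op_apply)
qed

lemma is_adjoint_zero: "is_adjoint P \<zero>\<^bsub>fock_op_alg P\<^esub> \<zero>\<^bsub>fock_op_alg P\<^esub>"
proof -
  have "arv_inner 0 A = 0" "arv_inner A 0 = 0" for A :: "complex ^ 'a ^ 'a"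
    by (simp_all add: vec_eq_iff arv_inner_nth)
  then show ?thesis
    unfolding is_adjoint_def by (auto simp: op_apply op_PiE fock_inner_def fock_op_alg_def)
qed

lemma is_adjoint_one: "is_adjoint P \<one>\<^bsub>fock_op_alg P\<^esub> \<one>\<^bsub>fock_op_alg P\<^esub>"
  unfolding is_adjoint_def by (auto simp: op_apply fock_op_alg_def)

lemma op_closed [simp]:
  "T \<in> ops P \<Longrightarrow> S \<in> ops P \<Longrightarrow> T \<oplus>\<^bsub>fock_op_alg P\<^esub> S \<in> ops P"
  "T \<in> ops P \<Longrightarrow> S \<in> ops P \<Longrightarrow> T \<otimes>\<^bsub>fock_op_alg P\<^esub> S \<in> ops P"
  "T \<in> ops P \<Longrightarrow> a \<odot>\<^bsub>fock_op_alg P\<^esub> T \<in> ops P"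
  "\<zero>\<^bsub>fock_op_alg P\<^esub> \<in> ops P" "\<one>\<^bsub>fock_op_alg P\<^esub> \<in> ops P"
  subgoal
    using is_adjoint_add ops_star(1) op_PiE(1) by (metis ops_iff)
  subgoal
    using is_adjoint_mult ops_star(1) op_PiE(2) by (metis ops_iff)
  subgoal
    using is_adjoint_smult ops_star(1) op_PiE(3) by (metis ops_iff)
  subgoal
    using is_adjoint_ops(1)[OF is_adjoint_zero] is_adjoint_zero unfolding is_adjoint_def by blast
  subgoal
    using is_adjoint_ops(1)[OF is_adjoint_one] is_adjoint_one unfolding is_adjoint_def by blast
  done

lemma ops_PiE: "T \<in> ops P \<Longrightarrow> T \<in> Fock P \<rightarrow>\<^sub>E Fock P"
  by (simp add: ops_iff)

lemma ring_fock_op_alg: "ring (fock_op_alg P)"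
proof (rule ringI)
  have ext: "T = S" if "T \<in> ops P" "S \<in> ops P" "\<And>\<xi>. \<xi> \<in> Fock P \<Longrightarrow> T \<xi> = S \<xi>" for T S
    using that ops_eqI ops_PiE by metis
  have neg: "(- 1) \<odot>\<^bsub>fock_op_alg P\<^esub> T \<oplus>\<^bsub>fock_op_alg P\<^esub> T = \<zero>\<^bsub>fock_op_alg P\<^esub>" if "T \<in> ops P" for T
    by (rule ext) (use that in \<open>simp_all add: op_apply cscale_minus1\<close>)
  show "abelian_group (fock_op_alg P)"
  proof (rule abelian_groupI)
    show "\<exists>S\<in>ops P. S \<oplus>\<^bsub>fock_op_alg P\<^esub> T = \<zero>\<^bsub>fock_op_alg P\<^esub>" if "T \<in> ops P" for T
      using neg[OF that] that by (intro bexI[of _ "(- 1) \<odot>\<^bsub>fock_op_alg P\<^esub> T"]) auto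
  qed (auto intro!: ext simp: op_apply add_ac)
  show "monoid (fock_op_alg P)"
    by (rule monoidI) (auto intro!: ext simp: op_apply)
  fix T S R
  assume "T \<in> ops P" "S \<in> ops P" "R \<in> ops P"
  then show "(T \<oplus>\<^bsub>fock_op_alg P\<^esub> S) \<otimes>\<^bsub>fock_op_alg P\<^esub> R =
      T \<otimes>\<^bsub>fock_op_alg P\<^esub> R \<oplus>\<^bsub>fock_op_alg P\<^esub> S \<otimes>\<^bsub>fock_op_alg P\<^esub> R"
    "R \<otimes>\<^bsub>fock_op_alg P\<^esub> (T \<oplus>\<^bsub>fock_op_alg P\<^esub> S) =
      R \<otimes>\<^bsub>fock_op_alg P\<^esub> T \<oplus>\<^bsub>fock_op_alg P\<^esub> R \<otimes>\<^bsub>fock_op_alg P\<^esub> S"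
    by (auto intro!: ext simp: op_apply op_linear)
qed

section \<open>Boundedness of adjointable operators\<close>

abbreviation op_minus :: "real ^ 'n ^ 'n \<Rightarrow> 'n fock_op \<Rightarrow> 'n fock_op \<Rightarrow> 'n fock_op" where
  "op_minus P T S \<equiv> T \<oplus>\<^bsub>fock_op_alg P\<^esub> (- 1) \<odot>\<^bsub>fock_op_alg P\<^esub> S"

lemma op_minus_apply:
  "\<xi> \<in> Fock P \<Longrightarrow> op_minus P T S \<xi> = (\<lambda>m. T \<xi> m - S \<xi> m)"
  by (simp add: op_apply cscale_minus1)

text \<open>A predicate instead of a norm, so that bounds can be combined without first knowing that
  a supremum exists.\<close>

definition opbound :: "real ^ 'n ^ 'n \<Rightarrow> 'n fock_op \<Rightarrow> real \<Rightarrow> bool" where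
  "opbound P T B \<longleftrightarrow> 0 \<le> B \<and> (\<forall>\<xi>\<in>Fock P. hnorm (T \<xi>) \<le> B * hnorm \<xi>)"

lemma opboundD: "opbound P T B \<Longrightarrow> \<xi> \<in> Fock P \<Longrightarrow> hnorm (T \<xi>) \<le> B * hnorm \<xi>"
  by (simp add: opbound_def)

lemma opbound_mono: "opbound P T B \<Longrightarrow> B \<le> C \<Longrightarrow> opbound P T C"
  unfolding opbound_def by (meson hnorm_nonneg mult_right_mono order_trans)

text \<open>A coordinate of \<open>T \<xi>\<close> is the inner product of \<open>\<xi>\<close> with
  the image of a matrix unit under the adjoint; Cauchy-Schwarz bounds it. The Baire argument below
  rests on this.\<close>

lemma op_coordinate_bounded:
  assumes "T \<in> ops P"
  obtains C where "0 \<le> C" "\<And>\<xi>. \<xi> \<in> Fock P \<Longrightarrow> cmod (T \<xi> m $ i $ j) \<le> C * hnorm \<xi>"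
proof (cases "(i, j) \<in> edges (mpow P m)")
  case True
  define S where "S = star (fock_op_alg P) T"
  define u where "u = S (unit_vec m i j)"
  have u: "unit_vec m i j \<in> Fock P"
    by (rule unit_vec_Fock[OF True])
  have adj: "is_adjoint P S T" and uF: "u \<in> Fock P"
    using ops_star[OF assms] u unfolding S_def u_def by auto
  have "cmod (T \<xi> m $ i $ j) \<le> hnorm u * hnorm \<xi>" if "\<xi> \<in> Fock P" for \<xi>
  proof -
    have "T \<xi> m $ i $ j = fock_inner (unit_vec m i j) (T \<xi>) $ j"
      using fock_inner_unit_vec[OF ops_Fock[OF assms that] True] by simp
    also have "\<dots> = fock_inner u \<xi> $ j"
      using adj that u unfolding is_adjoint_def u_def by simp
    finally show ?thesis
      using fock_inner_le[OF uF that] by simp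
  qed
  then show thesis
    using that uF hnorm_nonneg by blast
next
  case False
  then show thesis
    using that[of 0] Fock_eq0[OF ops_Fock[OF assms] False] by simp
qed

lemma hnorm_minus_commute: "hnorm (\<lambda>m. \<xi> m - \<eta> m) = hnorm (\<lambda>m. \<eta> m - \<xi> m)"
  by (simp add: hnorm_def norm_minus_commute)

text \<open>The default \<open>0\<close> keeps the distance nonnegative outside the Fock module,
  where \<open>hnorm\<close> has no meaning; \<open>Metric_space\<close> asks for nonnegativity and
  symmetry everywhere.\<close>

definition fock_dist :: "real ^ 'n ^ 'n \<Rightarrow> (nat \<Rightarrow> complex ^ 'n ^ 'n) \<Rightarrow> (nat \<Rightarrow> complex ^ 'n ^ 'n) \<Rightarrow> real" where
  "fock_dist P \<xi> \<eta> = (if \<xi> \<in> Fock P \<and> \<eta> \<in> Fock P then hnorm (\<lambda>m. \<xi> m - \<eta> m) else 0)"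

lemma fock_dist: "\<xi> \<in> Fock P \<Longrightarrow> \<eta> \<in> Fock P \<Longrightarrow> fock_dist P \<xi> \<eta> = hnorm (\<lambda>m. \<xi> m - \<eta> m)"
  by (simp add: fock_dist_def)

lemma Metric_space_Fock: "Metric_space (Fock P) (fock_dist P)"
proof
  fix \<xi> \<eta> \<zeta> :: "nat \<Rightarrow> complex ^ 'a ^ 'a"
  show "0 \<le> fock_dist P \<xi> \<eta>"
    unfolding fock_dist_def using Fock_diff(1) by fastforce
  show "fock_dist P \<xi> \<eta> = fock_dist P \<eta> \<xi>"
    unfolding fock_dist_def by (subst hnorm_minus_commute) simp
  show "fock_dist P \<xi> \<eta> = 0 \<longleftrightarrow> \<xi> = \<eta>" if "\<xi> \<in> Fock P" "\<eta> \<in> Fock P"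
  proof
    show "\<xi> = \<eta>" if "fock_dist P \<xi> \<eta> = 0"
      using that hnorm_eq_0[OF Fock_diff(1)[OF \<open>\<xi> \<in> Fock P\<close> \<open>\<eta> \<in> Fock P\<close>]]
      by (auto simp: fock_dist[OF \<open>\<xi> \<in> Fock P\<close> \<open>\<eta> \<in> Fock P\<close>])
  qed (auto simp: fock_dist_def)
  show "fock_dist P \<xi> \<zeta> \<le> fock_dist P \<xi> \<eta> + fock_dist P \<eta> \<zeta>"
    if "\<xi> \<in> Fock P" "\<eta> \<in> Fock P" "\<zeta> \<in> Fock P"
    using that Fock_add(2)[OF Fock_diff(1)[OF that(1,2)] Fock_diff(1)[OF that(2,3)]]
    by (simp add: fock_dist)
qed

text \<open>The Hellinger-Toeplitz theorem, by the Baire category theorem.\<close>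

lemma op_bounded:
  assumes T: "T \<in> ops P"
  shows "\<exists>B. opbound P T B"
proof -
  interpret Metric_space "Fock P" "fock_dist P"
    by (rule Metric_space_Fock)
  have complete: mcomplete
    unfolding mcomplete_def
  proof (intro allI impI)
    fix X
    assume X: "MCauchy X"
    then have XF: "X n \<in> Fock P" for n
      by (auto simp: MCauchy_def)
    have "\<exists>N. \<forall>m\<ge>N. \<forall>n\<ge>N. hnorm (\<lambda>l. X m l - X n l) \<le> e" if "0 < e" for e
    proof -
      have "\<forall>e>0. \<exists>N. \<forall>m n. N \<le> m \<longrightarrow> N \<le> n \<longrightarrow> fock_dist P (X m) (X n) < e"
        using X unfolding MCauchy_def by (rule conjunct2)
      from this[rule_format, OF that] obtain N
        where N: "\<forall>m n. N \<le> m \<longrightarrow> N \<le> n \<longrightarrow> fock_dist P (X m) (X n) < e" ..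
      have "hnorm (\<lambda>l. X m l - X n l) \<le> e" if "N \<le> m" "N \<le> n" for m n
        using N[rule_format, OF that] XF by (simp add: fock_dist)
      then show ?thesis
        by blast
    qed
    from Fock_complete[OF XF this] obtain x where x: "x \<in> Fock P"
      and lim: "(\<lambda>n. hnorm (\<lambda>l. X n l - x l)) \<longlonglongrightarrow> 0"
      by blast
    then have "limitin mtopology X x sequentially"
      using XF by (simp add: limitin_metric_dist_null fock_dist)
    then show "\<exists>x. limitin mtopology X x sequentially"
      by blast
  qed
  \<comment> \<open>These sets are closed: coordinates of \<open>T\<close> are continuous, and a
    bound on \<open>hnorm\<close> is a bound on each finite partial sum of coordinates. Together
    they exhaust the complete space, so one of them has interior points.\<close>
  define A where "A k = {\<xi> \<in> Fock P. hnorm (T \<xi>) \<le> real k}" for k :: nat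
  have closed: "closedin mtopology (A k)" for k
    unfolding closedin_metric
  proof (intro conjI allI impI)
    show "A k \<subseteq> Fock P"
      by (auto simp: A_def)
    fix x
    assume x: "x \<in> Fock P - A k"
    show "\<exists>r>0. disjnt (A k) (mball x r)"
    proof (rule ccontr)
      assume "\<not> (\<exists>r>0. disjnt (A k) (mball x r))"
      then have "\<not> disjnt (A k) (mball x (inverse (Suc n)))" for n
        by (metis inverse_positive_iff_positive of_nat_0_less_iff zero_less_Suc)
      then have "\<exists>y. y \<in> A k \<and> y \<in> mball x (inverse (Suc n))" for n
        unfolding disjnt_iff by blast
      then obtain y where y: "\<And>n. y n \<in> A k" "\<And>n. y n \<in> mball x (inverse (Suc n))"
        by metis
      have xF: "x \<in> Fock P" and yF: "y n \<in> Fock P" for n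
        using x y by (auto simp: A_def)
      have yx: "hnorm (\<lambda>m. y n m - x m) \<le> inverse (Suc n)" for n
        using y(2)[of n] xF yF[of n] by (simp add: fock_dist hnorm_minus_commute[of x])
      have lim0: "(\<lambda>n. hnorm (\<lambda>m. y n m - x m)) \<longlonglongrightarrow> 0"
        by (rule tendsto_sandwich[OF _ _ tendsto_const LIMSEQ_inverse_real_of_nat])
          (use yx hnorm_nonneg[OF Fock_diff(1)[OF yF xF]] in auto)
      have lim: "(\<lambda>n. T (y n) m) \<longlonglongrightarrow> T x m" for m
      proof (intro vec_tendstoI)
        fix i j
        obtain C where C: "\<And>\<xi>. \<xi> \<in> Fock P \<Longrightarrow> cmod (T \<xi> m $ i $ j) \<le> C * hnorm \<xi>"
          using op_coordinate_bounded[OF T] by metis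
        have le: "cmod (T (y n) m $ i $ j - T x m $ i $ j) \<le> C * hnorm (\<lambda>m. y n m - x m)" for n
          using C[OF Fock_diff(1)[OF yF xF]] by (simp add: op_diff[OF T yF xF])
        have "(\<lambda>n. C * hnorm (\<lambda>m. y n m - x m)) \<longlonglongrightarrow> 0"
          using tendsto_mult_left[OF lim0, of C] by simp
        then have "(\<lambda>n. T (y n) m $ i $ j - T x m $ i $ j) \<longlonglongrightarrow> 0"
          by (rule Lim_null_comparison[OF always_eventually[OF allI[OF le]]])
        then show "(\<lambda>n. T (y n) m $ i $ j) \<longlonglongrightarrow> T x m $ i $ j"
          by (rule Lim_null[THEN iffD2])
      qed
      have "hnorm (T x) \<le> real k"
      proof (rule hnorm_leI[OF ops_Fock[OF T xF]])
        show "(\<Sum>m<M. (norm (T x m))\<^sup>2) \<le> (real k)\<^sup>2" for M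
        proof (rule tendsto_upperbound)
          show "(\<lambda>n. \<Sum>m<M. (norm (T (y n) m))\<^sup>2) \<longlonglongrightarrow> (\<Sum>m<M. (norm (T x m))\<^sup>2)"
            by (intro tendsto_intros lim)
          have "(\<Sum>m<M. (norm (T (y n) m))\<^sup>2) \<le> (real k)\<^sup>2" for n
          proof -
            have "(\<Sum>m<M. (norm (T (y n) m))\<^sup>2) \<le> (hnorm (T (y n)))\<^sup>2"
              by (rule sum_le_hnorm[OF ops_Fock[OF T yF]]) simp
            also have "\<dots> \<le> (real k)\<^sup>2"
              using y(1)[of n] hnorm_nonneg[OF ops_Fock[OF T yF]] by (intro power_mono) (auto simp: A_def)
            finally show ?thesis .
          qed
          then show "\<forall>\<^sub>F n in sequentially. (\<Sum>m<M. (norm (T (y n) m))\<^sup>2) \<le> (real k)\<^sup>2"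
            by simp
        qed simp
      qed simp
      then show False
        using x by (auto simp: A_def)
    qed
  qed
  have "\<exists>k. mtopology interior_of A k \<noteq> {}"
  proof (rule ccontr)
    assume "\<nexists>k. mtopology interior_of A k \<noteq> {}"
    then have "mtopology interior_of \<Union> (range A) = {}"
      using closed by (intro metric_Baire_category_alt[OF complete]) auto
    moreover have "\<Union> (range A) = Fock P"
      using real_arch_simple by (fastforce simp: A_def)
    moreover have "mtopology interior_of Fock P = Fock P"
      using interior_of_topspace[of mtopology] by simp
    ultimately show False
      using Fock_0[of P] by auto
  qed
  then obtain k x where "x \<in> mtopology interior_of A k"
    by blast
  moreover have "openin mtopology (mtopology interior_of A k)" "mtopology interior_of A k \<subseteq> A k"
    by (rule openin_interior_of, rule interior_of_subset)
  ultimately obtain r where r: "0 < r" "mball x r \<subseteq> A k" and xA: "x \<in> A k"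
    unfolding openin_mtopology by blast
  then have xF: "x \<in> Fock P"
    by (simp add: A_def)
  \<comment> \<open>Scaled to norm \<open>r / 2\<close>, the vector is a difference of two points of
    the ball around \<open>x\<close>, where \<open>T\<close> is bounded by \<open>k\<close>. Its
    image has norm at most \<open>2 * k\<close>, and undoing the scaling by
    \<open>r / (2 * h)\<close> gives the constant.\<close>
  have "hnorm (T \<xi>) \<le> 4 * k / r * hnorm \<xi>" if \<xi>: "\<xi> \<in> Fock P" for \<xi>
  proof (cases "hnorm \<xi> \<le> 0")
    case True
    then have "\<xi> = (\<lambda>m. 0)"
      using hnorm_eq_0[OF \<xi>] by auto
    then show ?thesis
      by (simp add: op_zero[OF T])
  next
    case False
    define h s where "h = hnorm \<xi>" and "s = r / (2 * h)"
    have hs: "0 < h" "0 < s"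
      using False r by (simp_all add: h_def s_def)
    define \<zeta> where "\<zeta> = (\<lambda>m. cscale (of_real s) (\<xi> m))"
    define \<eta> where "\<eta> = (\<lambda>m. x m + \<zeta> m)"
    have "hnorm \<zeta> = s * h"
      unfolding \<zeta>_def hnorm_cscale[OF \<xi>] using hs by (simp add: h_def)
    then have \<zeta>: "\<zeta> \<in> Fock P" "hnorm \<zeta> = r / 2"
      using hs Fock_cscale[OF \<xi>] by (auto simp: \<zeta>_def s_def)
    have \<eta>F: "\<eta> \<in> Fock P"
      unfolding \<eta>_def by (rule Fock_add(1)[OF xF \<zeta>(1)])
    have "fock_dist P x \<eta> = hnorm \<zeta>"
      unfolding fock_dist[OF xF \<eta>F] hnorm_minus_commute[of x] by (simp add: \<eta>_def)
    then have "\<eta> \<in> A k"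
      using r \<zeta> xF \<eta>F by auto
    have "s * hnorm (T \<xi>) = hnorm (T \<zeta>)"
      unfolding \<zeta>_def using op_linear(2)[OF T \<xi>] hs T \<xi> by (simp add: hnorm_cscale[of _ P])
    also have "T \<zeta> = (\<lambda>m. T \<eta> m - T x m)"
      using op_diff[OF T \<eta>F xF] by (simp add: \<eta>_def)
    also have "hnorm \<dots> \<le> hnorm (T \<eta>) + hnorm (T x)"
      by (rule Fock_diff(2)[OF ops_Fock[OF T \<eta>F] ops_Fock[OF T xF]])
    also have "\<dots> \<le> k + k"
      using \<open>\<eta> \<in> A k\<close> xA by (simp add: A_def)
    finally show ?thesis
      using hs r by (simp add: s_def field_simps flip: h_def)
  qed
  then have "opbound P T (4 * k / r)"
    using r by (simp add: opbound_def)
  then show ?thesis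
    by blast
qed

section \<open>The module norm against the Hilbert space norm\<close>

lemma linf_norm_nth: "cmod (f $ j) \<le> linf_norm f"
  unfolding linf_norm_def by (rule cSUP_upper) auto

lemma fock_norm_le_hnorm:
  assumes "\<xi> \<in> Fock P"
  shows "fock_norm \<xi> \<le> hnorm \<xi>"
proof -
  have "linf_norm (fock_inner \<xi> \<xi>) \<le> (hnorm \<xi>)\<^sup>2"
    unfolding linf_norm_def power2_eq_square
    by (rule cSUP_least) (use fock_inner_le[OF assms assms] in auto)
  then show ?thesis
    unfolding fock_norm_def using hnorm_nonneg[OF assms] by (intro real_le_lsqrt) auto
qed

text \<open>The squared Hilbert space norm is the trace of the module inner product, whose largest
  diagonal entry is the squared module norm; hence the factor \<open>sqrt (CARD('n))\<close> between
  the two norms.\<close>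

lemma hnorm_sq_eq_inner:
  assumes "\<xi> \<in> Fock P"
  shows "of_real ((hnorm \<xi>)\<^sup>2) = (\<Sum>j\<in>UNIV. fock_inner \<xi> \<xi> $ j)"
proof -
  note s = summable_vec_nth[OF summable_fock_inner[OF assms assms]]
  have "of_real ((hnorm \<xi>)\<^sup>2) = (\<Sum>m. of_real ((norm (\<xi> m))\<^sup>2) :: complex)"
    unfolding hnorm_sq[OF assms] using assms by (intro suminf_of_real) (auto simp: Fock_iff)
  also have "\<dots> = (\<Sum>m. \<Sum>j\<in>UNIV. arv_inner (\<xi> m) (\<xi> m) $ j)"
    by (simp add: arv_inner_self_nth norm_matrix_sq)
  also have "\<dots> = (\<Sum>j\<in>UNIV. fock_inner \<xi> \<xi> $ j)"
    by (simp add: suminf_sum[OF s] fock_inner_nth[OF assms assms])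
  finally show ?thesis .
qed

lemma hnorm_le_fock_norm:
  fixes \<xi> :: "nat \<Rightarrow> complex ^ 'n ^ 'n"
  assumes "\<xi> \<in> Fock P"
  shows "hnorm \<xi> \<le> sqrt (CARD('n)) * fock_norm \<xi>"
proof -
  have "(hnorm \<xi>)\<^sup>2 = cmod (\<Sum>j\<in>UNIV. fock_inner \<xi> \<xi> $ j)"
    unfolding hnorm_sq_eq_inner[OF assms, symmetric] norm_of_real by simp
  also have "\<dots> \<le> (\<Sum>j\<in>(UNIV :: 'n set). linf_norm (fock_inner \<xi> \<xi>))"
    by (rule order_trans[OF norm_sum sum_mono]) (rule linf_norm_nth)
  finally show ?thesis
    unfolding fock_norm_def by (simp add: real_le_rsqrt flip: real_sqrt_mult)
qed

lemma fock_norm_nonneg: "0 \<le> fock_norm \<xi>"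
  unfolding fock_norm_def using order_trans[OF norm_ge_zero linf_norm_nth] by simp

lemma nrm_fock_op_alg:
  "nrm (fock_op_alg P) T = (SUP \<xi>\<in>{\<xi>\<in>Fock P. fock_norm \<xi> \<le> 1}. fock_norm (T \<xi>))"
  by (simp add: fock_op_alg_def)

lemma fock_norm_zero: "fock_norm (\<lambda>m. 0) \<le> 1"
  using fock_norm_le_hnorm[OF Fock_0] by (smt (verit) hnorm_0)

text \<open>\<open>nrm\<close> is a real supremum, informative only over a set that is bounded
  above. The bound \<open>B\<close> supplies this, which is why boundedness of adjointable operators
  comes first.\<close>

lemma nrm_le_opbound:
  fixes P :: "real ^ 'n ^ 'n"
  assumes T: "T \<in> ops P" and B: "opbound P T B"
  shows "nrm (fock_op_alg P) T \<le> B * sqrt (CARD('n))" "0 \<le> nrm (fock_op_alg P) T"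
    and "\<xi> \<in> Fock P \<Longrightarrow> fock_norm \<xi> \<le> 1 \<Longrightarrow> fock_norm (T \<xi>) \<le> nrm (fock_op_alg P) T"
proof -
  have bd: "fock_norm (T \<xi>) \<le> B * sqrt (CARD('n))" if "\<xi> \<in> Fock P" "fock_norm \<xi> \<le> 1" for \<xi>
  proof -
    have "fock_norm (T \<xi>) \<le> B * hnorm \<xi>"
      using fock_norm_le_hnorm[OF ops_Fock[OF T that(1)]] opboundD[OF B that(1)] by linarith
    also have "\<dots> \<le> B * (sqrt (CARD('n)) * 1)"
    proof (rule mult_left_mono)
      show "hnorm \<xi> \<le> sqrt (CARD('n)) * 1"
        by (rule order_trans[OF hnorm_le_fock_norm[OF that(1)] mult_left_mono[OF that(2)]]) simp
    qed (use B in \<open>simp add: opbound_def\<close>)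
    finally show ?thesis
      by simp
  qed
  show "nrm (fock_op_alg P) T \<le> B * sqrt (CARD('n))"
    unfolding nrm_fock_op_alg
    by (rule cSUP_least) (use bd fock_norm_zero Fock_0 in blast)+
  show le: "fock_norm (T \<xi>) \<le> nrm (fock_op_alg P) T" if "\<xi> \<in> Fock P" "fock_norm \<xi> \<le> 1" for \<xi>
    unfolding nrm_fock_op_alg
    by (rule cSUP_upper, use that in simp, rule bdd_aboveI2[where M = "B * sqrt (CARD('n))"])
      (use bd in blast)
  show "0 \<le> nrm (fock_op_alg P) T"
    using order_trans[OF fock_norm_nonneg le[OF Fock_0 fock_norm_zero]] .
qed

lemma opbound_nrm:
  fixes P :: "real ^ 'n ^ 'n"
  assumes T: "T \<in> ops P"
  shows "opbound P T (sqrt (CARD('n)) * nrm (fock_op_alg P) T)"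
  unfolding opbound_def
proof (intro conjI ballI)
  obtain B where B: "opbound P T B"
    using op_bounded[OF T] by blast
  note nrm = nrm_le_opbound[OF T B]
  show "0 \<le> sqrt (CARD('n)) * nrm (fock_op_alg P) T"
    using nrm(2) by simp
  fix \<xi>
  assume \<xi>: "\<xi> \<in> Fock P"
  show "hnorm (T \<xi>) \<le> sqrt (CARD('n)) * nrm (fock_op_alg P) T * hnorm \<xi>"
  proof (cases "hnorm \<xi> \<le> 0")
    case True
    then have "\<xi> = (\<lambda>m. 0)"
      using hnorm_eq_0[OF \<xi>] by auto
    then show ?thesis
      by (simp add: op_zero[OF T])
  next
    case False
    define h where "h = hnorm \<xi>"
    define \<eta> where "\<eta> = (\<lambda>m. cscale (of_real (1 / h)) (\<xi> m))"
    have h: "0 < h"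
      using False by (simp add: h_def)
    have \<eta>: "\<eta> \<in> Fock P" "hnorm \<eta> = 1"
      unfolding \<eta>_def hnorm_cscale[OF \<xi>] using h Fock_cscale[OF \<xi>]
      by (simp_all add: norm_divide flip: h_def)
    have "1 / h * hnorm (T \<xi>) = hnorm (T \<eta>)"
      unfolding \<eta>_def using op_linear(2)[OF T \<xi>] h T \<xi> by (simp add: hnorm_cscale[of _ P] norm_divide)
    also have "\<dots> \<le> sqrt (CARD('n)) * fock_norm (T \<eta>)"
      using hnorm_le_fock_norm[OF ops_Fock[OF T \<eta>(1)]] .
    also have "\<dots> \<le> sqrt (CARD('n)) * nrm (fock_op_alg P) T"
      using nrm(3)[OF \<eta>(1)] fock_norm_le_hnorm[OF \<eta>(1)] \<eta>(2) by (intro mult_left_mono) auto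
    finally show ?thesis
      using h by (simp add: field_simps flip: h_def)
  qed
qed

text \<open>Norm closure of subalgebras and membership in the ideal are both stated with
  \<open>nrm\<close>. This is the passage to \<open>opbound\<close>; the factors between the norms
  disappear in the choice of \<open>e\<close>.\<close>

lemma nrm_tendsto_0_iff:
  fixes T :: "nat \<Rightarrow> 'n::finite fock_op"
  assumes T: "\<And>n. T n \<in> ops P"
  shows "(\<lambda>n. nrm (fock_op_alg P) (T n)) \<longlonglongrightarrow> 0 \<longleftrightarrow> (\<forall>e>0. \<exists>N. \<forall>n\<ge>N. opbound P (T n) e)"
proof (intro iffI allI impI)
  let ?d = "sqrt (CARD('n))"
  have d: "0 < ?d"
    by simp
  {
    fix e :: real
    assume lim: "(\<lambda>n. nrm (fock_op_alg P) (T n)) \<longlonglongrightarrow> 0" and "0 < e"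
    then obtain N where N: "\<And>n. n \<ge> N \<Longrightarrow> \<bar>nrm (fock_op_alg P) (T n)\<bar> < e / ?d"
      using d unfolding LIMSEQ_iff by (metis diff_zero divide_pos_pos real_norm_def)
    have "opbound P (T n) e" if "n \<ge> N" for n
    proof -
      have "?d * nrm (fock_op_alg P) (T n) \<le> e"
        using N[OF that] d by (simp add: field_simps abs_less_iff)
      then show ?thesis
        by (rule opbound_mono[OF opbound_nrm[OF T]])
    qed
    then show "\<exists>N. \<forall>n\<ge>N. opbound P (T n) e"
      by blast
  next
    assume small: "\<forall>e>0. \<exists>N. \<forall>n\<ge>N. opbound P (T n) e"
    show "(\<lambda>n. nrm (fock_op_alg P) (T n)) \<longlonglongrightarrow> 0"
    proof (rule LIMSEQ_I)
      fix e :: real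
      assume "0 < e"
      then have "0 < e / 2 / ?d"
        by simp
      then obtain N where N: "\<And>n. n \<ge> N \<Longrightarrow> opbound P (T n) (e / 2 / ?d)"
        using small by blast
      have "norm (nrm (fock_op_alg P) (T n) - 0) < e" if "n \<ge> N" for n
        using nrm_le_opbound(1,2)[OF T N[OF that]] \<open>0 < e\<close> by simp
      then show "\<exists>N. \<forall>n\<ge>N. norm (nrm (fock_op_alg P) (T n) - 0) < e"
        by blast
    qed
  }
qed


section \<open>Weighted shifts\<close>

lemma ops_sum_mem:
  assumes X: "X \<subseteq> ops P" "\<zero>\<^bsub>fock_op_alg P\<^esub> \<in> X"
      "\<And>T S. T \<in> X \<Longrightarrow> S \<in> X \<Longrightarrow> T \<oplus>\<^bsub>fock_op_alg P\<^esub> S \<in> X"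
    and "finite I" "\<And>x. x \<in> I \<Longrightarrow> T x \<in> X"
  shows "(\<lambda>\<xi>\<in>Fock P. \<lambda>m. \<Sum>x\<in>I. T x \<xi> m) \<in> X"
  using assms(4,5)
proof (induction I)
  case empty
  then show ?case
    using X(2) by (simp add: fock_op_alg_def restrict_def)
next
  case (insert x I)
  have eq: "(\<lambda>\<xi>\<in>Fock P. \<lambda>m. \<Sum>x\<in>insert x I. T x \<xi> m) =
    T x \<oplus>\<^bsub>fock_op_alg P\<^esub> (\<lambda>\<xi>\<in>Fock P. \<lambda>m. \<Sum>x\<in>I. T x \<xi> m)"
    using insert.hyps by (auto simp: fock_op_alg_def fun_eq_iff)
  then show ?case
    unfolding eq by (intro X(3) insert.IH insert.prems) auto
qed

text \<open>Row \<open>k\<close> at level \<open>m - s\<close> is moved to row \<open>i\<close> at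
  level \<open>m\<close>, column by column. Weights are indexed by the target level, and
  \<open>s\<close> may be negative, so that adjoints have the same form. Only the target edge is
  tested: at the source the vector vanishes off the edges anyway. The generators are finite sums of
  such operators.\<close>

definition wshift :: "real ^ 'n ^ 'n \<Rightarrow> 'n \<Rightarrow> 'n \<Rightarrow> int \<Rightarrow> (nat \<Rightarrow> 'n \<Rightarrow> complex) \<Rightarrow> 'n fock_op" where
  "wshift P i k s w = (\<lambda>\<xi>\<in>Fock P. \<lambda>m. \<chi> a b.
     if a = i \<and> s \<le> int m \<and> (i, b) \<in> edges (mpow P m) then w m b * \<xi> (nat (int m - s)) $ k $ b else 0)"

text \<open>Only weights between an existing source entry and an existing target entry are bounded;
  the others never act.\<close>

definition wbound :: "real ^ 'n ^ 'n \<Rightarrow> 'n \<Rightarrow> 'n \<Rightarrow> int \<Rightarrow> (nat \<Rightarrow> 'n \<Rightarrow> complex) \<Rightarrow> real \<Rightarrow> bool" where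
  "wbound P i k s w B \<longleftrightarrow> 0 \<le> B \<and> (\<forall>m b. s \<le> int m \<longrightarrow> (i, b) \<in> edges (mpow P m) \<longrightarrow>
     (k, b) \<in> edges (mpow P (nat (int m - s))) \<longrightarrow> cmod (w m b) \<le> B)"

lemma wshift_nth:
  "\<xi> \<in> Fock P \<Longrightarrow> wshift P i k s w \<xi> m $ a $ b =
     (if a = i \<and> s \<le> int m \<and> (i, b) \<in> edges (mpow P m) then w m b * \<xi> (nat (int m - s)) $ k $ b else 0)"
  by (simp add: wshift_def)

lemma norm_wshift_level:
  assumes \<xi>: "\<xi> \<in> Fock P" and B: "0 \<le> B"
    and w: "\<And>b. s \<le> int m \<Longrightarrow> (i, b) \<in> edges (mpow P m) \<Longrightarrow> \<xi> (nat (int m - s)) $ k $ b \<noteq> 0 \<Longrightarrow> cmod (w m b) \<le> B"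
  shows "(norm (wshift P i k s w \<xi> m))\<^sup>2 \<le> (if s \<le> int m then B\<^sup>2 * (norm (\<xi> (nat (int m - s))))\<^sup>2 else 0)"
proof (cases "s \<le> int m")
  case True
  let ?x = "\<lambda>b. cmod (\<xi> (nat (int m - s)) $ k $ b)"
  have "(\<Sum>a\<in>UNIV. (cmod (wshift P i k s w \<xi> m $ a $ b))\<^sup>2) \<le> B\<^sup>2 * (?x b)\<^sup>2" for b
  proof -
    have "cmod (wshift P i k s w \<xi> m $ i $ b) \<le> B * ?x b"
    proof (cases "?x b = 0")
      case True
      then show ?thesis
        using \<xi> by (simp add: wshift_nth)
    next
      case False
      then show ?thesis
        using \<xi> True B w[of b] by (auto simp: wshift_nth norm_mult intro: mult_right_mono)
    qed
    then have "(cmod (wshift P i k s w \<xi> m $ i $ b))\<^sup>2 \<le> (B * ?x b)\<^sup>2"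
      by (intro power_mono) auto
    moreover have "(\<Sum>a\<in>UNIV. (cmod (wshift P i k s w \<xi> m $ a $ b))\<^sup>2) =
        (cmod (wshift P i k s w \<xi> m $ i $ b))\<^sup>2"
      by (subst sum.remove[of _ i]) (auto simp: wshift_nth[OF \<xi>] intro!: sum.neutral)
    ultimately show ?thesis
      by (simp add: power_mult_distrib)
  qed
  then have "(norm (wshift P i k s w \<xi> m))\<^sup>2 \<le> (\<Sum>b\<in>UNIV. B\<^sup>2 * (?x b)\<^sup>2)"
    unfolding norm_matrix_sq by (intro sum_mono)
  also have "\<dots> \<le> B\<^sup>2 * (norm (\<xi> (nat (int m - s))))\<^sup>2"
    unfolding norm_matrix_sq sum_distrib_left[symmetric]
    by (intro mult_left_mono sum_mono member_le_sum) auto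
  finally show ?thesis
    using True by simp
next
  case False
  then have "wshift P i k s w \<xi> m = 0"
    using \<xi> by (simp add: wshift_nth vec_eq_iff)
  then show ?thesis
    using False by simp
qed

lemma sum_shift_le_hnorm:
  assumes "\<xi> \<in> Fock P"
  shows "(\<Sum>m<M. if s \<le> int m then (norm (\<xi> (nat (int m - s))))\<^sup>2 else 0) \<le> (hnorm \<xi>)\<^sup>2"
proof -
  have inj: "inj_on (\<lambda>m. nat (int m - s)) {m. m < M \<and> s \<le> int m}"
    by (auto simp: inj_on_def)
  have "(\<Sum>m<M. if s \<le> int m then (norm (\<xi> (nat (int m - s))))\<^sup>2 else 0) =
    (\<Sum>m\<in>{m. m < M \<and> s \<le> int m}. (norm (\<xi> (nat (int m - s))))\<^sup>2)"
    by (rule sum.mono_neutral_cong_right) auto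
  also have "\<dots> = (\<Sum>m\<in>(\<lambda>m. nat (int m - s)) ` {m. m < M \<and> s \<le> int m}. (norm (\<xi> m))\<^sup>2)"
    by (simp add: sum.reindex[OF inj])
  also have "\<dots> \<le> (hnorm \<xi>)\<^sup>2"
    by (rule sum_le_hnorm[OF assms]) simp
  finally show ?thesis .
qed

text \<open>The weight is bounded only where the given vector is nonzero. For a vector supported on
  high levels a bound on the late weights is thus enough, which is how tails are estimated.\<close>

lemma wshift_bound:
  assumes \<xi>: "\<xi> \<in> Fock P" and B: "0 \<le> B"
    and w: "\<And>m b. s \<le> int m \<Longrightarrow> (i, b) \<in> edges (mpow P m) \<Longrightarrow> \<xi> (nat (int m - s)) $ k $ b \<noteq> 0 \<Longrightarrow> cmod (w m b) \<le> B"
  shows "wshift P i k s w \<xi> \<in> Fock P" "hnorm (wshift P i k s w \<xi>) \<le> B * hnorm \<xi>"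
proof -
  have le: "(\<Sum>m<M. (norm (wshift P i k s w \<xi> m))\<^sup>2) \<le> (B * hnorm \<xi>)\<^sup>2" for M
  proof -
    have "(\<Sum>m<M. (norm (wshift P i k s w \<xi> m))\<^sup>2) \<le>
      (\<Sum>m<M. B\<^sup>2 * (if s \<le> int m then (norm (\<xi> (nat (int m - s))))\<^sup>2 else 0))"
      by (rule sum_mono, rule order_trans[OF norm_wshift_level[OF \<xi> B w]]) auto
    also have "\<dots> \<le> B\<^sup>2 * (hnorm \<xi>)\<^sup>2"
      unfolding sum_distrib_left[symmetric] by (intro mult_left_mono sum_shift_le_hnorm[OF \<xi>]) auto
    finally show ?thesis
      by (simp add: power_mult_distrib)
  qed
  show F: "wshift P i k s w \<xi> \<in> Fock P"
    by (rule FockI[OF _ le]) (use \<xi> in \<open>auto simp: Arv_def wshift_nth\<close>)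
  show "hnorm (wshift P i k s w \<xi>) \<le> B * hnorm \<xi>"
    by (rule hnorm_leI[OF F _ le]) (use B \<xi> in auto)
qed

lemma wbound_wshift:
  assumes "wbound P i k s w B"
  shows "\<xi> \<in> Fock P \<Longrightarrow> wshift P i k s w \<xi> \<in> Fock P"
    and "opbound P (wshift P i k s w) B" and "wshift P i k s w \<in> Fock P \<rightarrow>\<^sub>E Fock P"
proof -
  have B: "0 \<le> B"
    using assms by (simp add: wbound_def)
  have w: "cmod (w m b) \<le> B" if "\<xi> \<in> Fock P" "s \<le> int m" "(i, b) \<in> edges (mpow P m)" "\<xi> (nat (int m - s)) $ k $ b \<noteq> 0"
    for \<xi> m b
    using assms that Fock_eq0[of \<xi> P] unfolding wbound_def by blast
  show F: "wshift P i k s w \<xi> \<in> Fock P" if "\<xi> \<in> Fock P" for \<xi>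
    by (rule wshift_bound(1)[OF that B w[OF that]])
  show "opbound P (wshift P i k s w) B"
    unfolding opbound_def by (intro conjI ballI B wshift_bound(2)[OF _ B w])
  show "wshift P i k s w \<in> Fock P \<rightarrow>\<^sub>E Fock P"
    using F by (auto simp: wshift_def)
qed

lemma suminf_skip:
  fixes g :: "nat \<Rightarrow> complex"
  assumes "\<And>m. m < n \<Longrightarrow> g m = 0"
  shows "suminf g = (\<Sum>m. g (m + n))"
proof -
  have "(sums) (\<lambda>m. g (m + n)) = (sums) g"
    by (rule ext, rule sums_zero_iff_shift) (rule assms)
  then show ?thesis
    by (simp add: suminf_def)
qed

text \<open>The substitution \<open>m - s\<close> for the summation index, valid for either sign of
  \<open>s\<close> because each side drops exactly the indices without a partner. It moves a shift
  across the inner product.\<close>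

lemma suminf_int_shift:
  fixes f :: "nat \<Rightarrow> nat \<Rightarrow> complex"
  shows "(\<Sum>m. if s \<le> int m then f m (nat (int m - s)) else 0) =
    (\<Sum>m. if - s \<le> int m then f (nat (int m + s)) m else 0)"
proof (cases "0 \<le> s")
  case True
  then obtain n where s: "s = int n"
    using nonneg_int_cases by blast
  show ?thesis
    unfolding s by (subst suminf_skip[of n]) (auto simp: nat_add_distrib)
next
  case False
  define n where "n = nat (- s)"
  have s: "s = - int n"
    using False by (simp add: n_def)
  have eq: "(\<Sum>m. if - s \<le> int m then f (nat (int m + s)) m else 0) = (\<Sum>m. f m (m + n))"
    unfolding s by (subst suminf_skip[of n]) auto
  show ?thesis
    unfolding s using eq[unfolded s] by (simp add: nat_add_distrib flip: of_nat_add)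
qed

text \<open>The adjoint maps level \<open>m + s\<close> to level \<open>m\<close>, so the conjugated
  weight is looked up at the old target \<open>m + s\<close>. The truncation by \<open>nat\<close>
  is harmless, since the shift by \<open>- s\<close> acts only where \<open>m + s\<close> is
  nonnegative.\<close>

definition wadj :: "int \<Rightarrow> (nat \<Rightarrow> 'n \<Rightarrow> complex) \<Rightarrow> nat \<Rightarrow> 'n \<Rightarrow> complex" where
  "wadj s w = (\<lambda>m b. cnj (w (nat (int m + s)) b))"

lemma wbound_wadj:
  assumes "wbound P i k s w B"
  shows "wbound P k i (- s) (wadj s w) B"
  unfolding wbound_def
proof (intro conjI allI impI)
  show "0 \<le> B"
    using assms by (simp add: wbound_def)
  fix m b
  assume "- s \<le> int m" "(k, b) \<in> edges (mpow P m)" "(i, b) \<in> edges (mpow P (nat (int m - - s)))"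
  then show "cmod (wadj s w m b) \<le> B"
    using assms unfolding wbound_def wadj_def
    by (auto dest!: spec[of _ "nat (int m + s)"])
qed

lemma is_adjoint_wshift:
  assumes "wbound P i k s w B"
  shows "is_adjoint P (wshift P i k s w) (wshift P k i (- s) (wadj s w))"
  unfolding is_adjoint_iff[OF wbound_wshift(3)[OF assms]]
proof (intro conjI ballI allI)
  note adj = wbound_wadj[OF assms]
  show "wshift P k i (- s) (wadj s w) \<in> Fock P \<rightarrow>\<^sub>E Fock P"
    by (rule wbound_wshift(3)[OF adj])
  fix \<xi> \<eta> b
  assume \<xi>: "\<xi> \<in> Fock P" and \<eta>: "\<eta> \<in> Fock P"
  define f where "f m l = cnj (w m b) * cnj (\<xi> l $ k $ b) * \<eta> m $ i $ b" for m l
  have "arv_inner (wshift P i k s w \<xi> m) (\<eta> m) $ b = (if s \<le> int m then f m (nat (int m - s)) else 0)" for m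
  proof -
    have "arv_inner (wshift P i k s w \<xi> m) (\<eta> m) $ b = cnj (wshift P i k s w \<xi> m $ i $ b) * \<eta> m $ i $ b"
      unfolding arv_inner_nth
      by (subst sum.remove[of _ i]) (auto simp: wshift_nth[OF \<xi>] intro!: sum.neutral)
    then show ?thesis
      using Fock_eq0[OF \<eta>, of i b m] by (auto simp: wshift_nth[OF \<xi>] f_def)
  qed
  moreover have "arv_inner (\<xi> m) (wshift P k i (- s) (wadj s w) \<eta> m) $ b =
    (if - s \<le> int m then f (nat (int m + s)) m else 0)" for m
  proof -
    have "arv_inner (\<xi> m) (wshift P k i (- s) (wadj s w) \<eta> m) $ b =
      cnj (\<xi> m $ k $ b) * wshift P k i (- s) (wadj s w) \<eta> m $ k $ b"
      unfolding arv_inner_nth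
      by (subst sum.remove[of _ k]) (auto simp: wshift_nth[OF \<eta>] intro!: sum.neutral)
    then show ?thesis
      using Fock_eq0[OF \<xi>, of k b m] by (auto simp: wshift_nth[OF \<eta>] f_def wadj_def)
  qed
  ultimately show "fock_inner (wshift P i k s w \<xi>) \<eta> $ b = fock_inner \<xi> (wshift P k i (- s) (wadj s w) \<eta>) $ b"
    unfolding fock_inner_nth[OF wbound_wshift(1)[OF assms \<xi>] \<eta>] fock_inner_nth[OF \<xi> wbound_wshift(1)[OF adj \<eta>]]
    by (simp add: suminf_int_shift)
qed

lemma wshift_ops: "wbound P i k s w B \<Longrightarrow> wshift P i k s w \<in> ops P"
  using is_adjoint_ops(1)[OF is_adjoint_wshift wbound_wshift(3)] .

lemma star_wshift:
  "wbound P i k s w B \<Longrightarrow> star (fock_op_alg P) (wshift P i k s w) = wshift P k i (- s) (wadj s w)"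
  by (rule star_eqI[OF is_adjoint_wshift])

text \<open>Going up by \<open>n\<close>, down by \<open>n\<close> and up again ends at the same
  target entry, so the three weights multiply at one index. The first step goes up, hence nothing is
  cut off in between.\<close>

lemma wshift_triple:
  assumes B: "wbound P i k (int n) w B" "wbound P i k (int n) v B'" "wbound P i k (int n) u B''"
  shows "wshift P i k (int n) w \<otimes>\<^bsub>fock_op_alg P\<^esub> (wshift P k i (- int n) (wadj (int n) v)
    \<otimes>\<^bsub>fock_op_alg P\<^esub> wshift P i k (int n) u) = wshift P i k (int n) (\<lambda>m b. w m b * cnj (v m b) * u m b)"
    (is "?L = ?R")
proof (rule ops_eqI)
  have "cmod (w m b * cnj (v m b) * u m b) \<le> B * B' * B''"
    if "int n \<le> int m" "(i, b) \<in> edges (mpow P m)" "(k, b) \<in> edges (mpow P (nat (int m - int n)))" for m b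
    using B that unfolding wbound_def by (simp add: norm_mult mult_mono)
  then have "wbound P i k (int n) (\<lambda>m b. w m b * cnj (v m b) * u m b) (B * B' * B'')"
    using B by (simp add: wbound_def)
  then show "?R \<in> Fock P \<rightarrow>\<^sub>E Fock P"
    by (rule wbound_wshift(3))
  show "?L \<in> Fock P \<rightarrow>\<^sub>E Fock P"
    by (rule ops_PiE) (intro op_closed wshift_ops[OF B(1)] wshift_ops[OF wbound_wadj[OF B(2)]] wshift_ops[OF B(3)])
  fix \<xi>
  assume \<xi>: "\<xi> \<in> Fock P"
  note F = wbound_wshift(1)[OF B(3) \<xi>] wbound_wshift(1)[OF wbound_wadj[OF B(2)] wbound_wshift(1)[OF B(3) \<xi>]]
  have "?L \<xi> m $ a $ b = ?R \<xi> m $ a $ b" for m a b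
  proof (cases "a = i \<and> n \<le> m \<and> (i, b) \<in> edges (mpow P m)")
    case True
    then show ?thesis
      using F \<xi> Fock_eq0[OF \<xi>, of k b "m - n"]
      by (auto simp: op_apply wshift_nth wadj_def nat_diff_distrib)
  next
    case False
    then show ?thesis
      using F \<xi> by (auto simp: op_apply wshift_nth)
  qed
  then show "?L \<xi> = ?R \<xi>"
    by (simp add: fun_eq_iff vec_eq_iff)
qed


section \<open>Unweighted shifts in the Toeplitz algebra\<close>

lemma nat_int_diff: "nat (int m - int n) = m - n"
  by simp

lemma cscale_0: "cscale 0 A = 0"
  and cscale_1: "cscale 1 A = A"
  by (simp_all add: vec_eq_iff)

lemma wbound_add:
  assumes "wbound P i k s w B" "wbound P i k s v C"
  shows "wbound P i k s (\<lambda>m b. w m b + v m b) (B + C)"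
  using assms unfolding wbound_def by (meson add_mono add_nonneg_nonneg norm_triangle_mono)

lemma wbound_smult:
  assumes "wbound P i k s w B"
  shows "wbound P i k s (\<lambda>m b. a * w m b) (cmod a * B)"
  using assms unfolding wbound_def by (auto simp: norm_mult intro!: mult_left_mono)

lemma wbound_1: "wbound P i k s (\<lambda>m b. 1) 1"
  by (simp add: wbound_def)

lemma wshift_add:
  assumes "wbound P i k s w B" "wbound P i k s v C"
  shows "wshift P i k s w \<oplus>\<^bsub>fock_op_alg P\<^esub> wshift P i k s v = wshift P i k s (\<lambda>m b. w m b + v m b)"
  by (rule ops_eqI[OF op_PiE(1)[OF wbound_wshift(3)[OF assms(1)] wbound_wshift(3)[OF assms(2)]]
        wbound_wshift(3)[OF wbound_add[OF assms]]])
    (simp add: op_apply wshift_nth fun_eq_iff vec_eq_iff algebra_simps)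

lemma wshift_smult:
  assumes "wbound P i k s w B"
  shows "a \<odot>\<^bsub>fock_op_alg P\<^esub> wshift P i k s w = wshift P i k s (\<lambda>m b. a * w m b)"
  by (rule ops_eqI[OF op_PiE(3)[OF wbound_wshift(3)[OF assms(1)]] wbound_wshift(3)[OF wbound_smult[OF assms]]])
    (simp add: op_apply wshift_nth fun_eq_iff vec_eq_iff)

section \<open>Closed subalgebras\<close>

lemma cstar_subalgebra_ops: "cstar_subalgebra (fock_op_alg P) (ops P)"
  by (simp add: cstar_subalgebra_def ops_star(3))

lemma cstar_subalgebraD:
  assumes "cstar_subalgebra A X"
  shows "X \<subseteq> carrier A" "\<zero>\<^bsub>A\<^esub> \<in> X" "\<And>x y. x \<in> X \<Longrightarrow> y \<in> X \<Longrightarrow> x \<oplus>\<^bsub>A\<^esub> y \<in> X"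
    "\<And>x y. x \<in> X \<Longrightarrow> y \<in> X \<Longrightarrow> x \<otimes>\<^bsub>A\<^esub> y \<in> X" "\<And>a x. x \<in> X \<Longrightarrow> a \<odot>\<^bsub>A\<^esub> x \<in> X"
    "\<And>x. x \<in> X \<Longrightarrow> star A x \<in> X"
  using assms by (auto simp: cstar_subalgebra_def)

lemma cstar_subalgebra_limit:
  assumes X: "cstar_subalgebra (fock_op_alg P) X" and T: "T \<in> ops P"
    and approx: "\<And>e. 0 < e \<Longrightarrow> \<exists>S\<in>X. opbound P (op_minus P S T) e"
  shows "T \<in> X"
proof -
  have "\<exists>S\<in>X. opbound P (op_minus P S T) (inverse (Suc n))" for n
    by (rule approx) simp
  then obtain S where S: "\<And>n. S n \<in> X"
    and bd: "\<And>n. opbound P (op_minus P (S n) T) (inverse (Suc n))"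
    by metis
  have ops: "S n \<in> ops P" for n
    using S cstar_subalgebraD(1)[OF X] by blast
  have "(\<lambda>n. nrm (fock_op_alg P) (op_minus P (S n) T)) \<longlonglongrightarrow> 0"
  proof (subst nrm_tendsto_0_iff)
    show "\<forall>e>0. \<exists>N. \<forall>n\<ge>N. opbound P (op_minus P (S n) T) e"
    proof (intro allI impI)
      fix e :: real
      assume "0 < e"
      then obtain N where N: "inverse (Suc N) < e"
        using reals_Archimedean by blast
      have "inverse (Suc n) \<le> e" if "N \<le> n" for n
      proof -
        have "inverse (real (Suc n)) \<le> inverse (Suc N)"
          using that by (intro le_imp_inverse_le) auto
        then show ?thesis
          using N by linarith
      qed
      then show "\<exists>N. \<forall>n\<ge>N. opbound P (op_minus P (S n) T) e"
        using opbound_mono[OF bd] by blast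
    qed
  qed (simp add: ops T)
  then show ?thesis
    using X S T unfolding cstar_subalgebra_def by blast
qed

lemma cstar_generated_subset: "cstar_subalgebra A X \<Longrightarrow> G \<subseteq> X \<Longrightarrow> cstar_generated A G \<subseteq> X"
  by (auto simp: cstar_generated_def)

lemma cstar_generated_superset: "G \<subseteq> cstar_generated A G"
  by (auto simp: cstar_generated_def)

text \<open>That the whole carrier is a subalgebra makes the intersected family nonempty, so that
  the intersection stays inside the carrier.\<close>

lemma cstar_subalgebra_generated:
  assumes A: "cstar_subalgebra A (carrier A)" and G: "G \<subseteq> carrier A"
  shows "cstar_subalgebra A (cstar_generated A G)"
proof -
  let ?S = "{X. cstar_subalgebra A X \<and> G \<subseteq> X}"
  have sub: "\<Inter>?S \<subseteq> carrier A"
    using A G by blast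
  have closed: "x \<in> \<Inter>?S"
    if "\<And>n. s n \<in> \<Inter>?S" "x \<in> carrier A" "(\<lambda>n. nrm A (s n \<oplus>\<^bsub>A\<^esub> (- 1) \<odot>\<^bsub>A\<^esub> x)) \<longlonglongrightarrow> 0" for s x
  proof
    fix X
    assume X: "X \<in> ?S"
    then have "\<And>n. s n \<in> X"
      using that(1) by blast
    then show "x \<in> X"
      using X that(2,3) unfolding cstar_subalgebra_def by blast
  qed
  show ?thesis
    unfolding cstar_generated_def cstar_subalgebra_def[of A "\<Inter>?S"]
  proof (intro conjI ballI allI impI)
    show "x \<in> \<Inter>?S" if "x \<in> carrier A" "\<forall>n. s n \<in> \<Inter>?S"
      "(\<lambda>n. nrm A (s n \<oplus>\<^bsub>A\<^esub> (- 1) \<odot>\<^bsub>A\<^esub> x)) \<longlonglongrightarrow> 0" for s x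
      using closed that by blast
  qed (use sub in \<open>blast intro: cstar_subalgebraD\<close>)+
qed

text \<open>If the weight \<open>w\<close> is bounded and bounded away from zero, the partial isometry in the polar
  decomposition of the weighted shift is the limit of \<open>T p(T\<^sup>* T)\<close> for polynomials \<open>p\<close> approximating
  the inverse square root.\<close>

lemma wshift_polar:
  assumes X: "cstar_subalgebra (fock_op_alg P) X"
    and w: "\<And>m b. n \<le> m \<Longrightarrow> (i, b) \<in> edges (mpow P m) \<Longrightarrow> (k, b) \<in> edges (mpow P (m - n)) \<Longrightarrow> \<alpha> \<le> w m b \<and> w m b \<le> \<beta>"
    and \<alpha>: "0 < \<alpha>" and \<beta>: "\<alpha> \<le> \<beta>"
    and mem: "wshift P i k (int n) (\<lambda>m b. of_real (w m b)) \<in> X"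
  shows "wshift P i k (int n) (\<lambda>m b. 1) \<in> X"
proof (rule cstar_subalgebra_limit[OF X wshift_ops[OF wbound_1]])
  fix e :: real
  assume "0 < e"
  note XD = cstar_subalgebraD[OF X]
  have wB: "wbound P i k (int n) (\<lambda>m b. of_real (w m b) ^ q) (\<beta> ^ q)" for q
    unfolding wbound_def
  proof (intro conjI allI impI)
    fix m b
    assume "int n \<le> int m" "(i, b) \<in> edges (mpow P m)" "(k, b) \<in> edges (mpow P (nat (int m - int n)))"
    then have "\<alpha> \<le> w m b \<and> w m b \<le> \<beta>"
      by (intro w) (auto simp: nat_int_diff)
    then show "cmod (of_real (w m b) ^ q) \<le> \<beta> ^ q"
      using \<alpha> by (simp add: norm_power power_mono)
  qed (use \<alpha> \<beta> in simp)
  \<comment> \<open>The weight \<open>w^(2q+1)\<close> belongs to \<open>T\<close> times the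
    \<open>q\<close>-th power of the product of its adjoint with \<open>T\<close>; each induction
    step is one use of \<open>wshift_triple\<close>.\<close>
  have odd: "wshift P i k (int n) (\<lambda>m b. of_real (w m b) ^ (2 * q + 1)) \<in> X" for q
  proof (induction q)
    case 0
    then show ?case
      using mem by simp
  next
    case (Suc q)
    note W1 = wB[of 1, simplified]
    have "wshift P k i (- int n) (wadj (int n) (\<lambda>m b. of_real (w m b))) \<in> X"
      using XD(6)[OF mem] unfolding star_wshift[OF W1] .
    from XD(4)[OF mem XD(4)[OF this Suc]] show ?case
      unfolding wshift_triple[OF W1 W1 wB[of "2 * q + 1"]] by (simp add: mult_ac)
  qed
  have "continuous_on {\<alpha>\<^sup>2..\<beta>\<^sup>2} (\<lambda>x. 1 / sqrt x)"
    by (intro continuous_intros) (use \<alpha> in auto)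
  \<comment> \<open>The approximation error of the inverse square root will be multiplied by the
    weight, which is at most \<open>\<beta>\<close>.\<close>
  moreover have "0 < e / \<beta>"
    using \<open>0 < e\<close> \<alpha> \<beta> by simp
  ultimately obtain g where g: "real_polynomial_function g"
    and ge: "\<And>x. x \<in> {\<alpha>\<^sup>2..\<beta>\<^sup>2} \<Longrightarrow> \<bar>1 / sqrt x - g x\<bar> < e / \<beta>"
    using Stone_Weierstrass_real_polynomial_function[OF compact_Icc] by metis
  obtain a d where ga: "g = (\<lambda>x. \<Sum>q\<le>d. a q * x ^ q)"
    using g real_polynomial_function_iff_sum by metis
  \<comment> \<open>The weight after multiplying \<open>w\<close> by the approximate inverse square
    root of its square; it is within \<open>e\<close> of \<open>1\<close>.\<close>
  define v where "v m b = complex_of_real (w m b * g ((w m b)\<^sup>2))" for m b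
  define T where "T q = of_real (a q) \<odot>\<^bsub>fock_op_alg P\<^esub> wshift P i k (int n) (\<lambda>m b. of_real (w m b) ^ (2 * q + 1))" for q
  have "(\<lambda>\<xi>\<in>Fock P. \<lambda>m. \<Sum>q\<in>{..d}. T q \<xi> m) \<in> X"
    by (rule ops_sum_mem[OF XD(1,2,3)]) (use odd XD(5) in \<open>auto simp: T_def\<close>)
  moreover have "(\<lambda>\<xi>\<in>Fock P. \<lambda>m. \<Sum>q\<in>{..d}. T q \<xi> m) = wshift P i k (int n) v"
  proof -
    have "(\<Sum>q\<in>{..d}. T q \<xi> m) $ x $ y = wshift P i k (int n) v \<xi> m $ x $ y" if "\<xi> \<in> Fock P" for \<xi> m x y
      unfolding T_def wshift_smult[OF wB]
      using that
      by (auto simp: wshift_nth v_def ga sum_distrib_left sum_distrib_right power_mult power2_eq_square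
          power_mult_distrib mult_ac intro!: sum.neutral sum.cong)
    then show ?thesis
      by (auto simp: fun_eq_iff vec_eq_iff wshift_def)
  qed
  ultimately have vX: "wshift P i k (int n) v \<in> X"
    by simp
  have diff: "wbound P i k (int n) (\<lambda>m b. v m b + (- 1) * 1) e"
    unfolding wbound_def
  proof (intro conjI allI impI)
    fix m b
    assume "int n \<le> int m" "(i, b) \<in> edges (mpow P m)" "(k, b) \<in> edges (mpow P (nat (int m - int n)))"
    then have W: "\<alpha> \<le> w m b" "w m b \<le> \<beta>"
      using w[of m b] by (auto simp: nat_int_diff)
    then have "(w m b)\<^sup>2 \<in> {\<alpha>\<^sup>2..\<beta>\<^sup>2}"
      using \<alpha> by (auto intro!: power_mono)
    from ge[OF this] have "\<bar>1 / w m b - g ((w m b)\<^sup>2)\<bar> < e / \<beta>"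
      using \<alpha> W by simp
    then have "\<beta> * \<bar>1 / w m b - g ((w m b)\<^sup>2)\<bar> \<le> e"
      using \<alpha> \<beta> by (simp add: field_simps)
    moreover have "w m b * \<bar>1 / w m b - g ((w m b)\<^sup>2)\<bar> \<le> \<beta> * \<bar>1 / w m b - g ((w m b)\<^sup>2)\<bar>"
      using W by (intro mult_right_mono) auto
    moreover have "\<bar>w m b * g ((w m b)\<^sup>2) - 1\<bar> = w m b * \<bar>1 / w m b - g ((w m b)\<^sup>2)\<bar>"
    proof -
      have "w m b * g ((w m b)\<^sup>2) - 1 = - (w m b * (1 / w m b - g ((w m b)\<^sup>2)))"
        using \<alpha> W by (simp add: field_simps)
      then show ?thesis
        using \<alpha> W by (simp only: abs_minus_cancel abs_mult)
    qed
    ultimately have "\<bar>w m b * g ((w m b)\<^sup>2) - 1\<bar> \<le> e"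
      by linarith
    then show "cmod (v m b + (- 1) * 1) \<le> e"
      unfolding v_def by (metis (no_types) add_uminus_conv_diff mult_1_right norm_of_real of_real_1 of_real_diff)
  qed (use \<open>0 < e\<close> in simp)
  have vB: "wbound P i k (int n) v (e + 1)"
    using wbound_add[OF diff wbound_1] by simp
  have "op_minus P (wshift P i k (int n) v) (wshift P i k (int n) (\<lambda>m b. 1)) =
    wshift P i k (int n) (\<lambda>m b. v m b + (- 1) * 1)"
    unfolding wshift_smult[OF wbound_1] by (rule wshift_add[OF vB wbound_smult[OF wbound_1]])
  then show "\<exists>S\<in>X. opbound P (op_minus P S (wshift P i k (int n) (\<lambda>m b. 1))) e"
    using vX wbound_wshift(2)[OF diff] by (intro bexI[of _ "wshift P i k (int n) v"]) simp_all
qed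

section \<open>The weights of the generating shifts\<close>

context chain
begin

text \<open>Where the denominator is positive, the square of this weight is the probability that the
  chain is in \<open>k\<close> at time \<open>n\<close>, given that it runs from \<open>i\<close> to
  \<open>b\<close> in \<open>m\<close> steps. Hence it is at most \<open>1\<close>.\<close>

definition sweight :: "nat \<Rightarrow> 'n \<Rightarrow> 'n \<Rightarrow> nat \<Rightarrow> 'n \<Rightarrow> real" where
  "sweight n i k m b = sqrt (mpow P n $ i $ k * mpow P (m - n) $ k $ b) / sqrt (mpow P m $ i $ b)"

lemma sweight_le_1:
  assumes "n \<le> m"
  shows "0 \<le> sweight n i k m b" "sweight n i k m b \<le> 1"
proof -
  have "mpow P n $ i $ k * mpow P (m - n) $ k $ b \<le> mpow P (n + (m - n)) $ i $ b"
    unfolding mpow_add_nth by (rule member_le_sum) (auto simp: mpow_nonneg[OF stoch])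
  then have "mpow P n $ i $ k * mpow P (m - n) $ k $ b \<le> mpow P m $ i $ b"
    using assms by simp
  then show "sweight n i k m b \<le> 1"
    unfolding sweight_def by (simp add: divide_le_eq_1)
      (metis mpow_nonneg[OF stoch] order_le_less real_sqrt_gt_0_iff real_sqrt_le_mono real_sqrt_zero)
  show "0 \<le> sweight n i k m b"
    unfolding sweight_def by (simp add: mpow_nonneg[OF stoch])
qed

lemma wbound_sweight: "wbound P i k (int n) (\<lambda>m b. of_real (sweight n i k m b)) 1"
  unfolding wbound_def using sweight_le_1 by auto

lemma shift_eq_sum:
  "shift P n A = (\<lambda>\<xi>\<in>Fock P. \<lambda>m. \<Sum>(i, k)\<in>UNIV.
     (A $ i $ k \<odot>\<^bsub>fock_op_alg P\<^esub> wshift P i k (int n) (\<lambda>m b. of_real (sweight n i k m b))) \<xi> m)"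
proof -
  have "shift P n A \<xi> m $ a $ b = (\<Sum>(i, k)\<in>UNIV.
     (A $ i $ k \<odot>\<^bsub>fock_op_alg P\<^esub> wshift P i k (int n) (\<lambda>m b. of_real (sweight n i k m b))) \<xi> m) $ a $ b"
    if \<xi>: "\<xi> \<in> Fock P" for \<xi> m a b
  proof -
    have "(\<Sum>(i, k)\<in>UNIV.
      (A $ i $ k \<odot>\<^bsub>fock_op_alg P\<^esub> wshift P i k (int n) (\<lambda>m b. of_real (sweight n i k m b))) \<xi> m) $ a $ b =
      (\<Sum>i\<in>UNIV. \<Sum>k\<in>UNIV. A $ i $ k * wshift P i k (int n) (\<lambda>m b. of_real (sweight n i k m b)) \<xi> m $ a $ b)"
      using \<xi> by (simp add: op_apply case_prod_unfold sum.cartesian_product flip: UNIV_Times_UNIV)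
    also have "\<dots> = (\<Sum>k\<in>UNIV. A $ a $ k * wshift P a k (int n) (\<lambda>m b. of_real (sweight n a k m b)) \<xi> m $ a $ b)"
      by (subst sum.remove[of _ a]) (auto simp: wshift_nth[OF \<xi>] intro!: sum.neutral)
    also have "\<dots> = shift P n A \<xi> m $ a $ b"
      using \<xi> by (auto simp: shift_def arv_prod_def wshift_nth sweight_def sum_divide_distrib mult_ac
          nat_int_diff intro!: sum.cong)
    finally show ?thesis
      by simp
  qed
  then show ?thesis
    by (auto simp: fun_eq_iff vec_eq_iff shift_def)
qed

lemma left_action_eq_sum:
  "left_action P f = (\<lambda>\<xi>\<in>Fock P. \<lambda>m. \<Sum>i\<in>UNIV. (f $ i \<odot>\<^bsub>fock_op_alg P\<^esub> wshift P i i 0 (\<lambda>m b. 1)) \<xi> m)"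
proof -
  have "(diag_mat f ** \<xi> m) $ a $ b = (\<Sum>i\<in>UNIV. (f $ i \<odot>\<^bsub>fock_op_alg P\<^esub> wshift P i i 0 (\<lambda>m b. 1)) \<xi> m) $ a $ b"
    if \<xi>: "\<xi> \<in> Fock P" for \<xi> m a b
  proof -
    have "(\<Sum>i\<in>UNIV. (f $ i \<odot>\<^bsub>fock_op_alg P\<^esub> wshift P i i 0 (\<lambda>m b. 1)) \<xi> m) $ a $ b = f $ a * \<xi> m $ a $ b"
      using \<xi> Fock_eq0[OF \<xi>, of a b m]
      by (simp add: op_apply, subst sum.remove[of _ a]) (auto simp: wshift_nth intro!: sum.neutral)
    moreover have "(diag_mat f ** \<xi> m) $ a $ b = f $ a * \<xi> m $ a $ b"
      by (simp add: diag_mat_def matrix_matrix_mult_def if_distrib[of "\<lambda>x. x * _"] cong: if_cong)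
    ultimately show ?thesis
      by simp
  qed
  then show ?thesis
    by (auto simp: fun_eq_iff vec_eq_iff left_action_def)
qed

text \<open>The weight is its limit times the square root of the ratio in \<open>mpow_ratio\<close>,
  and \<open>|sqrt t - 1|\<close> is at most \<open>|t - 1|\<close>. The estimate is uniform in the
  column \<open>b\<close>, as an operator bound requires.\<close>

lemma sweight_limit:
  assumes ik: "(i, k) \<in> edges (mpow P n)" and e: "0 < e"
  shows "\<exists>M. \<forall>m b. n \<le> m \<longrightarrow> M \<le> m - n \<longrightarrow> (k, b) \<in> edges (mpow P (m - n)) \<longrightarrow>
    \<bar>sweight n i k m b - sqrt (mpow P n $ i $ k)\<bar> \<le> e"
proof -
  obtain M where M: "\<And>m b. M \<le> m \<Longrightarrow> (k, b) \<in> edges (mpow P m) \<Longrightarrow>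
      \<bar>mpow P m $ k $ b / mpow P (n + m) $ i $ b - 1\<bar> < e"
    using mpow_ratio[OF ik e] by blast
  have p: "0 \<le> mpow P n $ i $ k" "mpow P n $ i $ k \<le> 1"
    using member_le_sum[of k UNIV "\<lambda>k. mpow P n $ i $ k"]
    by (simp_all add: mpow_nonneg[OF stoch] mpow_sum[OF stoch])
  have "\<bar>sweight n i k m b - sqrt (mpow P n $ i $ k)\<bar> \<le> e"
    if m: "n \<le> m" "M \<le> m - n" "(k, b) \<in> edges (mpow P (m - n))" for m b
  proof -
    define t where "t = mpow P (m - n) $ k $ b / mpow P m $ i $ b"
    have t: "\<bar>t - 1\<bar> < e" "0 \<le> t"
      using M[OF m(2,3)] m(1) mpow_nonneg[OF stoch] by (auto simp: t_def)
    have "t - 1 = (sqrt t - 1) * (sqrt t + 1)"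
      using t by (simp add: algebra_simps)
    then have "\<bar>t - 1\<bar> = \<bar>sqrt t - 1\<bar> * (sqrt t + 1)"
      using t by (simp add: abs_mult)
    moreover have "\<bar>sqrt t - 1\<bar> * 1 \<le> \<bar>sqrt t - 1\<bar> * (sqrt t + 1)"
      using t by (intro mult_left_mono) auto
    ultimately have "\<bar>sqrt t - 1\<bar> \<le> \<bar>t - 1\<bar>"
      by simp
    with t(1) have st: "\<bar>sqrt t - 1\<bar> \<le> e"
      by (meson less_imp_le order_trans)
    have "sweight n i k m b - sqrt (mpow P n $ i $ k) = sqrt (mpow P n $ i $ k) * (sqrt t - 1)"
      by (simp add: sweight_def t_def real_sqrt_mult real_sqrt_divide algebra_simps)
    also have "\<bar>\<dots>\<bar> \<le> 1 * e"
      unfolding abs_mult using p st by (intro mult_mono) auto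
    finally show ?thesis
      by simp
  qed
  then show ?thesis
    by blast
qed

text \<open>Beyond some level the weight is at least half its positive limit; below it there are
  finitely many weights, all positive. The minimum over both is the lower bound that polar
  decomposition asks for.\<close>

lemma sweight_lower:
  assumes ik: "(i, k) \<in> edges (mpow P n)"
  obtains \<alpha> where "0 < \<alpha>" "\<alpha> \<le> 1"
    "\<And>m b. n \<le> m \<Longrightarrow> (k, b) \<in> edges (mpow P (m - n)) \<Longrightarrow> \<alpha> \<le> sweight n i k m b"
proof -
  define \<kappa> where "\<kappa> = sqrt (mpow P n $ i $ k)"
  have \<kappa>: "0 < \<kappa>"
    using ik by (simp add: \<kappa>_def edges_iff)
  obtain M where M: "\<And>m b. n \<le> m \<Longrightarrow> M \<le> m - n \<Longrightarrow> (k, b) \<in> edges (mpow P (m - n)) \<Longrightarrow>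
      \<bar>sweight n i k m b - \<kappa>\<bar> \<le> \<kappa> / 2"
    using sweight_limit[OF ik, of "\<kappa> / 2"] \<kappa> unfolding \<kappa>_def by auto
  have pos: "0 < sweight n i k m b" if "n \<le> m" "(k, b) \<in> edges (mpow P (m - n))" for m b
    using ik that edge_trans[OF ik that(2)] by (simp add: sweight_def edges_iff)
  define S where "S = {(m, b). n \<le> m \<and> m - n < M \<and> (k, b) \<in> edges (mpow P (m - n))}"
  have "S \<subseteq> {..<M + n} \<times> UNIV"
    by (auto simp: S_def)
  then have fin: "finite S"
    by (rule finite_subset) simp
  define W where "W = insert 1 (insert (\<kappa> / 2) ((\<lambda>(m, b). sweight n i k m b) ` S))"
  have finW: "finite W"
    using fin by (simp add: W_def)
  have "0 < x" if "x \<in> W" for x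
    using that pos \<kappa> by (auto simp: W_def S_def)
  then have "0 < Min W"
    using Min_in[of W] finW W_def by blast
  moreover have "Min W \<le> 1"
    using finW by (intro Min_le) (auto simp: W_def)
  moreover have "Min W \<le> sweight n i k m b" if m: "n \<le> m" "(k, b) \<in> edges (mpow P (m - n))" for m b
  proof (cases "m - n < M")
    case True
    then have "(m, b) \<in> S"
      using m by (simp add: S_def)
    then show ?thesis
      using finW by (intro Min_le) (force simp: W_def)+
  next
    case False
    then have "\<kappa> - sweight n i k m b \<le> \<kappa> / 2"
      using M[OF m(1) _ m(2)] by linarith
    moreover have "Min W \<le> \<kappa> / 2"
      using finW by (intro Min_le) (auto simp: W_def)
    ultimately show ?thesis
      by linarith
  qed
  ultimately show thesis
    using that by blast
qed

abbreviation "toeplitz \<equiv> carrier (toeplitz_alg P)"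

lemma toeplitz_def:
  "toeplitz = cstar_generated (fock_op_alg P) (range (left_action P) \<union> {shift P n A | n A. A \<in> Arv P n})"
  by (simp add: toeplitz_alg_def)

lemma generators_ops: "range (left_action P) \<union> {shift P n A | n A. A \<in> Arv P n} \<subseteq> ops P"
proof -
  note OD = cstar_subalgebraD[OF cstar_subalgebra_ops[of P]]
  have "left_action P f \<in> ops P" for f
    unfolding left_action_eq_sum
    by (rule ops_sum_mem[OF OD(1,2,3)]) (auto intro!: op_closed(3) wshift_ops[OF wbound_1])
  moreover have "shift P n A \<in> ops P" for n A
    unfolding shift_eq_sum case_prod_unfold
    by (rule ops_sum_mem[OF OD(1,2,3)]) (auto intro!: op_closed(3) wshift_ops[OF wbound_sweight])
  ultimately show ?thesis
    by auto
qed

lemma toeplitz_subalgebra: "cstar_subalgebra (fock_op_alg P) toeplitz"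
  unfolding toeplitz_def by (rule cstar_subalgebra_generated[OF cstar_subalgebra_ops generators_ops])

lemma wshift_sweight_toeplitz:
  assumes ik: "(i, k) \<in> edges (mpow P n)"
  shows "wshift P i k (int n) (\<lambda>m b. of_real (sweight n i k m b)) \<in> toeplitz"
proof -
  define A :: "complex ^ 'n ^ 'n" where "A = (\<chi> a b. if a = i \<and> b = k then 1 else 0)"
  have eq: "shift P n A = wshift P i k (int n) (\<lambda>m b. of_real (sweight n i k m b))"
  proof (rule ops_eqI)
    have "A \<in> Arv P n"
      using ik by (auto simp: A_def Arv_def)
    then show "shift P n A \<in> Fock P \<rightarrow>\<^sub>E Fock P"
      using generators_ops ops_PiE by blast
    show "wshift P i k (int n) (\<lambda>m b. of_real (sweight n i k m b)) \<in> Fock P \<rightarrow>\<^sub>E Fock P"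
      by (rule wbound_wshift(3)[OF wbound_sweight])
    fix \<xi>
    assume \<xi>: "\<xi> \<in> Fock P"
    show "shift P n A \<xi> = wshift P i k (int n) (\<lambda>m b. of_real (sweight n i k m b)) \<xi>"
    proof
      fix m
      have "shift P n A \<xi> m = (\<Sum>(x, y)\<in>UNIV.
        (A $ x $ y \<odot>\<^bsub>fock_op_alg P\<^esub> wshift P x y (int n) (\<lambda>m b. of_real (sweight n x y m b))) \<xi> m)"
        using \<xi> by (simp add: shift_eq_sum)
      also have "\<dots> = (\<Sum>p\<in>UNIV. if p = (i, k)
          then wshift P i k (int n) (\<lambda>m b. of_real (sweight n i k m b)) \<xi> m else 0)"
      proof (rule sum.cong[OF refl])
        fix p :: "'n \<times> 'n"
        show "(case p of (x, y) \<Rightarrow> (A $ x $ y \<odot>\<^bsub>fock_op_alg P\<^esub>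
            wshift P x y (int n) (\<lambda>m b. of_real (sweight n x y m b))) \<xi> m) =
          (if p = (i, k) then wshift P i k (int n) (\<lambda>m b. of_real (sweight n i k m b)) \<xi> m else 0)"
          by (cases p) (simp add: A_def op_smult_apply[OF \<xi>] cscale_0 cscale_1)
      qed
      finally show "shift P n A \<xi> m = wshift P i k (int n) (\<lambda>m b. of_real (sweight n i k m b)) \<xi> m"
        by simp
    qed
  qed
  have "A \<in> Arv P n"
    using ik by (auto simp: A_def Arv_def)
  then show ?thesis
    unfolding toeplitz_def eq[symmetric] by (intro subsetD[OF cstar_generated_superset]) auto
qed

section \<open>Unweighted shifts compatible with the cyclic classes\<close>

text \<open>The offsets \<open>c k - c i\<close> telescope when matrix units are multiplied, so
  \<open>l\<close> is additive under composition; up to low levels, these operators multiply like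
  matrix units times powers of \<open>z\<close>.\<close>

definition eop :: "'n \<Rightarrow> 'n \<Rightarrow> int \<Rightarrow> 'n fock_op" where
  "eop i k l = wshift P i k (int r * l + c k - c i) (\<lambda>m b. 1)"

lemma eop_ops: "eop i k l \<in> ops P"
  unfolding eop_def by (rule wshift_ops[OF wbound_1])

lemma is_adjoint_eop: "is_adjoint P (eop i k l) (eop k i (- l))"
  using is_adjoint_wshift[OF wbound_1, of P i k "int r * l + c k - c i"]
  by (simp add: eop_def wadj_def algebra_simps)

lemma eop_apply:
  "\<xi> \<in> Fock P \<Longrightarrow> eop i k l \<xi> m $ a $ b =
    (if a = i \<and> int r * l + c k - c i \<le> int m \<and> (i, b) \<in> edges (mpow P m)
     then \<xi> (nat (int m - (int r * l + c k - c i))) $ k $ b else 0)"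
  by (simp add: eop_def wshift_nth)

text \<open>The required shift \<open>s\<close> may be negative or too small for
  \<open>(i, k)\<close> to be an edge. So the operator goes up by \<open>n = N + s\<close>, where
  the edge exists, and comes down by \<open>N\<close> in row \<open>i\<close>.\<close>

lemma eop_toeplitz: "eop i k l \<in> toeplitz"
proof -
  note TD = cstar_subalgebraD[OF toeplitz_subalgebra]
  have unweighted: "wshift P i k (int n) (\<lambda>m b. 1) \<in> toeplitz" if ik: "(i, k) \<in> edges (mpow P n)" for i k n
  proof -
    obtain \<alpha> where \<alpha>: "0 < \<alpha>" "\<alpha> \<le> 1"
      "\<And>m b. n \<le> m \<Longrightarrow> (k, b) \<in> edges (mpow P (m - n)) \<Longrightarrow> \<alpha> \<le> sweight n i k m b"
      using sweight_lower[OF ik] by blast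
    show ?thesis
      by (rule wshift_polar[OF toeplitz_subalgebra _ \<alpha>(1,2) wshift_sweight_toeplitz[OF ik]])
        (use \<alpha>(3) sweight_le_1(2) in blast)
  qed
  define s where "s = int r * l + c k - c i"
  \<comment> \<open>A multiple of \<open>r\<close>, so that \<open>(i, i)\<close> is an edge at
    level \<open>N\<close>; the summand with \<open>s\<close> gives
    \<open>N + s \<ge> N0\<close>.\<close>
  define N where "N = r * (N0 + nat \<bar>s\<bar>)"
  have "N0 + nat \<bar>s\<bar> \<le> N"
    unfolding N_def using mult_le_mono1[of 1 r "N0 + nat \<bar>s\<bar>"] r_pos by simp
  then have N: "N0 \<le> N" "int N0 \<le> int N + s"
    by auto
  obtain n where n: "int n = int N + s" "N0 \<le> n"
    using N(2) by (intro that[of "nat (int N + s)"]) auto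
  have ii: "(i, i) \<in> edges (mpow P N)"
    unfolding edges_iff by (rule class_pos[OF N(1)]) (simp add: N_def)
  have ik: "(i, k) \<in> edges (mpow P n)"
    unfolding edges_iff by (rule class_pos[OF n(2)]) (simp add: n s_def N_def)
  have "wshift P i i (- int N) (\<lambda>m b. 1) \<in> toeplitz"
    using TD(6)[OF unweighted[OF ii]] by (simp add: star_wshift[OF wbound_1] wadj_def)
  then have "wshift P i i (- int N) (\<lambda>m b. 1) \<otimes>\<^bsub>fock_op_alg P\<^esub> wshift P i k (int n) (\<lambda>m b. 1) \<in> toeplitz"
    using TD(4) unweighted[OF ik] by blast
  also have "wshift P i i (- int N) (\<lambda>m b. 1) \<otimes>\<^bsub>fock_op_alg P\<^esub> wshift P i k (int n) (\<lambda>m b. 1) = eop i k l"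
  proof (rule ops_eqI[OF op_PiE(2)[OF wbound_wshift(3)[OF wbound_1] wbound_wshift(3)[OF wbound_1]] ops_PiE[OF eop_ops]])
    fix \<xi>
    assume \<xi>: "\<xi> \<in> Fock P"
    \<comment> \<open>The intermediate entry exists whenever the final one does, so the detour
      through the higher level loses nothing.\<close>
    have "(i, b) \<in> edges (mpow P (N + m))" if "(i, b) \<in> edges (mpow P m)" for m b
      using edge_trans[OF ii that] .
    moreover have "nat (int m + int N) = N + m" for m
      by simp
    ultimately show "(wshift P i i (- int N) (\<lambda>m b. 1) \<otimes>\<^bsub>fock_op_alg P\<^esub> wshift P i k (int n) (\<lambda>m b. 1)) \<xi> = eop i k l \<xi>"
      using \<xi> n
      by (auto simp: op_apply wshift_nth eop_def wbound_wshift(1)[OF wbound_1] fun_eq_iff vec_eq_iff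
          simp flip: s_def)
  qed
  finally show ?thesis .
qed

end


section \<open>Toeplitz operators of trigonometric polynomials\<close>

text \<open>A geometric sum of \<open>N\<close>-th roots of unity; in the range
  \<open>|d| < N\<close> the only multiple of \<open>N\<close> is \<open>0\<close>.\<close>

lemma root_of_unity_sum:
  fixes N :: nat and d :: int
  assumes "\<bar>d\<bar> < int N"
  shows "(\<Sum>t<N. cis (2 * pi / N) powi (int t * d)) = (if d = 0 then of_nat N else 0)"
proof (cases "d = 0")
  case False
  define w where "w = cis (2 * pi / N) powi d"
  have N: "0 < N"
    using assms by auto
  have w_cis: "w = cis (of_int d * (2 * pi / N))"
    unfolding w_def by (rule cis_power_int)
  have "w \<noteq> 1"
  proof
    assume "w = 1"
    then have "cos (of_int d * (2 * pi / N)) = 1"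
      unfolding w_cis by (metis cis.sel(1) one_complex.sel(1))
    then obtain n :: int where "of_int d * (2 * pi / N) = of_int n * 2 * pi"
      unfolding cos_one_2pi_int by blast
    then have "real_of_int d = of_int n * of_nat N"
      using N by (simp add: field_simps)
    then have "d = n * int N"
      by (metis of_int_eq_iff of_int_mult of_int_of_nat_eq)
    moreover have "n \<noteq> 0"
      using False calculation by auto
    ultimately have "int N \<le> \<bar>d\<bar>"
      using mult_right_mono[of 1 "\<bar>n\<bar>" "int N"] by (simp add: abs_mult)
    then show False
      using assms by simp
  qed
  moreover have "w ^ N = 1"
  proof -
    have "w ^ N = cis (of_nat N * (of_int d * (2 * pi / N)))"
      unfolding w_cis by (rule Complex.DeMoivre)
    also have "of_nat N * (of_int d * (2 * pi / N)) = 2 * pi * of_int d"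
      using N by simp
    finally show ?thesis
      by (simp add: cis_multiple_2pi)
  qed
  ultimately have "(\<Sum>t<N. w ^ t) = 0"
    using one_diff_power_eq[of w N] by simp
  moreover have "cis (2 * pi / N) powi (int t * d) = w ^ t" for t
    unfolding w_def by (simp add: power_int_mult mult.commute)
  ultimately show ?thesis
    using False by simp
qed simp

lemma cnj_powi_circle:
  assumes "cmod z = 1"
  shows "cnj (z powi n) = z powi (- n)"
proof -
  have "z * cnj z = 1"
    using assms by (simp add: complex_norm_square[symmetric])
  then have "cnj z = inverse z"
    by (metis inverse_unique)
  then have "cnj (z powi n) = inverse z powi n"
    by (simp add: power_int_def)
  then show ?thesis
    by (simp add: power_int_minus power_int_inverse)
qed

lemma discrete_parseval:
  fixes u :: "int \<Rightarrow> complex" and N :: nat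
  assumes S: "finite S" "\<And>m n. m \<in> S \<Longrightarrow> n \<in> S \<Longrightarrow> \<bar>m - n\<bar> < int N"
  shows "(\<Sum>t<N. (cmod (\<Sum>m\<in>S. u m * cis (2 * pi / N) powi (int t * m)))\<^sup>2) = N * (\<Sum>m\<in>S. (cmod (u m))\<^sup>2)"
proof -
  define \<omega> where "\<omega> = cis (2 * pi / N)"
  have \<omega>: "cmod \<omega> = 1" "\<omega> \<noteq> 0"
    by (simp_all add: \<omega>_def)
  have "complex_of_real (\<Sum>t<N. (cmod (\<Sum>m\<in>S. u m * \<omega> powi (int t * m)))\<^sup>2) =
    (\<Sum>t<N. (\<Sum>m\<in>S. u m * \<omega> powi (int t * m)) * cnj (\<Sum>n\<in>S. u n * \<omega> powi (int t * n)))"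
    by (simp only: of_real_sum complex_norm_square)
  also have "\<dots> = (\<Sum>t<N. \<Sum>m\<in>S. \<Sum>n\<in>S. u m * cnj (u n) * \<omega> powi (int t * (m - n)))"
  proof (rule sum.cong[OF refl])
    fix t
    have "u m * \<omega> powi (int t * m) * cnj (u n * \<omega> powi (int t * n)) = u m * cnj (u n) * \<omega> powi (int t * (m - n))" for m n
    proof -
      have "\<omega> powi (int t * (m - n)) = \<omega> powi (int t * m) * \<omega> powi (- (int t * n))"
        by (subst power_int_add[symmetric]) (use \<omega> in \<open>auto simp: algebra_simps\<close>)
      then show ?thesis
        by (simp only: complex_cnj_mult cnj_powi_circle[OF \<omega>(1)] mult_ac)
    qed
    then show "(\<Sum>m\<in>S. u m * \<omega> powi (int t * m)) * cnj (\<Sum>n\<in>S. u n * \<omega> powi (int t * n)) =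
      (\<Sum>m\<in>S. \<Sum>n\<in>S. u m * cnj (u n) * \<omega> powi (int t * (m - n)))"
      by (simp only: cnj_sum sum_product)
  qed
  also have "\<dots> = (\<Sum>m\<in>S. \<Sum>n\<in>S. u m * cnj (u n) * (\<Sum>t<N. \<omega> powi (int t * (m - n))))"
    unfolding sum_distrib_left by (subst sum.swap, rule sum.cong[OF refl], rule sum.swap)
  also have "\<dots> = (\<Sum>m\<in>S. \<Sum>n\<in>S. if n = m then of_nat N * (u m * cnj (u m)) else 0)"
    using S(2) by (intro sum.cong refl) (auto simp: \<omega>_def root_of_unity_sum)
  also have "\<dots> = complex_of_real (N * (\<Sum>m\<in>S. (cmod (u m))\<^sup>2))"
    using S(1) by (simp add: sum_distrib_left complex_norm_square del: of_real_power)
  finally show ?thesis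
    unfolding \<omega>_def of_real_eq_iff .
qed

text \<open>The Fourier transform is taken over a cyclic group so large that nothing wraps around.\<close>

lemma convolution_bound:
  fixes xs :: "(complex \<times> int) list" and y :: "int \<Rightarrow> complex"
  assumes Y: "finite Y" "\<And>m. m \<notin> Y \<Longrightarrow> y m = 0" and M: "finite M"
    and C: "\<And>z. cmod z = 1 \<Longrightarrow> cmod (\<Sum>(a, s)\<leftarrow>xs. a * z powi s) \<le> C"
  shows "(\<Sum>m\<in>M. (cmod (\<Sum>(a, s)\<leftarrow>xs. a * y (m - s)))\<^sup>2) \<le> C\<^sup>2 * (\<Sum>m\<in>Y. (cmod (y m))\<^sup>2)"
proof -
  define v where "v m = (\<Sum>(a, s)\<leftarrow>xs. a * y (m - s))" for m
  \<comment> \<open>One finite window containing the output levels \<open>M\<close>, the support of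
    \<open>y\<close> and all its translates; \<open>N\<close> exceeds every difference inside
    it.\<close>
  define S where "S = M \<union> Y \<union> (\<Union>(a, s)\<in>set xs. (\<lambda>m. m + s) ` Y)"
  have finS: "finite S"
    using Y M by (auto simp: S_def)
  define D where "D = insert 0 ((\<lambda>(m, n). \<bar>m - n\<bar>) ` (S \<times> S))"
  have D: "finite D"
    using finS by (simp add: D_def)
  define N where "N = nat (Max D + 1)"
  have maxD: "0 \<le> Max D"
    using D by (simp add: D_def)
  have N: "\<bar>m - n\<bar> < int N" if "m \<in> S" "n \<in> S" for m n
  proof -
    have "\<bar>m - n\<bar> \<le> Max D"
      using D that by (intro Max_ge) (auto simp: D_def)
    then show ?thesis
      using maxD by (simp add: N_def)
  qed
  define \<omega> where "\<omega> = cis (2 * pi / N)"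
  have \<omega>: "\<omega> \<noteq> 0" "cmod (\<omega> powi j) = 1" for j
    by (simp_all add: \<omega>_def norm_power_int)
  \<comment> \<open>Each translation by \<open>s\<close> becomes multiplication by a power, so the
    convolution becomes multiplication by the value of the polynomial at a root of unity, where
    \<open>C\<close> applies.\<close>
  have fourier: "(\<Sum>m\<in>S. v m * \<omega> powi (int t * m)) =
    (\<Sum>(a, s)\<leftarrow>xs. a * (\<omega> powi int t) powi s) * (\<Sum>m\<in>S. y m * \<omega> powi (int t * m))" for t
  proof -
    have shift: "(\<Sum>m\<in>S. y (m - s) * \<omega> powi (int t * m)) =
      (\<omega> powi int t) powi s * (\<Sum>m\<in>S. y m * \<omega> powi (int t * m))" if "(a, s) \<in> set xs" for a s
    proof -
      have "(\<Sum>m\<in>S. y (m - s) * \<omega> powi (int t * m)) = (\<Sum>m\<in>(\<lambda>m. m + s) ` Y. y (m - s) * \<omega> powi (int t * m))"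
      proof (rule sum.mono_neutral_right[OF finS])
        show "(\<lambda>m. m + s) ` Y \<subseteq> S"
          using that unfolding S_def by blast
        have "m \<in> (\<lambda>m. m + s) ` Y" if "y (m - s) \<noteq> 0" for m
          using Y(2)[of "m - s"] that by (intro image_eqI[of _ _ "m - s"]) auto
        then show "\<forall>m\<in>S - (\<lambda>m. m + s) ` Y. y (m - s) * \<omega> powi (int t * m) = 0"
          by auto
      qed
      also have "\<dots> = (\<Sum>m\<in>Y. y m * \<omega> powi (int t * (m + s)))"
        by (subst sum.reindex) (auto simp: inj_on_def)
      also have "\<dots> = (\<omega> powi int t) powi s * (\<Sum>m\<in>Y. y m * \<omega> powi (int t * m))"
      proof -
        have "\<omega> powi (int t * (m + s)) = (\<omega> powi int t) powi s * \<omega> powi (int t * m)" for m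
          unfolding power_int_mult[symmetric]
          by (subst power_int_add[symmetric]) (use \<omega> in \<open>auto simp: algebra_simps\<close>)
        then show ?thesis
          by (simp only: sum_distrib_left mult_ac)
      qed
      also have "(\<Sum>m\<in>Y. y m * \<omega> powi (int t * m)) = (\<Sum>m\<in>S. y m * \<omega> powi (int t * m))"
        by (rule sum.mono_neutral_left[OF finS]) (use Y(2) in \<open>auto simp: S_def\<close>)
      finally show ?thesis .
    qed
    have "(\<Sum>m\<in>S. v m * \<omega> powi (int t * m)) = (\<Sum>(a, s)\<leftarrow>xs. a * (\<Sum>m\<in>S. y (m - s) * \<omega> powi (int t * m)))"
      unfolding v_def
      by (induction xs) (auto simp: sum.distrib distrib_right sum_distrib_left mult.assoc)
    also have "\<dots> = (\<Sum>(a, s)\<leftarrow>xs. a * (\<omega> powi int t) powi s * (\<Sum>m\<in>S. y m * \<omega> powi (int t * m)))"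
      by (rule arg_cong[where f = sum_list], rule map_cong[OF refl]) (use shift in auto)
    also have "\<dots> = (\<Sum>(a, s)\<leftarrow>xs. a * (\<omega> powi int t) powi s) * (\<Sum>m\<in>S. y m * \<omega> powi (int t * m))"
      by (simp add: case_prod_unfold sum_list_mult_const)
    finally show ?thesis .
  qed
  have "N * (\<Sum>m\<in>S. (cmod (v m))\<^sup>2) = (\<Sum>t<N. (cmod (\<Sum>m\<in>S. v m * \<omega> powi (int t * m)))\<^sup>2)"
    unfolding \<omega>_def by (rule discrete_parseval[OF finS N, symmetric])
  also have "\<dots> \<le> (\<Sum>t<N. C\<^sup>2 * (cmod (\<Sum>m\<in>S. y m * \<omega> powi (int t * m)))\<^sup>2)"
    unfolding fourier norm_mult power_mult_distrib
    by (intro sum_mono mult_right_mono power_mono C \<omega>) auto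
  also have "\<dots> = C\<^sup>2 * (N * (\<Sum>m\<in>S. (cmod (y m))\<^sup>2))"
    unfolding sum_distrib_left[symmetric] \<omega>_def using discrete_parseval[OF finS N, of y] by simp
  finally have "(\<Sum>m\<in>S. (cmod (v m))\<^sup>2) \<le> C\<^sup>2 * (\<Sum>m\<in>S. (cmod (y m))\<^sup>2)"
    using maxD by (simp add: N_def mult.left_commute)
  moreover have "(\<Sum>m\<in>M. (cmod (v m))\<^sup>2) \<le> (\<Sum>m\<in>S. (cmod (v m))\<^sup>2)"
    using finS by (intro sum_mono2) (auto simp: S_def)
  moreover have "(\<Sum>m\<in>S. (cmod (y m))\<^sup>2) = (\<Sum>m\<in>Y. (cmod (y m))\<^sup>2)"
    by (rule sum.mono_neutral_right[OF finS]) (use Y(2) in \<open>auto simp: S_def\<close>)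
  ultimately show ?thesis
    unfolding v_def by simp
qed

lemma opbound_add:
  assumes "T \<in> ops P" "S \<in> ops P" "opbound P T B" "opbound P S C"
  shows "opbound P (T \<oplus>\<^bsub>fock_op_alg P\<^esub> S) (B + C)"
  unfolding opbound_def
proof (intro conjI ballI)
  fix \<xi>
  assume \<xi>: "\<xi> \<in> Fock P"
  have "hnorm (\<lambda>m. T \<xi> m + S \<xi> m) \<le> hnorm (T \<xi>) + hnorm (S \<xi>)"
    using Fock_add(2)[OF ops_Fock[OF assms(1) \<xi>] ops_Fock[OF assms(2) \<xi>]] .
  also have "\<dots> \<le> B * hnorm \<xi> + C * hnorm \<xi>"
    using assms \<xi> by (intro add_mono opboundD)
  finally show "hnorm ((T \<oplus>\<^bsub>fock_op_alg P\<^esub> S) \<xi>) \<le> (B + C) * hnorm \<xi>"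
    using \<xi> by (simp add: op_apply distrib_right)
qed (use assms in \<open>simp add: opbound_def\<close>)

lemma opbound_smult:
  assumes "T \<in> ops P" "opbound P T B"
  shows "opbound P (a \<odot>\<^bsub>fock_op_alg P\<^esub> T) (cmod a * B)"
  using assms unfolding opbound_def
  by (auto simp: op_apply hnorm_cscale[of _ P] mult.assoc intro!: mult_left_mono)

lemma opbound_zero: "opbound P \<zero>\<^bsub>fock_op_alg P\<^esub> 0"
  by (simp add: opbound_def op_apply)

lemma ops_sum:
  assumes "finite I" "\<And>x. x \<in> I \<Longrightarrow> T x \<in> ops P"
  shows "(\<lambda>\<xi>\<in>Fock P. \<lambda>m. \<Sum>x\<in>I. T x \<xi> m) \<in> ops P"
  by (rule ops_sum_mem[OF cstar_subalgebraD(1,2,3)[OF cstar_subalgebra_ops]]) (use assms in auto)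

lemma opbound_sum:
  fixes B :: real
  assumes "finite I" "\<And>x. x \<in> I \<Longrightarrow> T x \<in> ops P" "\<And>x. x \<in> I \<Longrightarrow> opbound P (T x) B"
  shows "opbound P (\<lambda>\<xi>\<in>Fock P. \<lambda>m. \<Sum>x\<in>I. T x \<xi> m) (card I * B)"
  using assms
proof (induction I)
  case empty
  then show ?case
    by (simp add: opbound_def)
next
  case (insert x I)
  have eq: "(\<lambda>\<xi>\<in>Fock P. \<lambda>m. \<Sum>x\<in>insert x I. T x \<xi> m) =
    T x \<oplus>\<^bsub>fock_op_alg P\<^esub> (\<lambda>\<xi>\<in>Fock P. \<lambda>m. \<Sum>x\<in>I. T x \<xi> m)"
    using insert.hyps by (auto simp: fock_op_alg_def fun_eq_iff)
  have "opbound P (T x \<oplus>\<^bsub>fock_op_alg P\<^esub> (\<lambda>\<xi>\<in>Fock P. \<lambda>m. \<Sum>x\<in>I. T x \<xi> m)) (B + card I * B)"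
    by (rule opbound_add[OF _ ops_sum _ insert.IH]) (use insert.prems insert.hyps in auto)
  then show ?case
    unfolding eq using insert.hyps by (simp add: distrib_right add.commute)
qed

section \<open>Matrix Laurent polynomials and their operators\<close>

text \<open>A list of terms: coefficient, row, column and exponent. Repeated terms simply add, so
  evaluation and the operator are both defined by recursion, and no normal form is involved.\<close>

type_synonym 'n tpoly = "(complex \<times> 'n \<times> 'n \<times> int) list"

definition tval :: "'n tpoly \<Rightarrow> complex \<Rightarrow> complex ^ 'n ^ 'n" where
  "tval xs z = (\<chi> i k. \<Sum>(a, i', k', l)\<leftarrow>xs. if i' = i \<and> k' = k then a * z powi l else 0)"

lemma tval_Nil: "tval [] z = 0"
  and tval_Cons: "tval ((a, i, k, l) # xs) z $ i' $ k' = (if i = i' \<and> k = k' then a * z powi l else 0) + tval xs z $ i' $ k'"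
  and tval_append: "tval (xs @ ys) z = tval xs z + tval ys z"
  by (simp_all add: tval_def vec_eq_iff)

context chain
begin

primrec tpop :: "'n tpoly \<Rightarrow> 'n fock_op" where
  "tpop [] = \<zero>\<^bsub>fock_op_alg P\<^esub>"
| "tpop (x # xs) = (case x of (a, i, k, l) \<Rightarrow> (a \<odot>\<^bsub>fock_op_alg P\<^esub> eop i k l) \<oplus>\<^bsub>fock_op_alg P\<^esub> tpop xs)"

lemma tpop_mem:
  assumes X: "cstar_subalgebra (fock_op_alg P) X" "\<And>i k l. eop i k l \<in> X"
  shows "tpop xs \<in> X"
  by (induction xs) (auto intro: cstar_subalgebraD[OF X(1)] X(2))

lemma tpop_ops: "tpop xs \<in> ops P"
  by (rule tpop_mem[OF cstar_subalgebra_ops eop_ops])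

lemma tpop_toeplitz: "tpop xs \<in> toeplitz"
  by (rule tpop_mem[OF toeplitz_subalgebra eop_toeplitz])

lemma tpop_apply:
  assumes "\<xi> \<in> Fock P"
  shows "tpop xs \<xi> m $ a $ b = (\<Sum>(\<alpha>, i, k, l)\<leftarrow>xs. \<alpha> * eop i k l \<xi> m $ a $ b)"
  by (induction xs) (auto simp: op_apply assms)

text \<open>With a single matrix position, every column \<open>b\<close> undergoes a scalar
  convolution followed by discarding entries: those at missing edges. Discarding cannot increase the
  norm, so the supremum of the scalar symbol is a bound.\<close>

lemma tpop_entry_bound:
  assumes i: "\<And>x. x \<in> set xs \<Longrightarrow> fst (snd x) = i \<and> fst (snd (snd x)) = k"
    and C: "\<And>z. cmod z = 1 \<Longrightarrow> cmod (tval xs z $ i $ k) \<le> C"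
  shows "opbound P (tpop xs) C"
  unfolding opbound_def
proof (intro conjI ballI)
  show C0: "0 \<le> C"
    using order_trans[OF norm_ge_zero C[of 1]] by simp
  fix \<xi>
  assume \<xi>: "\<xi> \<in> Fock P"
  define s where "s l = int r * l + c k - c i" for l
  define ys where "ys = map (\<lambda>(a, i, k, l). (a, s l)) xs"
  have ys_bound: "cmod (\<Sum>(a, s)\<leftarrow>ys. a * z powi s) \<le> C" if z: "cmod z = 1" for z
  proof -
    have z0: "z \<noteq> 0"
      using z by auto
    \<comment> \<open>Actual level shifts are \<open>r * l + c k - c i\<close>, so the scalar symbol
      is the polynomial at \<open>z^r\<close>, up to a unimodular factor.\<close>
    have "(\<Sum>(a, s)\<leftarrow>ys. a * z powi s) = z powi (c k - c i) * tval xs (z powi int r) $ i $ k"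
    proof -
      have "(\<Sum>(a, s)\<leftarrow>ys. a * z powi s) = (\<Sum>(a, i', k', l)\<leftarrow>xs. z powi (c k - c i) * (if i' = i \<and> k' = k then a * (z powi int r) powi l else 0))"
        unfolding ys_def map_map
        by (intro arg_cong[where f = sum_list] map_cong refl)
          (use i z0 in \<open>auto simp: s_def power_int_add power_int_diff power_int_mult\<close>)
      then show ?thesis
        by (simp add: tval_def case_prod_unfold del: power_int_of_nat flip: sum_list_const_mult)
    qed
    then show ?thesis
      using C[of "z powi int r"] z by (simp add: norm_mult norm_power_int norm_power)
  qed
  show "hnorm (tpop xs \<xi>) \<le> C * hnorm \<xi>"
  proof (rule hnorm_leI[OF ops_Fock[OF tpop_ops \<xi>]])
    show "0 \<le> C * hnorm \<xi>"
      using C0 \<xi> by simp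
    fix M
    \<comment> \<open>High enough that every level feeding a level below \<open>M\<close> lies below
      \<open>K\<close>; the vector can then be cut off at \<open>K\<close> and extended by zero to
      negative levels, which also accounts for the truncation at level \<open>0\<close>.\<close>
    define K where "K = M + nat (\<Sum>x\<leftarrow>xs. \<bar>s (snd (snd (snd x)))\<bar>)"
    have K: "int m - s l < int K" if "m < M" "(a, i, k, l) \<in> set xs" for m a i k l
    proof -
      have "\<bar>s l\<bar> \<le> (\<Sum>x\<leftarrow>xs. \<bar>s (snd (snd (snd x)))\<bar>)"
        using that(2) by (intro member_le_sum_list) (force simp: image_iff)+
      then show ?thesis
        using that(1) unfolding K_def by linarith
    qed
    define y where "y b m = (if 0 \<le> m \<and> m < int K then \<xi> (nat m) $ k $ b else 0)" for b and m :: int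
    have entry: "cmod (tpop xs \<xi> m $ a $ b) \<le> (if a = i then cmod (\<Sum>(a, s)\<leftarrow>ys. a * y b (int m - s)) else 0)"
      if m: "m < M" for m a b
    proof (cases "a = i \<and> (i, b) \<in> edges (mpow P m)")
      case True
      have "tpop xs \<xi> m $ a $ b = (\<Sum>(a, s)\<leftarrow>ys. a * y b (int m - s))"
        unfolding tpop_apply[OF \<xi>] ys_def map_map
      proof (intro arg_cong[where f = sum_list] map_cong refl)
        fix x
        assume x: "x \<in> set xs"
        obtain \<alpha> l where x_eq: "x = (\<alpha>, i, k, l)"
          using i[OF x] by (cases x) auto
        have "int m - s l < int K"
          using K[OF m] x unfolding x_eq by blast
        then show "(case x of (\<alpha>, i, k, l) \<Rightarrow> \<alpha> * eop i k l \<xi> m $ a $ b) =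
          ((\<lambda>(a, s). a * y b (int m - s)) \<circ> (\<lambda>(a, i, k, l). (a, s l))) x"
          using True \<xi> by (auto simp: x_eq eop_apply y_def s_def)
      qed
      then show ?thesis
        using True by simp
    next
      case False
      have "eop i' k' l \<xi> m $ a $ b = 0" if "(\<alpha>, i', k', l) \<in> set xs" for \<alpha> i' k' l
        using False i[OF that] \<xi> by (auto simp: eop_apply)
      then have "tpop xs \<xi> m $ a $ b = (\<Sum>x\<leftarrow>xs. 0)"
        unfolding tpop_apply[OF \<xi>] by (intro arg_cong[where f = sum_list] map_cong refl) auto
      then show ?thesis
        by simp
    qed
    have "(\<Sum>m<M. (norm (tpop xs \<xi> m))\<^sup>2) = (\<Sum>m<M. \<Sum>b\<in>UNIV. \<Sum>a\<in>UNIV. (cmod (tpop xs \<xi> m $ a $ b))\<^sup>2)"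
      by (simp only: norm_matrix_sq)
    also have "\<dots> \<le> (\<Sum>m<M. \<Sum>b\<in>UNIV. (cmod (\<Sum>(a, s)\<leftarrow>ys. a * y b (int m - s)))\<^sup>2)"
    proof (intro sum_mono)
      fix m b
      assume m: "m \<in> {..<M}"
      have "(cmod (tpop xs \<xi> m $ a $ b))\<^sup>2 \<le>
        (if a = i then (cmod (\<Sum>(a, s)\<leftarrow>ys. a * y b (int m - s)))\<^sup>2 else 0)" for a
        using power_mono[OF entry[of m a b] norm_ge_zero, of 2] m by (simp split: if_splits)
      then have "(\<Sum>a\<in>UNIV. (cmod (tpop xs \<xi> m $ a $ b))\<^sup>2) \<le>
        (\<Sum>a\<in>UNIV. if a = i then (cmod (\<Sum>(a, s)\<leftarrow>ys. a * y b (int m - s)))\<^sup>2 else 0)"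
        by (rule sum_mono)
      then show "(\<Sum>a\<in>UNIV. (cmod (tpop xs \<xi> m $ a $ b))\<^sup>2) \<le> (cmod (\<Sum>(a, s)\<leftarrow>ys. a * y b (int m - s)))\<^sup>2"
        by simp
    qed
    also have "\<dots> = (\<Sum>b\<in>UNIV. \<Sum>m\<in>int ` {..<M}. (cmod (\<Sum>(a, s)\<leftarrow>ys. a * y b (m - s)))\<^sup>2)"
      by (subst sum.swap) (simp add: sum.reindex)
    also have "\<dots> \<le> (\<Sum>b\<in>UNIV. C\<^sup>2 * (\<Sum>m\<in>int ` {..<K}. (cmod (y b m))\<^sup>2))"
    proof (intro sum_mono convolution_bound ys_bound)
      show "y b m = 0" if "m \<notin> int ` {..<K}" for b m
        using that by (auto simp: y_def image_iff) (metis lessThan_iff nonneg_int_cases of_nat_less_iff)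
    qed auto
    also have "\<dots> = C\<^sup>2 * (\<Sum>m<K. \<Sum>b\<in>UNIV. (cmod (\<xi> m $ k $ b))\<^sup>2)"
      unfolding sum_distrib_left[symmetric] by (subst sum.swap) (simp add: sum.reindex y_def)
    also have "\<dots> \<le> C\<^sup>2 * (\<Sum>m<K. (norm (\<xi> m))\<^sup>2)"
      unfolding norm_matrix_sq by (intro mult_left_mono sum_mono member_le_sum) auto
    also have "\<dots> \<le> C\<^sup>2 * (hnorm \<xi>)\<^sup>2"
      by (intro mult_left_mono sum_le_hnorm[OF \<xi>]) auto
    finally show "(\<Sum>m<M. (norm (tpop xs \<xi> m))\<^sup>2) \<le> (C * hnorm \<xi>)\<^sup>2"
      by (simp add: power_mult_distrib)
  qed
qed

text \<open>The triangle inequality over matrix positions. The constant is crude but independent of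
  the polynomial, which is what limits need.\<close>

lemma tpop_bound:
  fixes C :: real
  assumes C: "\<And>z i k. cmod z = 1 \<Longrightarrow> cmod (tval xs z $ i $ k) \<le> C"
  shows "opbound P (tpop xs) (CARD('n \<times> 'n) * C)"
proof -
  define F where "F i k = filter (\<lambda>x. fst (snd x) = i \<and> fst (snd (snd x)) = k) xs" for i k
  have eq: "tpop xs = (\<lambda>\<xi>\<in>Fock P. \<lambda>m. \<Sum>(i, k)\<in>UNIV. tpop (F i k) \<xi> m)"
  proof (rule ops_eqI)
    show "tpop xs \<in> Fock P \<rightarrow>\<^sub>E Fock P"
      by (rule ops_PiE[OF tpop_ops])
    show "(\<lambda>\<xi>\<in>Fock P. \<lambda>m. \<Sum>(i, k)\<in>UNIV. tpop (F i k) \<xi> m) \<in> Fock P \<rightarrow>\<^sub>E Fock P"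
      unfolding case_prod_unfold by (rule ops_PiE[OF ops_sum]) (auto intro: tpop_ops)
    fix \<xi>
    assume \<xi>: "\<xi> \<in> Fock P"
    have "tpop xs \<xi> m $ a $ b = (\<Sum>(i, k)\<in>UNIV. tpop (F i k) \<xi> m) $ a $ b" for m a b
    proof -
      have "(\<Sum>(i, k)\<in>UNIV. tpop (F i k) \<xi> m) $ a $ b =
        (\<Sum>p\<in>UNIV. \<Sum>(\<alpha>, i, k, l)\<leftarrow>xs. if p = (i, k) then \<alpha> * eop i k l \<xi> m $ a $ b else 0)"
      proof -
        have "tpop (F i' k') \<xi> m $ a $ b = (\<Sum>(\<alpha>, i, k, l)\<leftarrow>xs. if (i', k') = (i, k) then \<alpha> * eop i k l \<xi> m $ a $ b else 0)" for i' k'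
          unfolding tpop_apply[OF \<xi>] F_def by (induction xs) auto
        then show ?thesis
          by (simp add: case_prod_unfold prod_eq_iff)
      qed
      also have "\<dots> = (\<Sum>(\<alpha>, i, k, l)\<leftarrow>xs. \<alpha> * eop i k l \<xi> m $ a $ b)"
        by (induction xs) (auto simp: sum.distrib)
      finally show ?thesis
        by (simp add: tpop_apply[OF \<xi>])
    qed
    then show "tpop xs \<xi> = (\<lambda>\<xi>\<in>Fock P. \<lambda>m. \<Sum>(i, k)\<in>UNIV. tpop (F i k) \<xi> m) \<xi>"
      using \<xi> by (simp add: fun_eq_iff vec_eq_iff)
  qed
  show ?thesis
    unfolding eq case_prod_unfold
  proof (rule opbound_sum)
    fix p :: "'n \<times> 'n"
    show "tpop (F (fst p) (snd p)) \<in> ops P"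
      by (rule tpop_ops)
    show "opbound P (tpop (F (fst p) (snd p))) C"
    proof (rule tpop_entry_bound)
      show "fst (snd x) = fst p \<and> fst (snd (snd x)) = snd p" if "x \<in> set (F (fst p) (snd p))" for x
        using that by (simp add: F_def)
      have "tval (F i k) z $ i $ k = tval xs z $ i $ k" for i k z
        unfolding tval_def F_def by (induction xs) auto
      then show "cmod (tval (F (fst p) (snd p)) z $ fst p $ snd p) \<le> C" if "cmod z = 1" for z
        using C[OF that] by simp
    qed
  qed simp
qed


text \<open>The wave packet \<open>\<Sum>t<N. z\<^sup>-\<^sup>t e(k, M + r t)\<close> is an approximate eigenvector.\<close>

lemma test_vector:
  assumes z: "cmod z = 1" and xs: "\<And>a i k l. (a, i, k, l) \<in> set xs \<Longrightarrow> \<bar>l\<bar> \<le> int L"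
  obtains \<xi> where "\<xi> \<in> Fock P" "(hnorm \<xi>)\<^sup>2 = N" "\<forall>m<K. \<xi> m = 0"
    "finite {m. \<xi> m \<noteq> 0}" "card {m. \<xi> m \<noteq> 0} \<le> N"
    "real (N - 2 * L) * (cmod (tval xs z $ i $ k))\<^sup>2 \<le> (hnorm (tpop xs \<xi>))\<^sup>2"
proof -
  define d where "d = c k - c i"
  \<comment> \<open>A multiple of \<open>r\<close>, so that \<open>(k, k)\<close> is an edge on all
    levels of the packet; large enough to lie above \<open>K\<close> and to keep the target levels,
    displaced by \<open>d\<close>, above \<open>N0\<close>.\<close>
  define M where "M = r * (K + N0 + nat \<bar>d\<bar>)"
  have "1 * (K + N0 + nat \<bar>d\<bar>) \<le> M"
    unfolding M_def by (rule mult_le_mono1) (use r_pos in simp)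
  then have M: "K + N0 \<le> M" "int N0 \<le> int M + d"
    by auto
  define S where "S = (\<lambda>t. M + r * t) ` {..<N}"
  define \<xi> :: "nat \<Rightarrow> complex ^ 'n ^ 'n"
    where "\<xi> = (\<lambda>m. \<chi> a b. if a = k \<and> b = k \<and> m \<in> S then z powi (- int ((m - M) div r)) else 0)"
  have cardS: "card S = N" "finite S"
    unfolding S_def using r_pos by (auto simp: card_image inj_on_def)
  have norm_\<xi>: "(norm (\<xi> m))\<^sup>2 = (if m \<in> S then 1 else 0)" for m
  proof -
    have "(cmod (\<xi> m $ a $ b))\<^sup>2 = (if a = k then if b = k then if m \<in> S then 1 else 0 else 0 else 0)" for a b
      by (simp add: \<xi>_def norm_power_int z)
    then show ?thesis
      unfolding norm_matrix_sq by simp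
  qed
  have supp: "\<xi> m = 0 \<longleftrightarrow> m \<notin> S" for m
    using norm_\<xi>[of m] by (metis norm_eq_zero power_zero_numeral zero_eq_power2 zero_neq_one)
  have edge: "(k, k) \<in> edges (mpow P m)" if "m \<in> S" for m
    unfolding edges_iff by (rule class_pos) (use that M in \<open>auto simp: S_def M_def\<close>)
  have \<xi>: "\<xi> \<in> Fock P"
    unfolding Fock_iff
  proof (intro conjI allI)
    show "\<xi> n \<in> Arv P n" for n
      using edge by (auto simp: Arv_def \<xi>_def)
    show "summable (\<lambda>n. (norm (\<xi> n))\<^sup>2)"
      by (rule summable_finite[OF cardS(2)]) (simp add: norm_\<xi>)
  qed
  have "(hnorm \<xi>)\<^sup>2 = (\<Sum>m\<in>S. (norm (\<xi> m))\<^sup>2)"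
    unfolding hnorm_sq[OF \<xi>] by (rule suminf_finite[OF cardS(2)]) (simp add: norm_\<xi>)
  then have N: "(hnorm \<xi>)\<^sup>2 = N"
    by (simp add: norm_\<xi> cardS)
  have bound: "real (N - 2 * L) * (cmod (tval xs z $ i $ k))\<^sup>2 \<le> (hnorm (tpop xs \<xi>))\<^sup>2"
  proof -
    define lev where "lev q = nat (int M + int r * int q + d)" for q
    have lev: "int (lev q) = int M + int r * int q + d" for q
    proof -
      have "0 \<le> int r * int q"
        by simp
      then have "0 \<le> int M + int r * int q + d"
        using M(2) by linarith
      then show ?thesis
        by (simp add: lev_def)
    qed
    \<comment> \<open>Away from the ends of the packet every term of the polynomial finds its source
      level, so the eigenvector equation is exact. Shifts by at most \<open>L\<close> spoil
      \<open>L\<close> positions at each end; this is the loss \<open>2 * L\<close>.\<close>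
    have entry: "tpop xs \<xi> (lev q) $ i $ k = z powi (- int q) * tval xs z $ i $ k" if q: "L \<le> q" "q < N - L" for q
    proof -
      have edge_lev: "(i, k) \<in> edges (mpow P (lev q))"
        unfolding edges_iff
      proof (rule class_pos)
        show "N0 \<le> lev q"
        proof -
          have "0 \<le> int r * int q"
            by simp
          then show ?thesis
            using M(2) lev[of q] by linarith
        qed
        show "int r dvd int (lev q) - (c k - c i)"
          by (simp add: lev M_def d_def)
      qed
      have "eop i' k' l \<xi> (lev q) $ i $ k = (if i' = i \<and> k' = k then z powi (- int q) * z powi l else 0)"
        if l: "\<bar>l\<bar> \<le> int L" for i' k' l
      proof (cases "i' = i \<and> k' = k")
        case True
        define t where "t = nat (int q - l)"
        have t: "int t = int q - l" "t < N"
          using l q by (auto simp: t_def)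
        have src: "int (lev q) - (int r * l + c k - c i) = int (M + r * t)"
          by (simp add: lev t d_def algebra_simps)
        then have "int r * l + c k - c i \<le> int (lev q)" "nat (int (lev q) - (int r * l + c k - c i)) = M + r * t"
          by linarith+
        moreover have "\<xi> (M + r * t) $ k $ k = z powi (- int q) * z powi l"
        proof -
          have "z \<noteq> 0"
            using z by auto
          then have "z powi (- int q) * z powi l = z powi (- int t)"
            by (subst power_int_add[symmetric]) (auto simp: t)
          moreover have "M + r * t \<in> S"
            using t by (auto simp: S_def)
          ultimately show ?thesis
            using r_pos by (simp add: \<xi>_def)
        qed
        ultimately show ?thesis
          using True \<xi> edge_lev by (simp add: eop_apply)
      next
        case False
        then show ?thesis
          using \<xi> by (auto simp: eop_apply \<xi>_def)
      qed
      then show ?thesis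
        unfolding tpop_apply[OF \<xi>] tval_def vec_lambda_beta sum_list_const_mult[symmetric]
        by (intro arg_cong[where f = sum_list] map_cong refl) (use xs in \<open>auto split: if_splits\<close>)
    qed
    have inj: "inj_on lev {L..<N - L}"
    proof
      fix p q
      assume "lev p = lev q"
      then have "int (lev p) = int (lev q)"
        by simp
      then show "p = q"
        using r_pos by (simp add: lev)
    qed
    have "real (N - 2 * L) * (cmod (tval xs z $ i $ k))\<^sup>2 = (\<Sum>q\<in>{L..<N - L}. (cmod (tval xs z $ i $ k))\<^sup>2)"
      by (simp add: mult_2)
    also have "\<dots> \<le> (\<Sum>q\<in>{L..<N - L}. (norm (tpop xs \<xi> (lev q)))\<^sup>2)"
    proof (rule sum_mono)
      fix q
      assume "q \<in> {L..<N - L}"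
      then have "cmod (tpop xs \<xi> (lev q) $ i $ k) = cmod (tval xs z $ i $ k)"
        by (simp add: entry norm_mult norm_power_int z)
      then have "cmod (tval xs z $ i $ k) \<le> norm (tpop xs \<xi> (lev q))"
        using norm_entry_le[of "tpop xs \<xi> (lev q)" i k] by simp
      then show "(cmod (tval xs z $ i $ k))\<^sup>2 \<le> (norm (tpop xs \<xi> (lev q)))\<^sup>2"
        by (rule power_mono) simp
    qed
    also have "\<dots> = (\<Sum>m\<in>lev ` {L..<N - L}. (norm (tpop xs \<xi> m))\<^sup>2)"
      by (simp add: sum.reindex[OF inj])
    also have "\<dots> \<le> (hnorm (tpop xs \<xi>))\<^sup>2"
      by (rule sum_le_hnorm[OF ops_Fock[OF tpop_ops \<xi>]]) simp
    finally show ?thesis .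
  qed
  show thesis
  proof (rule that[OF \<xi> N _ _ _ bound])
    show "\<forall>m<K. \<xi> m = 0"
      using M(1) unfolding supp S_def by auto
    show "finite {m. \<xi> m \<noteq> 0}" "card {m. \<xi> m \<noteq> 0} \<le> N"
      using cardS by (simp_all add: supp)
  qed
qed

section \<open>Behaviour on high levels\<close>

text \<open>A bound modulo finitely many levels. The output may lie anywhere, which is why left
  multiplication is harmless while right multiplication needs a factor that keeps high levels
  high.\<close>

definition tail :: "'n fock_op \<Rightarrow> real \<Rightarrow> bool" where
  "tail T e \<longleftrightarrow> 0 \<le> e \<and> (\<exists>M. \<forall>\<xi>\<in>Fock P. (\<forall>m<M. \<xi> m = 0) \<longrightarrow> hnorm (T \<xi>) \<le> e * hnorm \<xi>)"

text \<open>The constant \<open>C\<close> is the same for all \<open>N\<close>, but the level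
  \<open>K\<close> from which it holds may grow with \<open>N\<close>. It is tested on wave packets,
  which have finitely many levels.\<close>

definition locally_bounded :: "'n fock_op \<Rightarrow> real \<Rightarrow> bool" where
  "locally_bounded T C \<longleftrightarrow> (\<forall>N. \<exists>K. \<forall>\<xi>\<in>Fock P. finite {m. \<xi> m \<noteq> 0} \<longrightarrow> card {m. \<xi> m \<noteq> 0} \<le> N \<longrightarrow>
     (\<forall>m<K. \<xi> m = 0) \<longrightarrow> hnorm (T \<xi>) \<le> C * hnorm \<xi>)"

text \<open>On a wave packet of \<open>N\<close> levels the polynomial operator has squared norm at
  least \<open>(N - 2 * L) * v\<close>, while the hypotheses bound it by
  \<open>(C + e)^2 * N\<close>. For long packets this forces
  \<open>v \<le> (C + e)^2\<close>.\<close>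

lemma tval_le:
  assumes T: "T \<in> ops P" "locally_bounded T C" and C: "0 \<le> C"
    and tail: "tail (op_minus P T (tpop xs)) e" and z: "cmod z = 1"
  shows "cmod (tval xs z $ i $ k) \<le> C + e"
proof (rule ccontr)
  define v where "v = (cmod (tval xs z $ i $ k))\<^sup>2"
  define L where "L = nat (\<Sum>x\<leftarrow>xs. \<bar>snd (snd (snd x))\<bar>)"
  have L: "\<bar>l\<bar> \<le> int L" if "(a, i, k, l) \<in> set xs" for a i k l
  proof -
    have "\<bar>l\<bar> \<le> (\<Sum>x\<leftarrow>xs. \<bar>snd (snd (snd x))\<bar>)"
      using that by (intro member_le_sum_list) (force simp: image_iff)+
    then show ?thesis
      unfolding L_def by linarith
  qed
  have e: "0 \<le> e"
    using tail by (simp add: tail_def)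
  assume "\<not> cmod (tval xs z $ i $ k) \<le> C + e"
  then have gap: "(C + e)\<^sup>2 < v"
    unfolding v_def using C e by (intro power_strict_mono) auto
  \<comment> \<open>A rearrangement of \<open>(C + e)^2 * N < (N - 2 * L) * v\<close>: the packet is
    so long that its ends do not close the gap.\<close>
  obtain N :: nat where N: "2 * L * v < N * (v - (C + e)\<^sup>2)"
    using reals_Archimedean3[of "v - (C + e)\<^sup>2"] gap by auto
  obtain K1 where K1: "\<And>\<xi>. \<xi> \<in> Fock P \<Longrightarrow> finite {m. \<xi> m \<noteq> 0} \<Longrightarrow> card {m. \<xi> m \<noteq> 0} \<le> N \<Longrightarrow>
     (\<And>m. m < K1 \<Longrightarrow> \<xi> m = 0) \<Longrightarrow> hnorm (T \<xi>) \<le> C * hnorm \<xi>"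
    using T(2) unfolding locally_bounded_def by metis
  obtain K2 where K2: "\<And>\<xi>. \<xi> \<in> Fock P \<Longrightarrow> (\<And>m. m < K2 \<Longrightarrow> \<xi> m = 0) \<Longrightarrow>
      hnorm ((op_minus P T (tpop xs)) \<xi>) \<le> e * hnorm \<xi>"
    using tail unfolding tail_def by metis
  obtain \<xi> where \<xi>: "\<xi> \<in> Fock P" "(hnorm \<xi>)\<^sup>2 = N" "\<forall>m<max K1 K2. \<xi> m = 0"
    "finite {m. \<xi> m \<noteq> 0}" "card {m. \<xi> m \<noteq> 0} \<le> N"
    and \<xi>6: "(N - 2 * L) * v \<le> (hnorm (tpop xs \<xi>))\<^sup>2"
    unfolding v_def by (rule test_vector[OF z L, where N = N and K = "max K1 K2" and i = i and k = k])
  have "hnorm (tpop xs \<xi>) \<le> hnorm (T \<xi>) + hnorm (\<lambda>m. T \<xi> m - tpop xs \<xi> m)"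
    using Fock_diff(2)[OF ops_Fock[OF T(1) \<xi>(1)] Fock_diff(1)[OF ops_Fock[OF T(1) \<xi>(1)] ops_Fock[OF tpop_ops \<xi>(1), of xs]]]
    by simp
  also have "\<dots> \<le> C * hnorm \<xi> + e * hnorm \<xi>"
    using K1[OF \<xi>(1,4,5)] K2[OF \<xi>(1)] \<xi>(1,3) by (intro add_mono) (auto simp: op_minus_apply)
  finally have "(hnorm (tpop xs \<xi>))\<^sup>2 \<le> ((C + e) * hnorm \<xi>)\<^sup>2"
    using hnorm_nonneg[OF ops_Fock[OF tpop_ops \<xi>(1)]] by (intro power_mono) (auto simp: distrib_right)
  then have "(N - 2 * L) * v \<le> (C + e)\<^sup>2 * N"
    using \<xi>(2) \<xi>6 by (simp add: power_mult_distrib)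
  moreover have "(real N - 2 * real L) * v \<le> (N - 2 * L) * v"
    by (intro mult_right_mono) (auto simp: v_def)
  ultimately show False
    using N by (simp add: algebra_simps)
qed

lemma tailD: "tail T e \<Longrightarrow> \<exists>M. \<forall>\<xi>\<in>Fock P. (\<forall>m<M. \<xi> m = 0) \<longrightarrow> hnorm (T \<xi>) \<le> e * hnorm \<xi>"
  by (simp add: tail_def)

lemma opbound_tail: "opbound P T B \<Longrightarrow> tail T B"
  by (auto simp: opbound_def tail_def)

lemma tail_mono: "tail T e \<Longrightarrow> e \<le> f \<Longrightarrow> tail T f"
  unfolding tail_def by (meson hnorm_nonneg mult_right_mono order_trans)

lemma tail_add:
  assumes "T \<in> ops P" "S \<in> ops P" "tail T e" "tail S f"
  shows "tail (T \<oplus>\<^bsub>fock_op_alg P\<^esub> S) (e + f)"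
proof -
  obtain M1 M2 where M: "\<And>\<xi>. \<xi> \<in> Fock P \<Longrightarrow> \<forall>m<M1. \<xi> m = 0 \<Longrightarrow> hnorm (T \<xi>) \<le> e * hnorm \<xi>"
      "\<And>\<xi>. \<xi> \<in> Fock P \<Longrightarrow> \<forall>m<M2. \<xi> m = 0 \<Longrightarrow> hnorm (S \<xi>) \<le> f * hnorm \<xi>"
    using tailD[OF assms(3)] tailD[OF assms(4)] by blast
  have "hnorm ((T \<oplus>\<^bsub>fock_op_alg P\<^esub> S) \<xi>) \<le> (e + f) * hnorm \<xi>"
    if \<xi>: "\<xi> \<in> Fock P" "\<forall>m<max M1 M2. \<xi> m = 0" for \<xi>
    using Fock_add(2)[OF ops_Fock[OF assms(1) \<xi>(1)] ops_Fock[OF assms(2) \<xi>(1)]] M[OF \<xi>(1)] \<xi>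
    by (simp add: op_apply distrib_right)
  then show ?thesis
    using assms(3,4) unfolding tail_def by (intro conjI exI[of _ "max M1 M2"]) auto
qed

lemma tail_smult:
  assumes "T \<in> ops P" "tail T e"
  shows "tail (a \<odot>\<^bsub>fock_op_alg P\<^esub> T) (cmod a * e)"
proof -
  obtain M where M: "\<And>\<xi>. \<xi> \<in> Fock P \<Longrightarrow> \<forall>m<M. \<xi> m = 0 \<Longrightarrow> hnorm (T \<xi>) \<le> e * hnorm \<xi>"
    using tailD[OF assms(2)] by blast
  have "hnorm ((a \<odot>\<^bsub>fock_op_alg P\<^esub> T) \<xi>) \<le> cmod a * e * hnorm \<xi>"
    if \<xi>: "\<xi> \<in> Fock P" "\<forall>m<M. \<xi> m = 0" for \<xi>
    using M[OF \<xi>] assms(1) \<xi>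
    by (simp add: op_apply hnorm_cscale[OF ops_Fock[OF assms(1) \<xi>(1)]] mult.assoc mult_left_mono)
  then show ?thesis
    using assms(2) unfolding tail_def by auto
qed

lemma tail_mult_left:
  assumes "S \<in> ops P" "opbound P T B" "tail S e"
  shows "tail (T \<otimes>\<^bsub>fock_op_alg P\<^esub> S) (B * e)"
proof -
  obtain M where M: "\<And>\<xi>. \<xi> \<in> Fock P \<Longrightarrow> \<forall>m<M. \<xi> m = 0 \<Longrightarrow> hnorm (S \<xi>) \<le> e * hnorm \<xi>"
    using tailD[OF assms(3)] by blast
  have B: "0 \<le> B"
    using assms by (simp add: opbound_def)
  have "hnorm ((T \<otimes>\<^bsub>fock_op_alg P\<^esub> S) \<xi>) \<le> B * e * hnorm \<xi>" if \<xi>: "\<xi> \<in> Fock P" "\<forall>m<M. \<xi> m = 0" for \<xi>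
    using order_trans[OF opboundD[OF assms(2) ops_Fock[OF assms(1) \<xi>(1)]] mult_left_mono[OF M[OF \<xi>] B]] \<xi>
    by (simp add: op_apply mult.assoc)
  then show ?thesis
    using assms(3) B unfolding tail_def by auto
qed

text \<open>A polynomial changes levels by a bounded amount. Vectors supported high up are therefore
  mapped to vectors supported high up, which makes right multiplication by it compatible with
  \<open>tail\<close>.\<close>

lemma tpop_band: "\<exists>L. \<forall>M. \<forall>\<xi>\<in>Fock P. (\<forall>m<M + L. \<xi> m = 0) \<longrightarrow> (\<forall>m<M. tpop xs \<xi> m = 0)"
proof (induction xs)
  case Nil
  then show ?case
    by (simp add: op_apply)
next
  case (Cons x xs)
  obtain a i k l where x: "x = (a, i, k, l)"
    by (cases x)
  obtain L where L: "\<And>M \<xi>. \<xi> \<in> Fock P \<Longrightarrow> \<forall>m<M + L. \<xi> m = 0 \<Longrightarrow> \<forall>m<M. tpop xs \<xi> m = 0"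
    using Cons by blast
  define L' where "L' = nat \<bar>int r * l + c k - c i\<bar>"
  have *: "tpop (x # xs) \<xi> m = 0" if \<xi>: "\<xi> \<in> Fock P" "\<forall>m<M + (L + L'). \<xi> m = 0" and m: "m < M" for M \<xi> m
  proof -
    have "\<xi> (nat (int m - (int r * l + c k - c i))) = 0" if "int r * l + c k - c i \<le> int m"
      using \<xi>(2) m that unfolding L'_def by auto
    then have "eop i k l \<xi> m = 0"
      using \<xi> by (auto simp: vec_eq_iff eop_apply)
    moreover have "tpop xs \<xi> m = 0"
      using L[OF \<xi>(1), of M] \<xi>(2) m by auto
    ultimately show ?thesis
      using \<xi> by (simp add: x op_apply vec_eq_iff)
  qed
  show ?case
    by (intro exI[of _ "L + L'"] allI ballI impI, rule *)
qed

lemma tail_mult_right: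
  assumes "opbound P (tpop xs) B" "tail T e"
  shows "tail (T \<otimes>\<^bsub>fock_op_alg P\<^esub> tpop xs) (e * B)"
proof -
  obtain M where M: "\<And>\<xi>. \<xi> \<in> Fock P \<Longrightarrow> \<forall>m<M. \<xi> m = 0 \<Longrightarrow> hnorm (T \<xi>) \<le> e * hnorm \<xi>"
    using tailD[OF assms(2)] by blast
  obtain L where L: "\<forall>M. \<forall>\<xi>\<in>Fock P. (\<forall>m<M + L. \<xi> m = 0) \<longrightarrow> (\<forall>m<M. tpop xs \<xi> m = 0)"
    using tpop_band[of xs] ..
  have e: "0 \<le> e"
    using assms by (simp add: tail_def)
  have "hnorm ((T \<otimes>\<^bsub>fock_op_alg P\<^esub> tpop xs) \<xi>) \<le> e * B * hnorm \<xi>" if \<xi>: "\<xi> \<in> Fock P" "\<forall>m<M + L. \<xi> m = 0" for \<xi>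
  proof -
    have "\<forall>m<M. tpop xs \<xi> m = 0"
      using L \<xi> by simp
    from order_trans[OF M[OF ops_Fock[OF tpop_ops \<xi>(1)] this] mult_left_mono[OF opboundD[OF assms(1) \<xi>(1)] e]]
    show ?thesis
      using \<xi> by (simp add: op_apply mult.assoc)
  qed
  then show ?thesis
    using assms unfolding tail_def opbound_def by (intro conjI exI[of _ "M + L"]) auto
qed

section \<open>Sums, adjoints and products of polynomial operators\<close>

lemma tpop_append: "tpop (xs @ ys) = tpop xs \<oplus>\<^bsub>fock_op_alg P\<^esub> tpop ys"
  by (rule ops_eqI[OF ops_PiE[OF tpop_ops] ops_PiE[OF op_closed(1)[OF tpop_ops tpop_ops]]])
    (simp add: op_add_apply fun_eq_iff vec_eq_iff tpop_apply)

definition tsmult :: "complex \<Rightarrow> 'n tpoly \<Rightarrow> 'n tpoly" where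
  "tsmult \<alpha> xs = map (\<lambda>(a, x). (\<alpha> * a, x)) xs"

lemma tpop_tsmult: "tpop (tsmult \<alpha> xs) = \<alpha> \<odot>\<^bsub>fock_op_alg P\<^esub> tpop xs"
proof (rule ops_eqI[OF ops_PiE[OF tpop_ops] ops_PiE[OF op_closed(3)[OF tpop_ops]]])
  fix \<xi>
  assume \<xi>: "\<xi> \<in> Fock P"
  have "tpop (tsmult \<alpha> xs) \<xi> m $ a $ b = \<alpha> * tpop xs \<xi> m $ a $ b" for m a b
    unfolding tpop_apply[OF \<xi>] tsmult_def by (induction xs) (auto simp: algebra_simps)
  then show "tpop (tsmult \<alpha> xs) \<xi> = (\<alpha> \<odot>\<^bsub>fock_op_alg P\<^esub> tpop xs) \<xi>"
    using \<xi> by (simp add: op_apply fun_eq_iff vec_eq_iff)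
qed

lemma tval_tsmult: "tval (tsmult \<alpha> xs) z = cscale \<alpha> (tval xs z)"
proof -
  have "tval (tsmult \<alpha> xs) z $ i $ k = \<alpha> * tval xs z $ i $ k" for i k
    unfolding tsmult_def by (induction xs) (auto simp: tval_Nil tval_Cons algebra_simps)
  then show ?thesis
    by (simp add: vec_eq_iff)
qed

definition tadj :: "'n tpoly \<Rightarrow> 'n tpoly" where
  "tadj xs = map (\<lambda>(a, i, k, l). (cnj a, k, i, - l)) xs"

lemma is_adjoint_tpop: "is_adjoint P (tpop xs) (tpop (tadj xs))"
proof (induction xs)
  case Nil
  then show ?case
    by (simp add: tadj_def is_adjoint_zero)
next
  case (Cons x xs)
  then show ?case
    by (cases x) (auto simp: tadj_def eop_ops tpop_ops
        intro!: is_adjoint_add is_adjoint_smult is_adjoint_eop)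
qed

lemma tval_tadj: "cmod z = 1 \<Longrightarrow> tval (tadj xs) z = ctranspose (tval xs z)"
proof -
  assume z: "cmod z = 1"
  have "tval (tadj xs) z $ i $ k = cnj (tval xs z $ k $ i)" for i k
    unfolding tadj_def
    by (induction xs) (auto simp: tval_Nil tval_Cons simp flip: cnj_powi_circle[OF z] simp del: complex_cnj_power_int)
  then show ?thesis
    by (simp add: vec_eq_iff ctranspose_def)
qed

definition tmult :: "'n tpoly \<Rightarrow> 'n tpoly \<Rightarrow> 'n tpoly" where
  "tmult xs ys = concat (map (\<lambda>(a, i, k, l). map (\<lambda>(a', k', j, l'). (a * a', i, j, l + l'))
     (filter (\<lambda>(a', k', j, l'). k' = k) ys)) xs)"

lemma tval_tmult:
  assumes "cmod z = 1"
  shows "tval (tmult xs ys) z = tval xs z ** tval ys z"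
proof -
  have z: "z \<noteq> 0"
    using assms by auto
  have "tval (tmult xs ys) z $ i $ j = (\<Sum>k\<in>UNIV. tval xs z $ i $ k * tval ys z $ k $ j)" for i j
  proof (induction xs)
    case Nil
    then show ?case
      by (simp add: tmult_def tval_Nil)
  next
    case (Cons x xs)
    obtain a i' k' l where x: "x = (a, i', k', l)"
      by (cases x)
    have "tval (map (\<lambda>(a', k, j, l'). (a * a', i', j, l + l')) (filter (\<lambda>(a', k, j, l'). k = k') ys)) z $ i $ j =
      (if i' = i then a * z powi l * tval ys z $ k' $ j else 0)"
      by (induction ys) (auto simp: tval_Nil tval_Cons power_int_add z algebra_simps)
    also have "\<dots> = (\<Sum>k\<in>UNIV. (if i' = i \<and> k' = k then a * z powi l else 0) * tval ys z $ k $ j)"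
      by (cases "i' = i") (simp_all add: if_distrib[of "\<lambda>x. x * _"] cong: if_cong)
    finally show ?case
      using Cons by (simp add: x tmult_def tval_append tval_Cons distrib_right sum.distrib)
  qed
  then show ?thesis
    by (simp add: vec_eq_iff matrix_matrix_mult_def)
qed

text \<open>The composition differs from the single shift only where the intermediate entry is
  missing. If the vector starts high enough, the intermediate level is at least \<open>N0\<close>,
  and there the congruence alone makes \<open>(k, b)\<close> an edge.\<close>

lemma eop_mult:
  assumes \<xi>: "\<xi> \<in> Fock P" "\<And>m. m < M \<Longrightarrow> \<xi> m = 0" and M: "int N0 + \<bar>int r * l' + c j - c k'\<bar> \<le> int M"
  shows "eop i k l (eop k' j l' \<xi>) m $ a $ b = (if k' = k then eop i j (l + l') \<xi> m $ a $ b else 0)"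
proof -
  define s s' where "s = int r * l + c k - c i" and "s' = int r * l' + c j - c k'"
  note F = ops_Fock[OF eop_ops \<xi>(1)]
  have "eop i k l (eop k' j l' \<xi>) m $ a $ b = eop i j (l + l') \<xi> m $ a $ b" if "k' = k"
  proof -
    have s': "int r * l' + c j - c k = s'"
      using that by (simp add: s'_def)
    show ?thesis
    proof (cases "a = i \<and> (i, b) \<in> edges (mpow P m) \<and> \<xi> (nat (int m - (s + s'))) $ j $ b \<noteq> 0 \<and> s + s' \<le> int m")
      case True
      define q where "q = nat (int m - (s + s'))"
      have q: "int q = int m - (s + s')"
        using True by (simp add: q_def)
      have "\<xi> q \<noteq> 0"
        using True by (auto simp: q_def)
      then have "M \<le> q"
        using \<xi>(2) not_less by blast
      \<comment> \<open>The intermediate level is \<open>m - s = q + s'\<close>, and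
        \<open>M\<close> was chosen to absorb the shift \<open>s'\<close>.\<close>
      then have ms: "int N0 \<le> int m - s"
        using M q by (simp add: s'_def)
      have "(j, b) \<in> edges (mpow P q)"
        using True Fock_eq0[OF \<xi>(1)] unfolding q_def by blast
      then have "int r dvd int q - (c b - c j)"
        unfolding edges_iff by (rule class_dvd)
      then have "int r dvd int q - (c b - c j) + int r * l'"
        by simp
      then have "int r dvd int (nat (int m - s)) - (c b - c k)"
        using ms q that by (simp add: s'_def algebra_simps)
      then have "(k, b) \<in> edges (mpow P (nat (int m - s)))"
        unfolding edges_iff using ms by (intro class_pos) auto
      moreover have "int r * (l + l') + c j - c i = s + s'"
        using that by (simp add: s_def s'_def algebra_simps)
      moreover have "s' \<le> int (nat (int m - s))" "s \<le> int m" "nat (int (nat (int m - s)) - s') = q"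
        using ms True by (auto simp: q_def)
      ultimately show ?thesis
        using True that F \<xi> by (simp add: eop_apply q_def s' flip: s_def)
    next
      case False
      have "int r * (l + l') + c j - c i = s + s'"
        using that by (simp add: s_def s'_def algebra_simps)
      moreover have "nat (int (nat (int m - s)) - s') = nat (int m - (s + s'))" if "s \<le> int m"
        using that by (simp add: algebra_simps)
      ultimately show ?thesis
        using False that F \<xi> by (auto simp: eop_apply s' simp flip: s_def)
    qed
  qed
  moreover have "eop i k l (eop k' j l' \<xi>) m $ a $ b = 0" if "k' \<noteq> k"
    using that F \<xi> by (simp add: eop_apply)
  ultimately show ?thesis
    by simp
qed

text \<open>Multiplication of polynomials is matched exactly above a level that covers all shifts in
  \<open>ys\<close>; hence the tail bound is \<open>0\<close> and not merely small.\<close>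

lemma tpop_tmult:
  "tail (op_minus P (tpop xs \<otimes>\<^bsub>fock_op_alg P\<^esub> tpop ys) (tpop (tmult xs ys))) 0"
proof -
  define M where "M = N0 + nat (\<Sum>(a, k, j, l)\<leftarrow>ys. \<bar>int r * l + c j - c k\<bar>)"
  have M: "int N0 + \<bar>int r * l + c j - c k\<bar> \<le> int M" if "(a, k, j, l) \<in> set ys" for a k j l
  proof -
    have "\<bar>int r * l + c j - c k\<bar> \<le> (\<Sum>(a, k, j, l)\<leftarrow>ys. \<bar>int r * l + c j - c k\<bar>)"
      using that by (intro member_le_sum_list) (force simp: image_iff)+
    then show ?thesis
      unfolding M_def by linarith
  qed
  have "tpop xs (tpop ys \<xi>) = tpop (tmult xs ys) \<xi>" if \<xi>: "\<xi> \<in> Fock P" "\<forall>m<M. \<xi> m = 0" for \<xi>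
  proof -
    have eop_tpop: "eop i k l (tpop ys \<xi>) m $ a $ b =
      (\<Sum>(\<alpha>, k', j, l')\<leftarrow>ys. \<alpha> * (if k' = k then eop i j (l + l') \<xi> m $ a $ b else 0))" for i k l m a b
    proof -
      have "eop i k l (tpop ys \<xi>) m $ a $ b = (\<Sum>(\<alpha>, k', j, l')\<leftarrow>ys. \<alpha> * eop i k l (eop k' j l' \<xi>) m $ a $ b)"
      proof -
        have "eop i k l (eop k' j l' \<xi>) m $ a $ b = (if a = i \<and> int r * l + c k - c i \<le> int m \<and> (i, b) \<in> edges (mpow P m)
           then eop k' j l' \<xi> (nat (int m - (int r * l + c k - c i))) $ k $ b else 0)" for k' j l'
          by (rule eop_apply[OF ops_Fock[OF eop_ops \<xi>(1)]])
        then show ?thesis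
          unfolding eop_apply[OF ops_Fock[OF tpop_ops \<xi>(1)]] tpop_apply[OF \<xi>(1)]
          by (cases "a = i \<and> int r * l + c k - c i \<le> int m \<and> (i, b) \<in> edges (mpow P m)")
            (simp_all only: case_prod_unfold if_True if_False mult_zero_right simp_thms sum_list_0)
      qed
      also have "\<dots> = (\<Sum>(\<alpha>, k', j, l')\<leftarrow>ys. \<alpha> * (if k' = k then eop i j (l + l') \<xi> m $ a $ b else 0))"
      proof (intro arg_cong[where f = sum_list] map_cong refl)
        fix y
        assume "y \<in> set ys"
        moreover obtain \<alpha> k' j l' where y: "y = (\<alpha>, k', j, l')"
          by (cases y)
        ultimately show "(case y of (\<alpha>, k', j, l') \<Rightarrow> \<alpha> * eop i k l (eop k' j l' \<xi>) m $ a $ b) =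
          (case y of (\<alpha>, k', j, l') \<Rightarrow> \<alpha> * (if k' = k then eop i j (l + l') \<xi> m $ a $ b else 0))"
          using eop_mult[OF \<xi>(1) _ M] \<xi>(2) by simp
      qed
      finally show ?thesis .
    qed
    have "tpop xs (tpop ys \<xi>) m $ a $ b = tpop (tmult xs ys) \<xi> m $ a $ b" for m a b
    proof (induction xs)
      case Nil
      then show ?case
        using \<xi> by (simp add: tmult_def op_apply ops_Fock[OF tpop_ops])
    next
      case (Cons x xs)
      obtain \<beta> i k l where x: "x = (\<beta>, i, k, l)"
        by (cases x)
      have "\<beta> * (\<Sum>(\<alpha>, k', j, l')\<leftarrow>ys. \<alpha> * (if k' = k then eop i j (l + l') \<xi> m $ a $ b else 0)) =
        tpop (map (\<lambda>(a', k', j, l'). (\<beta> * a', i, j, l + l')) (filter (\<lambda>(a', k', j, l'). k' = k) ys)) \<xi> m $ a $ b"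
        unfolding tpop_apply[OF \<xi>(1)] by (induction ys) (auto simp: algebra_simps)
      then show ?case
        using Cons \<xi> by (simp add: x tmult_def op_apply ops_Fock[OF tpop_ops] tpop_append eop_tpop)
    qed
    then show ?thesis
      by (simp add: fun_eq_iff vec_eq_iff)
  qed
  then show ?thesis
    unfolding tail_def by (intro conjI exI[of _ M]) (auto simp: op_apply cscale_minus1)
qed

end


section \<open>Operators with a symbol\<close>

lemma ops_ext:
  assumes "T \<in> ops P" "S \<in> ops P" "\<And>\<xi> m. \<xi> \<in> Fock P \<Longrightarrow> T \<xi> m = S \<xi> m"
  shows "T = S"
  using assms by (intro ops_eqI[of _ P] ops_PiE) (auto simp: fun_eq_iff)

lemma op_minus_ops: "T \<in> ops P \<Longrightarrow> S \<in> ops P \<Longrightarrow> op_minus P T S \<in> ops P"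
  by simp

text \<open>The squared norm of \<open>S \<xi>\<close> is the trace of the inner product of
  \<open>T (S \<xi>)\<close> with \<open>\<xi>\<close>. Estimating each of the columns separately
  costs the factor \<open>CARD('n)\<close>.\<close>

lemma opbound_is_adjoint:
  fixes P :: "real ^ 'n ^ 'n" and B :: real
  assumes T: "T \<in> ops P" and adj: "is_adjoint P T S" and B: "opbound P T B"
  shows "opbound P S (CARD('n) * B)"
  unfolding opbound_def
proof (intro conjI ballI)
  show "0 \<le> CARD('n) * B"
    using B by (simp add: opbound_def)
  fix \<xi>
  assume \<xi>: "\<xi> \<in> Fock P"
  have S: "S \<in> ops P"
    using is_adjoint_ops(2)[OF adj ops_PiE[OF T]] .
  note S\<xi> = ops_Fock[OF S \<xi>] and TS\<xi> = ops_Fock[OF T ops_Fock[OF S \<xi>]]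
  have "(hnorm (S \<xi>))\<^sup>2 = cmod (\<Sum>j\<in>UNIV. fock_inner (S \<xi>) (S \<xi>) $ j)"
    unfolding hnorm_sq_eq_inner[OF S\<xi>, symmetric] norm_of_real by simp
  also have "(\<Sum>j\<in>UNIV. fock_inner (S \<xi>) (S \<xi>) $ j) = (\<Sum>j\<in>UNIV. fock_inner (T (S \<xi>)) \<xi> $ j)"
    using adj S\<xi> \<xi> by (simp add: is_adjoint_def)
  also have "cmod \<dots> \<le> (\<Sum>j\<in>(UNIV :: 'n set). hnorm (T (S \<xi>)) * hnorm \<xi>)"
    by (rule order_trans[OF norm_sum sum_mono]) (rule fock_inner_le[OF TS\<xi> \<xi>])
  also have "\<dots> \<le> CARD('n) * (B * hnorm (S \<xi>) * hnorm \<xi>)"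
    using mult_right_mono[OF opboundD[OF B S\<xi>] hnorm_nonneg[OF \<xi>]] by simp
  finally have "hnorm (S \<xi>) * hnorm (S \<xi>) \<le> (CARD('n) * B * hnorm \<xi>) * hnorm (S \<xi>)"
    by (simp add: power2_eq_square mult_ac)
  then show "hnorm (S \<xi>) \<le> CARD('n) * B * hnorm \<xi>"
    using hnorm_nonneg[OF S\<xi>] hnorm_nonneg[OF \<xi>] B unfolding opbound_def
    by (cases "hnorm (S \<xi>) = 0") auto
qed

lemma is_adjoint_minus:
  assumes "is_adjoint P T S" "is_adjoint P T' S'" "T \<in> ops P" "T' \<in> ops P"
  shows "is_adjoint P (op_minus P T T') (op_minus P S S')"
  using is_adjoint_add[OF assms(1) is_adjoint_smult[OF assms(2,4), of "- 1"] assms(3)] assms(4) by simp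

section \<open>Norm limits of adjointable operators\<close>

lemma fock_inner_tendsto:
  assumes X: "\<And>n. X n \<in> Fock P" "x \<in> Fock P" "\<eta> \<in> Fock P"
    and lim: "(\<lambda>n. hnorm (\<lambda>m. X n m - x m)) \<longlonglongrightarrow> 0"
  shows "(\<lambda>n. fock_inner (X n) \<eta> $ j) \<longlonglongrightarrow> fock_inner x \<eta> $ j"
proof (rule Lim_null[THEN iffD2])
  have "cmod (fock_inner (X n) \<eta> $ j - fock_inner x \<eta> $ j) \<le> hnorm (\<lambda>m. X n m - x m) * hnorm \<eta>" for n
  proof -
    have "fock_inner (\<lambda>m. X n m - x m) \<eta> $ j = fock_inner (X n) \<eta> $ j - fock_inner x \<eta> $ j"
      using fock_inner_add_left[OF X(3) X(1) Fock_cscale[OF X(2)], of n "- 1"]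
        fock_inner_cscale_left[OF X(3,2), of "- 1" j]
      by (simp add: cscale_minus1)
    then show ?thesis
      using fock_inner_le[OF Fock_diff(1)[OF X(1,2)] X(3), of n j] by simp
  qed
  moreover have "(\<lambda>n. hnorm (\<lambda>m. X n m - x m) * hnorm \<eta>) \<longlonglongrightarrow> 0"
    using tendsto_mult_right[OF lim, of "hnorm \<eta>"] by simp
  ultimately show "(\<lambda>n. fock_inner (X n) \<eta> $ j - fock_inner x \<eta> $ j) \<longlonglongrightarrow> 0"
    by (rule Lim_null_comparison[OF always_eventually[OF allI]])
qed

lemma op_pointwise_limit:
  fixes T :: "nat \<Rightarrow> 'n::finite fock_op"
  assumes T: "\<And>n. T n \<in> ops P"
    and cauchy: "\<And>e. 0 < e \<Longrightarrow> \<exists>N. \<forall>m\<ge>N. \<forall>n\<ge>N. opbound P (op_minus P (T m) (T n)) e"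
  obtains S where "S \<in> Fock P \<rightarrow>\<^sub>E Fock P"
    "\<forall>\<xi>\<in>Fock P. (\<lambda>n. hnorm (\<lambda>m. T n \<xi> m - S \<xi> m)) \<longlonglongrightarrow> 0"
proof -
  have "\<exists>x\<in>Fock P. (\<lambda>n. hnorm (\<lambda>m. T n \<xi> m - x m)) \<longlonglongrightarrow> 0" if \<xi>: "\<xi> \<in> Fock P" for \<xi>
  proof -
    have "\<exists>N. \<forall>m\<ge>N. \<forall>n\<ge>N. hnorm (\<lambda>l. T m \<xi> l - T n \<xi> l) \<le> e" if e: "0 < e" for e
    proof -
      define h where "h = hnorm \<xi> + 1"
      have h: "0 < h" "hnorm \<xi> \<le> h"
        using hnorm_nonneg[OF \<xi>] by (simp_all add: h_def)
      obtain N where N: "\<And>m n. N \<le> m \<Longrightarrow> N \<le> n \<Longrightarrow> opbound P (op_minus P (T m) (T n)) (e / h)"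
        using cauchy[of "e / h"] e h by (meson divide_pos_pos)
      have "hnorm (\<lambda>l. T m \<xi> l - T n \<xi> l) \<le> e" if "N \<le> m" "N \<le> n" for m n
      proof -
        have "hnorm (\<lambda>l. T m \<xi> l - T n \<xi> l) \<le> e / h * hnorm \<xi>"
          using opboundD[OF N[OF that] \<xi>] by (simp add: op_minus_apply[OF \<xi>])
        also have "\<dots> \<le> e / h * h"
          using h \<open>0 < e\<close> by (intro mult_left_mono) auto
        finally show ?thesis
          using h by simp
      qed
      then show ?thesis
        by blast
    qed
    then show ?thesis
      using Fock_complete[of "\<lambda>n. T n \<xi>" P] ops_Fock[OF T \<xi>] by blast
  qed
  then have ex: "\<exists>x. x \<in> Fock P \<and> (\<lambda>n. hnorm (\<lambda>m. T n \<xi> m - x m)) \<longlonglongrightarrow> 0" if "\<xi> \<in> Fock P" for \<xi>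
    using that by blast
  define S where "S = (\<lambda>\<xi>\<in>Fock P. SOME x. x \<in> Fock P \<and> (\<lambda>n. hnorm (\<lambda>m. T n \<xi> m - x m)) \<longlonglongrightarrow> 0)"
  have S: "S \<xi> \<in> Fock P \<and> (\<lambda>n. hnorm (\<lambda>m. T n \<xi> m - S \<xi> m)) \<longlonglongrightarrow> 0" if "\<xi> \<in> Fock P" for \<xi>
    using someI_ex[OF ex[OF that]] that by (simp add: S_def)
  show thesis
  proof (rule that)
    show "S \<in> Fock P \<rightarrow>\<^sub>E Fock P"
      using S by (intro PiE_I) (auto simp: S_def)
  qed (use S in blast)
qed

text \<open>The adjoints form a Cauchy sequence too, by \<open>opbound_is_adjoint\<close>. Both
  sequences converge pointwise, and the adjoint relation passes to the limit, so the limit is again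
  adjointable.\<close>

lemma ops_complete:
  fixes P :: "real ^ 'n ^ 'n" and T :: "nat \<Rightarrow> 'n fock_op"
  assumes T: "\<And>n. T n \<in> ops P"
    and cauchy: "\<And>e. 0 < e \<Longrightarrow> \<exists>N. \<forall>m\<ge>N. \<forall>n\<ge>N. opbound P (op_minus P (T m) (T n)) e"
  obtains S where "S \<in> ops P" "\<forall>e>0. \<exists>N. \<forall>n\<ge>N. opbound P (op_minus P (T n) S) e"
proof -
  define T' where "T' n = star (fock_op_alg P) (T n)" for n
  have T': "T' n \<in> ops P" and adj: "is_adjoint P (T n) (T' n)" for n
    using ops_star[OF T] by (simp_all add: T'_def)
  have cauchy': "\<exists>N. \<forall>m\<ge>N. \<forall>n\<ge>N. opbound P (op_minus P (T' m) (T' n)) e" if e: "0 < e" for e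
  proof -
    obtain N where N: "\<And>m n. N \<le> m \<Longrightarrow> N \<le> n \<Longrightarrow> opbound P (op_minus P (T m) (T n)) (e / CARD('n))"
      using cauchy[of "e / CARD('n)"] e by (meson divide_pos_pos of_nat_0_less_iff zero_less_card_finite)
    have "opbound P (op_minus P (T' m) (T' n)) e" if "N \<le> m" "N \<le> n" for m n
      using opbound_is_adjoint[OF op_minus_ops[OF T T] is_adjoint_minus[OF adj adj T T] N[OF that]] by simp
    then show ?thesis
      by blast
  qed
  obtain S where S: "S \<in> Fock P \<rightarrow>\<^sub>E Fock P"
    and limS: "\<forall>\<xi>\<in>Fock P. (\<lambda>n. hnorm (\<lambda>m. T n \<xi> m - S \<xi> m)) \<longlonglongrightarrow> 0"
    by (rule op_pointwise_limit[OF T cauchy])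
  obtain S' where S': "S' \<in> Fock P \<rightarrow>\<^sub>E Fock P"
    and limS': "\<forall>\<xi>\<in>Fock P. (\<lambda>n. hnorm (\<lambda>m. T' n \<xi> m - S' \<xi> m)) \<longlonglongrightarrow> 0"
    by (rule op_pointwise_limit[OF T' cauchy'])
  have "fock_inner (S \<xi>) \<eta> $ j = fock_inner \<xi> (S' \<eta>) $ j" if \<xi>: "\<xi> \<in> Fock P" and \<eta>: "\<eta> \<in> Fock P" for \<xi> \<eta> j
  proof (rule LIMSEQ_unique)
    have F: "S \<xi> \<in> Fock P" "S' \<eta> \<in> Fock P"
      using S S' \<xi> \<eta> by auto
    show "(\<lambda>n. fock_inner (T n \<xi>) \<eta> $ j) \<longlonglongrightarrow> fock_inner (S \<xi>) \<eta> $ j"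
      by (rule fock_inner_tendsto[OF ops_Fock[OF T \<xi>] F(1) \<eta> limS[rule_format, OF \<xi>]])
    have "(\<lambda>n. fock_inner (T' n \<eta>) \<xi> $ j) \<longlonglongrightarrow> fock_inner (S' \<eta>) \<xi> $ j"
      by (rule fock_inner_tendsto[OF ops_Fock[OF T' \<eta>] F(2) \<xi> limS'[rule_format, OF \<eta>]])
    from tendsto_cnj[OF this] show "(\<lambda>n. fock_inner (T n \<xi>) \<eta> $ j) \<longlonglongrightarrow> fock_inner \<xi> (S' \<eta>) $ j"
      using adj \<xi> \<eta> fock_inner_cnj[OF ops_Fock[OF T' \<eta>] \<xi>] fock_inner_cnj[OF F(2) \<xi>]
      by (simp add: is_adjoint_def)
  qed
  then have adjS: "is_adjoint P S S'"
    using is_adjoint_iff[OF S] S' by simp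
  then have SP: "S \<in> ops P"
    using is_adjoint_ops(1) S by blast
  have "\<exists>N. \<forall>n\<ge>N. opbound P (op_minus P (T n) S) e" if e: "0 < e" for e
  proof -
    obtain N where N: "\<And>m n. N \<le> m \<Longrightarrow> N \<le> n \<Longrightarrow> opbound P (op_minus P (T m) (T n)) e"
      using cauchy[OF e] by blast
    have "opbound P (op_minus P (T n) S) e" if n: "N \<le> n" for n
      unfolding opbound_def
    proof (intro conjI ballI)
      fix \<xi>
      assume \<xi>: "\<xi> \<in> Fock P"
      note F = ops_Fock[OF T \<xi>] ops_Fock[OF SP \<xi>]
      \<comment> \<open>Comparison with a later \<open>T l\<close>: the remaining error depends on
        \<open>\<xi>\<close> but vanishes as \<open>l\<close> grows, leaving a bound uniform in
        \<open>\<xi>\<close>.\<close>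
      have "hnorm (\<lambda>m. T n \<xi> m - S \<xi> m) \<le> e * hnorm \<xi> + 0"
      proof (rule tendsto_lowerbound)
        show "(\<lambda>l. e * hnorm \<xi> + hnorm (\<lambda>m. T l \<xi> m - S \<xi> m)) \<longlonglongrightarrow> e * hnorm \<xi> + 0"
          by (intro tendsto_intros limS[rule_format, OF \<xi>])
        have "hnorm (\<lambda>m. T n \<xi> m - S \<xi> m) \<le> e * hnorm \<xi> + hnorm (\<lambda>m. T l \<xi> m - S \<xi> m)" if "N \<le> l" for l
          using opboundD[OF N[OF n that] \<xi>] Fock_add(2)[OF Fock_diff(1)[OF F(1)[of n] F(1)[of l]] Fock_diff(1)[OF F(1)[of l] F(2)]]
          by (simp add: op_minus_apply[OF \<xi>])
        then show "\<forall>\<^sub>F l in sequentially. hnorm (\<lambda>m. T n \<xi> m - S \<xi> m) \<le> e * hnorm \<xi> + hnorm (\<lambda>m. T l \<xi> m - S \<xi> m)"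
          unfolding eventually_sequentially by blast
      qed simp
      then show "hnorm (op_minus P (T n) S \<xi>) \<le> e * hnorm \<xi>"
        by (simp add: op_minus_apply[OF \<xi>])
    qed (use \<open>0 < e\<close> in simp)
    then show ?thesis
      by blast
  qed
  then show thesis
    by (intro that[OF SP]) simp
qed

section \<open>Approximate symbols\<close>

text \<open>Uniform distance on the circle, entry by entry; it is equivalent to the distance in
  operator norm and leaves values off the circle free.\<close>

definition near :: "real \<Rightarrow> (complex \<Rightarrow> complex ^ 'n ^ 'n) \<Rightarrow> (complex \<Rightarrow> complex ^ 'n ^ 'n) \<Rightarrow> bool" where
  "near e F G \<longleftrightarrow> (\<forall>z i k. cmod z = 1 \<longrightarrow> cmod (F z $ i $ k - G z $ i $ k) \<le> e)"

lemma nearD: "near e F G \<Longrightarrow> cmod z = 1 \<Longrightarrow> cmod (F z $ i $ k - G z $ i $ k) \<le> e"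
  by (simp add: near_def)

lemma near_trans:
  assumes "near e F G" "near f G H"
  shows "near (e + f) F H"
  unfolding near_def
proof (intro allI impI)
  fix z :: complex and i k
  assume z: "cmod z = 1"
  show "cmod (F z $ i $ k - H z $ i $ k) \<le> e + f"
    using norm_triangle_ineq[of "F z $ i $ k - G z $ i $ k" "G z $ i $ k - H z $ i $ k"]
      nearD[OF assms(1) z, of i k] nearD[OF assms(2) z, of i k] by simp
qed

lemma near_sym: "near e F G \<Longrightarrow> near e G F"
  by (simp add: near_def norm_minus_commute)

lemma near_mono: "near e F G \<Longrightarrow> e \<le> f \<Longrightarrow> near f F G"
  unfolding near_def by (meson order_trans)

lemma near_ctranspose: "near e F G \<Longrightarrow> near e (\<lambda>z. ctranspose (F z)) (\<lambda>z. ctranspose (G z))"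
  by (simp add: near_def ctranspose_def flip: complex_cnj_diff)

lemma tval_bounded: "\<exists>C\<ge>0. \<forall>z i k. cmod z = 1 \<longrightarrow> cmod (tval xs z $ i $ k) \<le> C"
proof (induction xs)
  case Nil
  then show ?case
    by (auto simp: tval_Nil)
next
  case (Cons x xs)
  obtain a i k l where x: "x = (a, i, k, l)"
    by (cases x)
  obtain C where C: "0 \<le> C" "\<And>z i k. cmod z = 1 \<Longrightarrow> cmod (tval xs z $ i $ k) \<le> C"
    using Cons by blast
  have "cmod (tval (x # xs) z $ i' $ k') \<le> cmod a + C" if z: "cmod z = 1" for z i' k'
  proof -
    have "cmod (if i = i' \<and> k = k' then a * z powi l else 0) \<le> cmod a"
      by (simp add: norm_mult norm_power_int z)
    then show ?thesis
      unfolding x tval_Cons using C(2)[OF z, of i' k'] by (rule norm_triangle_mono)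
  qed
  then show ?case
    using C(1) by (intro exI[of _ "cmod a + C"]) auto
qed

lemma continuous_on_tval: "continuous_on (sphere 0 1) (tval xs)"
proof (induction xs)
  case Nil
  then show ?case
    by (simp add: tval_Nil[abs_def])
next
  case (Cons x xs)
  obtain a i k l where x: "x = (a, i, k, l)"
    by (cases x)
  have "continuous_on (sphere 0 1) (\<lambda>z. \<chi> i' k'. (if i = i' \<and> k = k' then a * z powi l else 0) + tval xs z $ i' $ k')"
  proof (intro continuous_on_vec_lambda continuous_on_add)
    show "continuous_on (sphere 0 1) (\<lambda>z. if i = i' \<and> k = k' then a * z powi l else 0)" for i' k'
      by (cases "i = i' \<and> k = k'") (auto intro!: continuous_intros)
    show "continuous_on (sphere 0 1) (\<lambda>z. tval xs z $ i' $ k')" for i' k'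
      by (intro continuous_on_component Cons)
  qed
  moreover have "tval (x # xs) = (\<lambda>z. \<chi> i' k'. (if i = i' \<and> k = k' then a * z powi l else 0) + tval xs z $ i' $ k')"
    by (auto simp: x vec_eq_iff tval_Cons)
  ultimately show ?case
    by simp
qed

context chain
begin

text \<open>A function and an operator correspond if the same polynomials approximate the one
  uniformly and the other on high levels. Continuity of \<open>F\<close> on the circle and its
  uniqueness there are consequences.\<close>

definition good :: "'n fock_op \<Rightarrow> (complex \<Rightarrow> complex ^ 'n ^ 'n) \<Rightarrow> bool" where
  "good T F \<longleftrightarrow> (\<forall>e>0. \<exists>xs. near e F (tval xs) \<and> tail (op_minus P T (tpop xs)) e)"

lemma goodD:
  assumes "good T F" "0 < e"
  obtains xs where "near e F (tval xs)" "tail (op_minus P T (tpop xs)) e"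
  using assms unfolding good_def by blast

lemma good_tpop:
  assumes "near 0 F (tval xs)"
  shows "good (tpop xs) F"
  unfolding good_def
proof (intro allI impI exI conjI)
  fix e :: real
  assume "0 < e"
  then show "near e F (tval xs)"
    using near_mono[OF assms] by simp
  have "op_minus P (tpop xs) (tpop xs) = \<zero>\<^bsub>fock_op_alg P\<^esub>"
    by (rule ops_ext[of _ P]) (simp_all add: tpop_ops op_apply cscale_minus1)
  then show "tail (op_minus P (tpop xs) (tpop xs)) e"
    using opbound_tail[OF opbound_mono[OF opbound_zero]] \<open>0 < e\<close> by simp
qed

lemma good_add:
  assumes ops: "T \<in> ops P" "S \<in> ops P" and good: "good T F" "good S G"
  shows "good (T \<oplus>\<^bsub>fock_op_alg P\<^esub> S) (\<lambda>z. F z + G z)"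
  unfolding good_def
proof (intro allI impI)
  fix e :: real
  assume "0 < e"
  then obtain xs ys where xs: "near (e / 2) F (tval xs)" "tail (op_minus P T (tpop xs)) (e / 2)"
    and ys: "near (e / 2) G (tval ys)" "tail (op_minus P S (tpop ys)) (e / 2)"
    using goodD[OF good(1), of "e / 2"] goodD[OF good(2), of "e / 2"] by (metis half_gt_zero)
  have "op_minus P (T \<oplus>\<^bsub>fock_op_alg P\<^esub> S) (tpop (xs @ ys)) =
    op_minus P T (tpop xs) \<oplus>\<^bsub>fock_op_alg P\<^esub> op_minus P S (tpop ys)"
    by (rule ops_ext[of _ P]) (simp_all add: ops tpop_ops op_apply cscale_minus1 tpop_append)
  then have "tail (op_minus P (T \<oplus>\<^bsub>fock_op_alg P\<^esub> S) (tpop (xs @ ys))) (e / 2 + e / 2)"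
    using tail_add[OF _ _ xs(2) ys(2)] ops tpop_ops by simp
  moreover have "near (e / 2 + e / 2) (\<lambda>z. F z + G z) (tval (xs @ ys))"
    unfolding near_def tval_append
  proof (intro allI impI)
    fix z :: complex and i k
    assume z: "cmod z = 1"
    show "cmod ((F z + G z) $ i $ k - (tval xs z + tval ys z) $ i $ k) \<le> e / 2 + e / 2"
      using norm_triangle_mono[OF nearD[OF xs(1) z] nearD[OF ys(1) z]] by (simp add: add_diff_add)
  qed
  ultimately show "\<exists>xs. near e (\<lambda>z. F z + G z) (tval xs) \<and> tail (op_minus P (T \<oplus>\<^bsub>fock_op_alg P\<^esub> S) (tpop xs)) e"
    by (intro exI[of _ "xs @ ys"]) simp
qed

lemma good_smult:
  assumes ops: "T \<in> ops P" and good: "good T F"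
  shows "good (a \<odot>\<^bsub>fock_op_alg P\<^esub> T) (\<lambda>z. cscale a (F z))"
  unfolding good_def
proof (intro allI impI)
  fix e :: real
  assume e: "0 < e"
  define f where "f = e / (cmod a + 1)"
  have f: "0 < f" "cmod a * f \<le> e"
    using e unfolding f_def by (simp_all add: add_nonneg_pos divide_le_eq mult_left_mono)
  obtain xs where xs: "near f F (tval xs)" "tail (op_minus P T (tpop xs)) f"
    using goodD[OF good f(1)] by blast
  have "op_minus P (a \<odot>\<^bsub>fock_op_alg P\<^esub> T) (tpop (tsmult a xs)) = a \<odot>\<^bsub>fock_op_alg P\<^esub> op_minus P T (tpop xs)"
    by (rule ops_ext[of _ P])
      (simp_all add: ops tpop_ops op_apply cscale_minus1 tpop_tsmult vec_eq_iff right_diff_distrib)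
  then have "tail (op_minus P (a \<odot>\<^bsub>fock_op_alg P\<^esub> T) (tpop (tsmult a xs))) (cmod a * f)"
    using tail_smult[OF _ xs(2)] ops tpop_ops by simp
  moreover have "near (cmod a * f) (\<lambda>z. cscale a (F z)) (tval (tsmult a xs))"
    using xs(1) unfolding near_def tval_tsmult
    by (simp add: norm_mult mult_left_mono flip: right_diff_distrib)
  ultimately show "\<exists>xs. near e (\<lambda>z. cscale a (F z)) (tval xs) \<and> tail (op_minus P (a \<odot>\<^bsub>fock_op_alg P\<^esub> T) (tpop xs)) e"
    using f(2) near_mono tail_mono by blast
qed

lemma good_bounded:
  assumes "good T F"
  shows "\<exists>C\<ge>0. \<forall>z i k. cmod z = 1 \<longrightarrow> cmod (F z $ i $ k) \<le> C"
proof -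
  obtain xs where xs: "near 1 F (tval xs)"
    using goodD[OF assms, of 1] by auto
  obtain C where C: "0 \<le> C" "\<And>z i k. cmod z = 1 \<Longrightarrow> cmod (tval xs z $ i $ k) \<le> C"
    using tval_bounded by blast
  have "cmod (F z $ i $ k) \<le> 1 + C" if "cmod z = 1" for z i k
    using nearD[OF xs that, of i k] C(2)[OF that, of i k] norm_triangle_sub[of "F z $ i $ k" "tval xs z $ i $ k"]
    by linarith
  then show ?thesis
    using C(1) by (intro exI[of _ "1 + C"]) auto
qed

lemma near_mult:
  fixes F :: "complex \<Rightarrow> complex ^ 'n ^ 'n" and C C' e f :: real
  assumes F: "\<And>z i k. cmod z = 1 \<Longrightarrow> cmod (F z $ i $ k) \<le> C" and C': "\<And>z i k. cmod z = 1 \<Longrightarrow> cmod (G' z $ i $ k) \<le> C'"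
    and near: "near f F F'" "near e G G'"
  shows "near (CARD('n) * (C * e + f * C')) (\<lambda>z. F z ** G z) (\<lambda>z. F' z ** G' z)"
  unfolding near_def
proof (intro allI impI)
  fix z :: complex and i k
  assume z: "cmod z = 1"
  have "cmod (F z $ i $ j * G z $ j $ k - F' z $ i $ j * G' z $ j $ k) \<le> C * e + f * C'" for j
  proof -
    have "F z $ i $ j * G z $ j $ k - F' z $ i $ j * G' z $ j $ k =
      F z $ i $ j * (G z $ j $ k - G' z $ j $ k) + (F z $ i $ j - F' z $ i $ j) * G' z $ j $ k"
      by (simp add: algebra_simps)
    moreover have "cmod (F z $ i $ j * (G z $ j $ k - G' z $ j $ k)) \<le> C * e"
      unfolding norm_mult using F[OF z, of i j] nearD[OF near(2) z]
      by (intro mult_mono) (auto intro: order_trans[OF norm_ge_zero])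
    moreover have "cmod ((F z $ i $ j - F' z $ i $ j) * G' z $ j $ k) \<le> f * C'"
      unfolding norm_mult using C'[OF z, of j k] nearD[OF near(1) z, of i j]
      by (intro mult_mono) (auto intro: order_trans[OF norm_ge_zero])
    ultimately show ?thesis
      by (metis norm_triangle_mono)
  qed
  then have "cmod (\<Sum>j\<in>UNIV. F z $ i $ j * G z $ j $ k - F' z $ i $ j * G' z $ j $ k) \<le> (\<Sum>j\<in>(UNIV :: 'n set). C * e + f * C')"
    by (intro order_trans[OF norm_sum sum_mono])
  then show "cmod ((F z ** G z) $ i $ k - (F' z ** G' z) $ i $ k) \<le> CARD('n) * (C * e + f * C')"
    by (simp add: matrix_matrix_mult_def sum_subtractf)
qed

lemma good_mult:
  assumes ops: "T \<in> ops P" "S \<in> ops P" and good: "good T F" "good S G"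
  shows "good (T \<otimes>\<^bsub>fock_op_alg P\<^esub> S) (\<lambda>z. F z ** G z)"
  unfolding good_def
proof (intro allI impI)
  fix e :: real
  assume e: "0 < e"
  let ?d = "real (CARD('n))"
  obtain B where B: "opbound P T B"
    using op_bounded[OF ops(1)] by blast
  then have B0: "0 \<le> B"
    by (simp add: opbound_def)
  obtain C where C: "0 \<le> C" "\<And>z i k. cmod z = 1 \<Longrightarrow> cmod (F z $ i $ k) \<le> C"
    using good_bounded[OF good(1)] by blast
  \<comment> \<open>The order of choice matters. \<open>ys\<close> comes first, with an error
    depending on bounds for \<open>T\<close> and \<open>F\<close>; the error for \<open>xs\<close>
    then depends on bounds for the chosen \<open>ys\<close>. Adding \<open>1\<close> keeps the
    divisors positive.\<close>
  define e1 where "e1 = e / 2 / (B + ?d * C + 1)"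
  have den1: "0 < B + ?d * C + 1"
    using B0 C(1) by (simp add: add_nonneg_pos)
  then have e1: "0 < e1"
    using e by (simp add: e1_def)
  have halve: "x * (e / 2 / x) = e / 2" if "0 < x" for x :: real
    using that by simp
  have e1': "(B + ?d * C + 1) * e1 = e / 2"
    unfolding e1_def by (rule halve[OF den1])
  obtain ys where ys: "near e1 G (tval ys)" "tail (op_minus P S (tpop ys)) e1"
    using goodD[OF good(2) e1] by blast
  obtain B' where B': "opbound P (tpop ys) B'"
    using op_bounded[OF tpop_ops] by blast
  then have B'0: "0 \<le> B'"
    by (simp add: opbound_def)
  obtain C' where C': "0 \<le> C'" "\<And>z i k. cmod z = 1 \<Longrightarrow> cmod (tval ys z $ i $ k) \<le> C'"
    using tval_bounded by blast
  define e2 where "e2 = e / 2 / (B' + ?d * C' + 1)"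
  have den2: "0 < B' + ?d * C' + 1"
    using B'0 C'(1) by (simp add: add_nonneg_pos)
  then have e2: "0 < e2"
    using e by (simp add: e2_def)
  have e2': "(B' + ?d * C' + 1) * e2 = e / 2"
    unfolding e2_def by (rule halve[OF den2])
  obtain xs where xs: "near e2 F (tval xs)" "tail (op_minus P T (tpop xs)) e2"
    using goodD[OF good(1) e2] by blast
  have nonneg: "0 \<le> B * e1" "0 \<le> ?d * C * e1" "0 \<le> B' * e2" "0 \<le> ?d * C' * e2"
    using B0 C(1) B'0 C'(1) e1 e2 by auto
  have "near (?d * (C * e1 + e2 * C')) (\<lambda>z. F z ** G z) (\<lambda>z. tval xs z ** tval ys z)"
    by (rule near_mult[OF C(2) C'(2) xs(1) ys(1)])
  then have "near (?d * (C * e1 + e2 * C')) (\<lambda>z. F z ** G z) (tval (tmult xs ys))"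
    by (simp add: near_def tval_tmult)
  moreover have "?d * (C * e1 + e2 * C') \<le> e"
    using e1' e2' e1 e2 nonneg by (simp add: algebra_simps)
  ultimately have near: "near e (\<lambda>z. F z ** G z) (tval (tmult xs ys))"
    by (rule near_mono)
  \<comment> \<open>The three errors of the product: approximation of \<open>S\<close>,
    approximation of \<open>T\<close> in front of a polynomial, and multiplication of two
    polynomials. The right factor in the second one is a polynomial so that
    \<open>tail_mult_right\<close> applies.\<close>
  have eq: "op_minus P (T \<otimes>\<^bsub>fock_op_alg P\<^esub> S) (tpop (tmult xs ys)) =
    (T \<otimes>\<^bsub>fock_op_alg P\<^esub> op_minus P S (tpop ys)) \<oplus>\<^bsub>fock_op_alg P\<^esub>
    ((op_minus P T (tpop xs) \<otimes>\<^bsub>fock_op_alg P\<^esub> tpop ys) \<oplus>\<^bsub>fock_op_alg P\<^esub>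
     op_minus P (tpop xs \<otimes>\<^bsub>fock_op_alg P\<^esub> tpop ys) (tpop (tmult xs ys)))"
    by (rule ops_ext[of _ P])
      (simp_all add: ops tpop_ops op_apply cscale_minus1 op_diff[OF ops(1)])
  have tl: "tail ((T \<otimes>\<^bsub>fock_op_alg P\<^esub> op_minus P S (tpop ys)) \<oplus>\<^bsub>fock_op_alg P\<^esub>
    ((op_minus P T (tpop xs) \<otimes>\<^bsub>fock_op_alg P\<^esub> tpop ys) \<oplus>\<^bsub>fock_op_alg P\<^esub>
     op_minus P (tpop xs \<otimes>\<^bsub>fock_op_alg P\<^esub> tpop ys) (tpop (tmult xs ys)))) (B * e1 + (e2 * B' + 0))"
    by (intro tail_add tail_mult_left[OF _ B ys(2)] tail_mult_right[OF B' xs(2)] tpop_tmult op_closed ops tpop_ops)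
  have "B * e1 + (e2 * B' + 0) \<le> e"
    using e1' e2' e1 e2 nonneg by (simp add: algebra_simps)
  from tail_mono[OF tl this] show "\<exists>xs. near e (\<lambda>z. F z ** G z) (tval xs) \<and> tail (op_minus P (T \<otimes>\<^bsub>fock_op_alg P\<^esub> S) (tpop xs)) e"
    using near by (intro exI[of _ "tmult xs ys"]) (simp add: eq)
qed

lemma good_near:
  assumes "\<And>e. 0 < e \<Longrightarrow> \<exists>S G. S \<in> ops P \<and> good S G \<and> near e F G \<and> opbound P (op_minus P S T) e" and T: "T \<in> ops P"
  shows "good T F"
  unfolding good_def
proof (intro allI impI)
  fix e :: real
  assume "0 < e"
  then obtain S G where S: "S \<in> ops P" "good S G" "near (e / 2) F G" "opbound P (op_minus P S T) (e / 2)"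
    using assms(1)[of "e / 2"] by auto
  obtain xs where xs: "near (e / 2) G (tval xs)" "tail (op_minus P S (tpop xs)) (e / 2)"
    using goodD[OF S(2), of "e / 2"] \<open>0 < e\<close> by auto
  have "op_minus P T (tpop xs) = op_minus P (op_minus P S (tpop xs)) (op_minus P S T)"
    by (rule ops_ext[of _ P]) (simp_all add: S T tpop_ops op_apply cscale_minus1)
  moreover have "tail (op_minus P (op_minus P S (tpop xs)) (op_minus P S T)) (e / 2 + cmod (- 1) * (e / 2))"
    by (intro tail_add tail_smult xs(2) opbound_tail S op_closed T tpop_ops)
  ultimately have "tail (op_minus P T (tpop xs)) e"
    by simp
  then show "\<exists>xs. near e F (tval xs) \<and> tail (op_minus P T (tpop xs)) e"
    using near_trans[OF S(3) xs(1)] by auto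
qed

text \<open>The wave packet estimate carried over from polynomials to symbols. Since it asks for a
  bound only on boundedly many levels at a time, it applies to elements of the ideal.\<close>

lemma good_le:
  assumes "T \<in> ops P" "good T F" "locally_bounded T C" "0 \<le> C" "cmod z = 1"
  shows "cmod (F z $ i $ k) \<le> C"
proof (rule field_le_epsilon)
  fix e :: real
  assume "0 < e"
  then obtain xs where xs: "near (e / 2) F (tval xs)" "tail (op_minus P T (tpop xs)) (e / 2)"
    using goodD[OF assms(2), of "e / 2"] by auto
  have "cmod (tval xs z $ i $ k) \<le> C + e / 2"
    by (rule tval_le[OF assms(1,3,4) xs(2) assms(5)])
  then show "cmod (F z $ i $ k) \<le> C + e"
    using nearD[OF xs(1) assms(5), of i k] norm_triangle_sub[of "F z $ i $ k" "tval xs z $ i $ k"] by simp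
qed

lemma opbound_locally_bounded: "opbound P T B \<Longrightarrow> locally_bounded T B"
  by (auto simp: opbound_def locally_bounded_def)

text \<open>Operators close in norm have uniformly close symbols. With \<open>B = 0\<close> this is
  uniqueness of the symbol; along a convergent sequence it makes the symbols uniformly
  Cauchy.\<close>

lemma good_near_opbound:
  assumes "T \<in> ops P" "S \<in> ops P" "good T F" "good S G" "opbound P (op_minus P T S) B"
  shows "near B F G"
  unfolding near_def
proof (intro allI impI)
  fix z :: complex and i k
  assume z: "cmod z = 1"
  have good: "good (op_minus P T S) (\<lambda>z. F z + cscale (- 1) (G z))"
    by (intro good_add good_smult op_closed assms)
  have "0 \<le> B"
    using assms(5) by (simp add: opbound_def)
  from good_le[OF op_minus_ops[OF assms(1,2)] good opbound_locally_bounded[OF assms(5)] this z, of i k]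
  show "cmod (F z $ i $ k - G z $ i $ k) \<le> B"
    by simp
qed

lemma good_unique:
  assumes "T \<in> ops P" "good T F" "good T G" "cmod z = 1"
  shows "F z = G z"
proof -
  have "op_minus P T T = \<zero>\<^bsub>fock_op_alg P\<^esub>"
    by (rule ops_ext[of _ P]) (simp_all add: assms op_apply cscale_minus1)
  then have "near 0 F G"
    using good_near_opbound[OF assms(1,1,2,3), of 0] opbound_zero[of P] by simp
  then have "cmod (F z $ i $ k - G z $ i $ k) \<le> 0" for i k
    by (rule nearD[OF _ assms(4)])
  then show ?thesis
    by (simp add: vec_eq_iff)
qed

lemma good_continuous:
  assumes "good T F"
  shows "continuous_on (sphere 0 1) F"
proof -
  have "\<exists>xs. near (inverse (Suc n)) F (tval xs)" for n
    by (rule goodD[OF assms, of "inverse (Suc n)"]) auto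
  then obtain xs where xs: "\<And>n. near (inverse (Suc n)) F (tval (xs n))"
    by metis
  have "continuous_on (sphere 0 1) (\<lambda>z. F z $ i $ k)" for i k
  proof (rule uniform_limit_theorem[where F = sequentially])
    show "\<forall>\<^sub>F n in sequentially. continuous_on (sphere 0 1) (\<lambda>z. tval (xs n) z $ i $ k)"
      by (intro always_eventually allI continuous_on_component continuous_on_tval)
    show "uniform_limit (sphere 0 1) (\<lambda>n z. tval (xs n) z $ i $ k) (\<lambda>z. F z $ i $ k) sequentially"
      unfolding uniform_limit_sequentially_iff
    proof (intro allI impI)
      fix e :: real
      assume "0 < e"
      then obtain N where N: "inverse (Suc N) < e"
        using reals_Archimedean by blast
      have "dist (tval (xs n) z $ i $ k) (F z $ i $ k) < e" if "n \<ge> N" "z \<in> sphere 0 1" for n z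
      proof -
        have "dist (tval (xs n) z $ i $ k) (F z $ i $ k) \<le> inverse (Suc n)"
          using nearD[OF xs[of n], of z i k] that(2) by (simp add: dist_norm norm_minus_commute)
        also have "\<dots> \<le> inverse (Suc N)"
          using that(1) by (intro le_imp_inverse_le) auto
        finally show ?thesis
          using N by linarith
      qed
      then show "\<exists>N. \<forall>n\<ge>N. \<forall>z\<in>sphere 0 1. dist (tval (xs n) z $ i $ k) (F z $ i $ k) < e"
        by blast
    qed
  qed simp
  then have "continuous_on (sphere 0 1) (\<lambda>z. \<chi> i k. F z $ i $ k)"
    by (intro continuous_on_vec_lambda)
  then show ?thesis
    by simp
qed

end


section \<open>The symbol map on the Toeplitz algebra\<close>

lemma ctranspose_simps:
  fixes A B :: "complex ^ 'n ^ 'n"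
  shows "ctranspose (ctranspose A) = A" "ctranspose (A + B) = ctranspose A + ctranspose B"
    "ctranspose (A ** B) = ctranspose B ** ctranspose A" "ctranspose (cscale a A) = cscale (cnj a) (ctranspose A)"
  by (simp_all add: ctranspose_def vec_eq_iff matrix_matrix_mult_def mult.commute)

lemma star_ops:
  assumes "T \<in> ops P" "S \<in> ops P"
  shows "star (fock_op_alg P) (T \<oplus>\<^bsub>fock_op_alg P\<^esub> S) = star (fock_op_alg P) T \<oplus>\<^bsub>fock_op_alg P\<^esub> star (fock_op_alg P) S"
    "star (fock_op_alg P) (T \<otimes>\<^bsub>fock_op_alg P\<^esub> S) = star (fock_op_alg P) S \<otimes>\<^bsub>fock_op_alg P\<^esub> star (fock_op_alg P) T"
    "star (fock_op_alg P) (a \<odot>\<^bsub>fock_op_alg P\<^esub> T) = cnj a \<odot>\<^bsub>fock_op_alg P\<^esub> star (fock_op_alg P) T"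
    "star (fock_op_alg P) (star (fock_op_alg P) T) = T"
    "star (fock_op_alg P) (op_minus P T S) = op_minus P (star (fock_op_alg P) T) (star (fock_op_alg P) S)"
  using assms
  by (auto intro!: star_eqI is_adjoint_add is_adjoint_mult is_adjoint_smult is_adjoint_minus ops_star)

lemma near_limit:
  fixes G :: "nat \<Rightarrow> complex \<Rightarrow> complex ^ 'n ^ 'n"
  assumes cauchy: "\<And>e. 0 < e \<Longrightarrow> \<exists>N. \<forall>m\<ge>N. \<forall>n\<ge>N. near e (G m) (G n)"
  obtains F where "\<forall>e>0. \<exists>N. \<forall>n\<ge>N. near e (G n) F"
proof -
  have conv: "convergent (\<lambda>n. G n z $ i $ k)" if z: "cmod z = 1" for z i k
    unfolding Cauchy_convergent_iff[symmetric] Cauchy_def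
  proof (intro allI impI)
    fix e :: real
    assume "0 < e"
    then obtain N where "\<forall>m\<ge>N. \<forall>n\<ge>N. near (e / 2) (G m) (G n)"
      using cauchy[of "e / 2"] by auto
    then have "dist (G m z $ i $ k) (G n z $ i $ k) \<le> e / 2" if "N \<le> m" "N \<le> n" for m n
      using nearD[of "e / 2" "G m" "G n" z i k] that z by (simp add: dist_norm)
    then show "\<exists>M. \<forall>m\<ge>M. \<forall>n\<ge>M. dist (G m z $ i $ k) (G n z $ i $ k) < e"
      using \<open>0 < e\<close> by (intro exI[of _ N]) fastforce
  qed
  define F :: "complex \<Rightarrow> complex ^ 'n ^ 'n" where "F z = (\<chi> i k. lim (\<lambda>n. G n z $ i $ k))" for z
  have lim: "(\<lambda>n. G n z $ i $ k) \<longlonglongrightarrow> F z $ i $ k" if "cmod z = 1" for z i k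
    using conv[OF that, of i k] by (simp add: F_def convergent_LIMSEQ_iff)
  have "\<exists>N. \<forall>n\<ge>N. near e (G n) F" if e: "0 < e" for e
  proof -
    obtain N where N: "\<And>m n. N \<le> m \<Longrightarrow> N \<le> n \<Longrightarrow> near e (G m) (G n)"
      using cauchy[OF e] by blast
    have "near e (G n) F" if n: "N \<le> n" for n
      unfolding near_def
    proof (intro allI impI)
      fix z :: complex and i k
      assume z: "cmod z = 1"
      show "cmod (G n z $ i $ k - F z $ i $ k) \<le> e"
      proof (rule tendsto_upperbound)
        show "(\<lambda>m. cmod (G n z $ i $ k - G m z $ i $ k)) \<longlonglongrightarrow> cmod (G n z $ i $ k - F z $ i $ k)"
          by (intro tendsto_intros lim[OF z])
        show "\<forall>\<^sub>F m in sequentially. cmod (G n z $ i $ k - G m z $ i $ k) \<le> e"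
          unfolding eventually_sequentially using nearD[OF N[OF n] z] by blast
      qed simp
    qed
    then show ?thesis
      by blast
  qed
  then show thesis
    by (intro that[of F]) simp
qed

section \<open>Trigonometric approximation of continuous functions\<close>

lemma sum_list_prod:
  fixes f g :: "'a \<Rightarrow> complex"
  shows "(\<Sum>x\<leftarrow>xs. f x) * (\<Sum>y\<leftarrow>ys. g y) = (\<Sum>(x, y)\<leftarrow>List.product xs ys. f x * g y)"
  by (induction xs) (simp_all add: distrib_right sum_list_const_mult o_def)

text \<open>On the circle the conjugate of \<open>z\<close> is its inverse, so real and imaginary
  parts are Laurent polynomials in \<open>z\<close>; sums and products of Laurent polynomials stay
  such.\<close>

lemma real_polynomial_trigonometric:
  fixes g :: "complex \<Rightarrow> real"
  assumes "real_polynomial_function g"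
  shows "\<exists>ys. \<forall>z. cmod z = 1 \<longrightarrow> complex_of_real (g z) = (\<Sum>(a, l)\<leftarrow>ys. a * z powi l)"
  using assms
proof induction
  case (linear f)
  interpret bounded_linear f
    by fact
  define \<alpha> where "\<alpha> = complex_of_real (f 1)"
  define \<beta> where "\<beta> = complex_of_real (f \<i>)"
  show ?case
  \<comment> \<open>The coefficients of \<open>Re z * \<alpha> + Im z * \<beta>\<close> after
    inserting \<open>(z + cnj z) / 2\<close> and \<open>- \<i> * (z - cnj z) / 2\<close>.\<close>
  proof (intro exI[of _ "[((\<alpha> - \<i> * \<beta>) / 2, 1), ((\<alpha> + \<i> * \<beta>) / 2, - 1)]"] allI impI)
    fix z :: complex
    assume z: "cmod z = 1"
    have "z = Re z *\<^sub>R 1 + Im z *\<^sub>R \<i>"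
      by (simp add: complex_eq_iff)
    then have "f z = Re z * f 1 + Im z * f \<i>"
      by (metis add scaleR real_scaleR_def)
    then have "complex_of_real (f z) = of_real (Re z) * \<alpha> + of_real (Im z) * \<beta>"
      by (simp add: \<alpha>_def \<beta>_def)
    moreover have "z powi (- 1) = cnj z"
      using cnj_powi_circle[OF z, of 1] by simp
    moreover have "of_real (Re z) = (z + cnj z) / 2" "of_real (Im z) = - \<i> * (z - cnj z) / 2"
      by (simp_all add: complex_eq_iff)
    ultimately show "complex_of_real (f z) = (\<Sum>(a, l)\<leftarrow>[((\<alpha> - \<i> * \<beta>) / 2, 1), ((\<alpha> + \<i> * \<beta>) / 2, - 1)]. a * z powi l)"
      by (simp add: field_simps)
  qed
next
  case (const a)
  show ?case
    by (intro exI[of _ "[(of_real a, 0)]"]) simp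
next
  case (add f g)
  then obtain xs ys where "\<And>z. cmod z = 1 \<Longrightarrow> complex_of_real (f z) = (\<Sum>(a, l)\<leftarrow>xs. a * z powi l)"
    "\<And>z. cmod z = 1 \<Longrightarrow> complex_of_real (g z) = (\<Sum>(a, l)\<leftarrow>ys. a * z powi l)"
    by blast
  then show ?case
    by (intro exI[of _ "xs @ ys"]) simp
next
  case (mult f g)
  then obtain xs ys where xs: "\<And>z. cmod z = 1 \<Longrightarrow> complex_of_real (f z) = (\<Sum>(a, l)\<leftarrow>xs. a * z powi l)"
    and ys: "\<And>z. cmod z = 1 \<Longrightarrow> complex_of_real (g z) = (\<Sum>(a, l)\<leftarrow>ys. a * z powi l)"
    by blast
  show ?case
  proof (intro exI[of _ "map (\<lambda>((a, l), (b, m)). (a * b, l + m)) (List.product xs ys)"] allI impI)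
    fix z :: complex
    assume z: "cmod z = 1"
    then have z0: "z \<noteq> 0"
      by auto
    have "complex_of_real (f z * g z) = (\<Sum>(x, y)\<leftarrow>List.product xs ys. (case x of (a, l) \<Rightarrow> a * z powi l) * (case y of (a, l) \<Rightarrow> a * z powi l))"
      unfolding of_real_mult xs[OF z] ys[OF z] by (rule sum_list_prod)
    also have "\<dots> = (\<Sum>(a, l)\<leftarrow>map (\<lambda>((a, l), (b, m)). (a * b, l + m)) (List.product xs ys). a * z powi l)"
      unfolding map_map
      by (intro arg_cong[where f = sum_list] map_cong refl) (auto simp: power_int_add z0)
    finally show "complex_of_real (f z * g z) = (\<Sum>(a, l)\<leftarrow>map (\<lambda>((a, l), (b, m)). (a * b, l + m)) (List.product xs ys). a * z powi l)" .
  qed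
qed

lemma trigonometric_approx:
  fixes f :: "complex \<Rightarrow> complex"
  assumes f: "continuous_on (sphere 0 1) f" and e: "0 < e"
  shows "\<exists>ys. \<forall>z. cmod z = 1 \<longrightarrow> cmod (f z - (\<Sum>(a, l)\<leftarrow>ys. a * z powi l)) \<le> e"
proof -
  obtain g where g: "polynomial_function g" "\<And>z. z \<in> sphere 0 1 \<Longrightarrow> cmod (f z - g z) < e"
    using Stone_Weierstrass_polynomial_function[OF compact_sphere f e] by blast
  have "real_polynomial_function (Re \<circ> g)" "real_polynomial_function (Im \<circ> g)"
    using g(1) bounded_linear_Re bounded_linear_Im unfolding polynomial_function_def by blast+
  then obtain xs ys where xs: "\<And>z. cmod z = 1 \<Longrightarrow> complex_of_real (Re (g z)) = (\<Sum>(a, l)\<leftarrow>xs. a * z powi l)"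
    and ys: "\<And>z. cmod z = 1 \<Longrightarrow> complex_of_real (Im (g z)) = (\<Sum>(a, l)\<leftarrow>ys. a * z powi l)"
    using real_polynomial_trigonometric[of "Re \<circ> g"] real_polynomial_trigonometric[of "Im \<circ> g"] by auto
  have "g z = (\<Sum>(a, l)\<leftarrow>xs @ map (\<lambda>(a, l). (\<i> * a, l)) ys. a * z powi l)" if z: "cmod z = 1" for z
  proof -
    have "g z = of_real (Re (g z)) + \<i> * of_real (Im (g z))"
      by (simp add: complex_eq_iff)
    also have "\<dots> = (\<Sum>(a, l)\<leftarrow>xs. a * z powi l) + (\<Sum>(a, l)\<leftarrow>map (\<lambda>(a, l). (\<i> * a, l)) ys. a * z powi l)"
      unfolding xs[OF z] ys[OF z] by (simp add: case_prod_unfold o_def mult.assoc sum_list_const_mult)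
    finally show ?thesis
      by simp
  qed
  then show ?thesis
    using g(2) by (intro exI[of _ "xs @ map (\<lambda>(a, l). (\<i> * a, l)) ys"]) (auto intro: less_imp_le)
qed

lemma tval_approx:
  fixes F :: "complex \<Rightarrow> complex ^ 'n ^ 'n"
  assumes F: "continuous_on (sphere 0 1) F" and e: "0 < e"
  shows "\<exists>xs. near e F (tval xs)"
proof -
  have "\<exists>ys. \<forall>z. cmod z = 1 \<longrightarrow> cmod (F z $ i $ k - (\<Sum>(a, l)\<leftarrow>ys. a * z powi l)) \<le> e" for i k
    by (rule trigonometric_approx[OF _ e]) (intro continuous_on_component F)
  then obtain ys where ys: "\<And>i k z. cmod z = 1 \<Longrightarrow> cmod (F z $ i $ k - (\<Sum>(a, l)\<leftarrow>ys i k. a * z powi l)) \<le> e"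
    by metis
  have "\<exists>xs. \<forall>z i k. tval xs z $ i $ k = (if (i, k) \<in> A then \<Sum>(a, l)\<leftarrow>ys i k. a * z powi l else 0)"
    if "finite A" for A :: "('n \<times> 'n) set"
    using that
  proof (induction A)
    case empty
    then show ?case
      by (intro exI[of _ "[]"]) (simp add: tval_Nil)
  next
    case (insert p A)
    obtain i k where p: "p = (i, k)"
      by (cases p)
    obtain xs where xs: "\<And>z i k. tval xs z $ i $ k = (if (i, k) \<in> A then \<Sum>(a, l)\<leftarrow>ys i k. a * z powi l else 0)"
      using insert by blast
    have "tval (map (\<lambda>(a, l). (a, i, k, l)) zs) z $ i' $ k' = (if (i', k') = (i, k) then \<Sum>(a, l)\<leftarrow>zs. a * z powi l else 0)" for zs z i' k'
      by (induction zs) (auto simp: tval_Nil tval_Cons)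
    then show ?case
      using insert.hyps by (intro exI[of _ "map (\<lambda>(a, l). (a, i, k, l)) (ys i k) @ xs"]) (auto simp: tval_append xs p)
  qed
  from this[OF finite[of UNIV]] obtain xs where "\<And>z i k. tval xs z $ i $ k = (\<Sum>(a, l)\<leftarrow>ys i k. a * z powi l)"
    by auto
  then have "near e F (tval xs)"
    using ys by (simp add: near_def)
  then show ?thesis
    by blast
qed

section \<open>Level projections\<close>

lemma level_proj_ops: "level_proj P n \<in> ops P"
proof -
  have F: "(\<lambda>m. if m = n then \<xi> m else 0) \<in> Fock P" if "\<xi> \<in> Fock P" for \<xi>
    unfolding Fock_iff
  proof (intro conjI allI)
    show "(if m = n then \<xi> m else 0) \<in> Arv P m" for m
      using Fock_Arv[OF that] by simp
    show "summable (\<lambda>m. (norm (if m = n then \<xi> m else 0))\<^sup>2)"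
      by (rule summable_finite[of "{n}"]) auto
  qed
  have arv0: "arv_inner 0 A = 0" "arv_inner A 0 = 0" for A :: "complex ^ 'a ^ 'a"
    by (simp_all add: vec_eq_iff arv_inner_nth)
  have "arv_inner (if m = n then \<xi> m else 0) (\<eta> m) = arv_inner (\<xi> m) (if m = n then \<eta> m else 0)"
    for \<xi> \<eta> :: "nat \<Rightarrow> complex ^ 'a ^ 'a" and m
    by (simp add: arv0)
  then have adj: "is_adjoint P (level_proj P n) (level_proj P n)"
    using F by (auto simp: is_adjoint_def level_proj_def fock_inner_def)
  then show "level_proj P n \<in> ops P"
    using is_adjoint_ops(1)[OF adj] by (simp add: is_adjoint_def)
qed

lemma hnorm_level_proj:
  assumes \<xi>: "\<xi> \<in> Fock P"
  shows "hnorm (level_proj P n \<xi>) \<le> hnorm \<xi>"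
proof (rule hnorm_leI[OF ops_Fock[OF level_proj_ops \<xi>] hnorm_nonneg[OF \<xi>]])
  fix M
  have "(\<Sum>m<M. (norm (level_proj P n \<xi> m))\<^sup>2) \<le> (\<Sum>m<M. (norm (\<xi> m))\<^sup>2)"
    using \<xi> by (intro sum_mono) (simp add: level_proj_def)
  also have "\<dots> \<le> (hnorm \<xi>)\<^sup>2"
    by (rule sum_le_hnorm[OF \<xi>]) simp
  finally show "(\<Sum>m<M. (norm (level_proj P n \<xi> m))\<^sup>2) \<le> (hnorm \<xi>)\<^sup>2" .
qed

text \<open>The restriction to the levels in \<open>S\<close> is a sum of \<open>card S\<close>
  level projections, each of which contributes at most \<open>\<delta>\<close>. The factor
  \<open>card S\<close> is the reason for counting levels in \<open>locally_bounded\<close>.\<close>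

lemma restrict_levels_bound:
  fixes \<delta> :: real
  assumes T: "T \<in> ops P" and \<xi>: "\<xi> \<in> Fock P" and "finite S"
    and bd: "\<And>n. n \<in> S \<Longrightarrow> opbound P (T \<otimes>\<^bsub>fock_op_alg P\<^esub> level_proj P n) \<delta>"
  shows "(\<lambda>m. if m \<in> S then \<xi> m else 0) \<in> Fock P \<and>
    hnorm (T (\<lambda>m. if m \<in> S then \<xi> m else 0)) \<le> card S * \<delta> * hnorm \<xi>"
  using assms(3,4)
proof (induction S)
  case empty
  then show ?case
    by (simp add: op_zero[OF T])
next
  case (insert n S)
  let ?\<eta> = "\<lambda>m. if m \<in> S then \<xi> m else 0"
  have IH: "?\<eta> \<in> Fock P" "hnorm (T ?\<eta>) \<le> card S * \<delta> * hnorm \<xi>"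
    using insert by blast+
  note Q = ops_Fock[OF level_proj_ops \<xi>, of n]
  have eq: "(\<lambda>m. if m \<in> insert n S then \<xi> m else 0) = (\<lambda>m. level_proj P n \<xi> m + ?\<eta> m)"
    using insert.hyps \<xi> by (auto simp: level_proj_def)
  have "hnorm (T (level_proj P n \<xi>)) \<le> \<delta> * hnorm \<xi>"
    using opboundD[OF insert.prems[of n] \<xi>] \<xi> by (simp add: op_mult_apply)
  moreover have "hnorm (\<lambda>m. T (level_proj P n \<xi>) m + T ?\<eta> m) \<le> hnorm (T (level_proj P n \<xi>)) + hnorm (T ?\<eta>)"
    by (rule Fock_add(2)[OF ops_Fock[OF T Q] ops_Fock[OF T IH(1)]])
  ultimately have "hnorm (T (\<lambda>m. level_proj P n \<xi> m + ?\<eta> m)) \<le> card (insert n S) * \<delta> * hnorm \<xi>"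
    unfolding op_linear(1)[OF T Q IH(1)] using IH(2) insert.hyps by (simp add: algebra_simps)
  then show ?case
    unfolding eq using Fock_add(1)[OF Q IH(1)] by blast
qed

section \<open>Symbols of elements of the Toeplitz algebra\<close>

context chain
begin

text \<open>Approximation in the sense of \<open>tail\<close> looks at inputs only and is not
  obviously inherited by adjoints. Requiring it for both makes the set of operators with a symbol
  closed under adjoints by definition.\<close>

definition symbol_of :: "'n fock_op \<Rightarrow> (complex \<Rightarrow> complex ^ 'n ^ 'n) \<Rightarrow> bool" where
  "symbol_of T F \<longleftrightarrow> T \<in> ops P \<and> good T F \<and> good (star (fock_op_alg P) T) (\<lambda>z. ctranspose (F z))"

lemma symbol_of_unique: "symbol_of T F \<Longrightarrow> symbol_of T G \<Longrightarrow> cmod z = 1 \<Longrightarrow> F z = G z"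
  unfolding symbol_of_def using good_unique by blast

lemma symbol_of_tpop: "symbol_of (tpop xs) (tval xs)"
  unfolding symbol_of_def star_eqI[OF is_adjoint_tpop]
  by (intro conjI tpop_ops good_tpop) (simp_all add: near_def tval_tadj)

lemma symbol_of_add:
  assumes "symbol_of T F" "symbol_of S G"
  shows "symbol_of (T \<oplus>\<^bsub>fock_op_alg P\<^esub> S) (\<lambda>z. F z + G z)"
  using assms unfolding symbol_of_def by (auto simp: star_ops ctranspose_simps ops_star(3) intro!: good_add)

lemma symbol_of_smult:
  assumes "symbol_of T F"
  shows "symbol_of (a \<odot>\<^bsub>fock_op_alg P\<^esub> T) (\<lambda>z. cscale a (F z))"
  using assms unfolding symbol_of_def by (auto simp: star_ops ctranspose_simps ops_star(3) intro!: good_smult)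

lemma symbol_of_mult:
  assumes "symbol_of T F" "symbol_of S G"
  shows "symbol_of (T \<otimes>\<^bsub>fock_op_alg P\<^esub> S) (\<lambda>z. F z ** G z)"
  using assms unfolding symbol_of_def by (auto simp: star_ops ctranspose_simps ops_star(3) intro!: good_mult)

lemma symbol_of_star:
  assumes "symbol_of T F"
  shows "symbol_of (star (fock_op_alg P) T) (\<lambda>z. ctranspose (F z))"
  using assms unfolding symbol_of_def by (auto simp: star_ops ctranspose_simps ops_star(3))

lemma symbol_of_limit:
  assumes T: "T \<in> ops P"
    and approx: "\<And>e. 0 < e \<Longrightarrow> \<exists>S G. symbol_of S G \<and> near e F G \<and> opbound P (op_minus P S T) e"
  shows "symbol_of T F"
  unfolding symbol_of_def
proof (intro conjI T good_near ops_star(3))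
  fix e :: real
  assume e: "0 < e"
  show "\<exists>S G. S \<in> ops P \<and> good S G \<and> near e F G \<and> opbound P (op_minus P S T) e"
    using approx[OF e] unfolding symbol_of_def by blast
  let ?d = "real CARD('n)"
  have d: "1 \<le> ?d"
    by (simp add: Suc_le_eq)
  \<comment> \<open>The error is divided by the number of states because passing to adjoints
    multiplies bounds by it.\<close>
  obtain S G where S: "symbol_of S G" "near (e / ?d) F G" "opbound P (op_minus P S T) (e / ?d)"
  proof -
    have "0 < e / ?d"
      using e d by simp
    from approx[OF this] show thesis
      using that by blast
  qed
  have SP: "S \<in> ops P"
    using S(1) by (simp add: symbol_of_def)
  have "e / ?d \<le> e / 1"
    using d e by (intro divide_left_mono) auto
  then have "near e (\<lambda>z. ctranspose (F z)) (\<lambda>z. ctranspose (G z))"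
    using near_mono[OF near_ctranspose[OF S(2)]] by simp
  moreover have "opbound P (star (fock_op_alg P) (op_minus P S T)) (?d * (e / ?d))"
    by (rule opbound_is_adjoint[OF op_minus_ops[OF SP T] ops_star(1)[OF op_minus_ops[OF SP T]] S(3)])
  then have "opbound P (op_minus P (star (fock_op_alg P) S) (star (fock_op_alg P) T)) e"
    unfolding star_ops(5)[OF SP T] using d by simp
  ultimately show "\<exists>S G. S \<in> ops P \<and> good S G \<and> near e (\<lambda>z. ctranspose (F z)) G \<and>
      opbound P (op_minus P S (star (fock_op_alg P) T)) e"
    using S(1) ops_star(3)[OF SP] unfolding symbol_of_def by blast
qed

text \<open>The closure condition is the substantial one: along a norm convergent sequence the
  symbols are uniformly Cauchy by \<open>good_near_opbound\<close>, and their limit is a symbol of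
  the limit operator.\<close>

lemma symbol_of_subalgebra: "cstar_subalgebra (fock_op_alg P) {T. \<exists>F. symbol_of T F}"
  unfolding cstar_subalgebra_def
proof (intro conjI ballI allI impI)
  show "{T. \<exists>F. symbol_of T F} \<subseteq> ops P"
    by (auto simp: symbol_of_def)
  show "\<zero>\<^bsub>fock_op_alg P\<^esub> \<in> {T. \<exists>F. symbol_of T F}"
    using symbol_of_tpop[of "[]"] by auto
  fix s T
  assume T: "T \<in> ops P" and s: "\<forall>n. s n \<in> {T. \<exists>F. symbol_of T F}"
    and lim: "(\<lambda>n. nrm (fock_op_alg P) (op_minus P (s n) T)) \<longlonglongrightarrow> 0"
  obtain G where G: "\<And>n. symbol_of (s n) (G n)"
    using s by auto metis
  then have sP: "s n \<in> ops P" "good (s n) (G n)" for n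
    by (simp_all add: symbol_of_def)
  have small: "\<exists>N. \<forall>n\<ge>N. opbound P (op_minus P (s n) T) e" if "0 < e" for e
    using lim that nrm_tendsto_0_iff[of "\<lambda>n. op_minus P (s n) T" P] op_minus_ops[OF sP(1) T] by simp
  have "\<exists>N. \<forall>m\<ge>N. \<forall>n\<ge>N. near e (G m) (G n)" if e: "0 < e" for e
  proof -
    obtain N where N: "\<And>n. N \<le> n \<Longrightarrow> opbound P (op_minus P (s n) T) (e / 2)"
      using small[of "e / 2"] e by auto
    have "near e (G m) (G n)" if mn: "N \<le> m" "N \<le> n" for m n
    proof (rule good_near_opbound[OF sP(1,1,2,2)])
      have "op_minus P (s m) (s n) = op_minus P (op_minus P (s m) T) (op_minus P (s n) T)"
        by (rule ops_ext[of _ P]) (simp_all add: sP T op_apply cscale_minus1)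
      moreover have "opbound P (op_minus P (op_minus P (s m) T) (op_minus P (s n) T))
        (e / 2 + cmod (- 1) * (e / 2))"
        by (intro opbound_add opbound_smult N mn op_closed sP T)
      ultimately show "opbound P (op_minus P (s m) (s n)) e"
        by simp
    qed
    then show ?thesis
      by blast
  qed
  then obtain F where F: "\<forall>e>0. \<exists>N. \<forall>n\<ge>N. near e (G n) F"
    by (rule near_limit)
  have "symbol_of T F"
  proof (rule symbol_of_limit[OF T])
    fix e :: real
    assume e: "0 < e"
    obtain N1 where N1: "\<And>n. N1 \<le> n \<Longrightarrow> opbound P (op_minus P (s n) T) e"
      using small[OF e] by blast
    obtain N2 where N2: "\<And>n. N2 \<le> n \<Longrightarrow> near e (G n) F"
      using F e by blast
    show "\<exists>S G. symbol_of S G \<and> near e F G \<and> opbound P (op_minus P S T) e"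
      using G[of "max N1 N2"] N1[of "max N1 N2"] near_sym[OF N2[of "max N1 N2"]] by auto
  qed
  then show "T \<in> {T. \<exists>F. symbol_of T F}"
    by blast
qed (auto intro: symbol_of_add symbol_of_mult symbol_of_smult symbol_of_star)

text \<open>The difference is again a weighted shift, with weight \<open>w - a\<close>. On vectors
  vanishing below level \<open>M\<close> only late weights act, and these are at most
  \<open>e\<close>.\<close>

lemma wshift_constant_tail:
  assumes w: "\<And>m b. s \<le> int m \<Longrightarrow> (i, b) \<in> edges (mpow P m) \<Longrightarrow> (k, b) \<in> edges (mpow P (nat (int m - s))) \<Longrightarrow>
      int M \<le> int m - s \<Longrightarrow> cmod (w m b - a) \<le> e"
    and B: "wbound P i k s w B" and e: "0 \<le> e" and s: "s = int r * l + c k - c i"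
  shows "tail (op_minus P (wshift P i k s w) (tpop [(a, i, k, l)])) e"
proof -
  have "op_minus P (wshift P i k s w) (tpop [(a, i, k, l)]) = wshift P i k s (\<lambda>m b. w m b + (- a) * 1)"
  proof (rule ops_ext[of _ P])
    show "wshift P i k s (\<lambda>m b. w m b + (- a) * 1) \<in> ops P"
      by (rule wshift_ops[OF wbound_add[OF B wbound_smult[OF wbound_1]]])
    fix \<xi> m
    assume "\<xi> \<in> Fock P"
    then show "op_minus P (wshift P i k s w) (tpop [(a, i, k, l)]) \<xi> m = wshift P i k s (\<lambda>m b. w m b + (- a) * 1) \<xi> m"
      by (simp add: op_apply cscale_minus1 vec_eq_iff eop_def wshift_nth algebra_simps s)
  qed (intro op_closed wshift_ops[OF B] tpop_ops)
  moreover have "hnorm (wshift P i k s (\<lambda>m b. w m b + (- a) * 1) \<xi>) \<le> e * hnorm \<xi>"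
    if \<xi>: "\<xi> \<in> Fock P" "\<forall>m<M. \<xi> m = 0" for \<xi>
  proof (rule wshift_bound(2)[OF \<xi>(1) e])
    fix m b
    assume m: "s \<le> int m" "(i, b) \<in> edges (mpow P m)" "\<xi> (nat (int m - s)) $ k $ b \<noteq> 0"
    have "\<not> nat (int m - s) < M"
      using \<xi>(2) m(3) by (metis zero_index)
    then have "int M \<le> int m - s"
      using m(1) by linarith
    moreover have "(k, b) \<in> edges (mpow P (nat (int m - s)))"
      using Fock_eq0[OF \<xi>(1)] m(3) by blast
    ultimately show "cmod (w m b + (- a) * 1) \<le> e"
      using w[OF m(1,2)] by simp
  qed
  ultimately show ?thesis
    using e unfolding tail_def by auto
qed

lemma symbol_of_wshift:
  assumes ik: "(i, k) \<in> edges (mpow P n)"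
  shows "\<exists>F. symbol_of (wshift P i k (int n) (\<lambda>m b. of_real (sweight n i k m b))) F"
proof -
  define \<kappa> where "\<kappa> = sqrt (mpow P n $ i $ k)"
  \<comment> \<open>The division is exact: an edge at level \<open>n\<close> satisfies the class
    congruence.\<close>
  define l where "l = (int n - (c k - c i)) div int r"
  have n: "int n = int r * l + c k - c i"
    using class_dvd[of n i k] ik unfolding l_def edges_iff by simp
  let ?T = "wshift P i k (int n) (\<lambda>m b. complex_of_real (sweight n i k m b))"
  have "good ?T (tval [(of_real \<kappa>, i, k, l)])"
    unfolding good_def
  proof (intro allI impI)
    fix e :: real
    assume e: "0 < e"
    obtain M where M: "\<And>m b. n \<le> m \<Longrightarrow> M \<le> m - n \<Longrightarrow> (k, b) \<in> edges (mpow P (m - n)) \<Longrightarrow>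
      \<bar>sweight n i k m b - \<kappa>\<bar> \<le> e"
      using sweight_limit[OF ik e] unfolding \<kappa>_def by blast
    have "tail (op_minus P ?T (tpop [(of_real \<kappa>, i, k, l)])) e"
    proof (rule wshift_constant_tail[OF _ wbound_sweight _ n])
      fix m b
      assume "int n \<le> int m" "(k, b) \<in> edges (mpow P (nat (int m - int n)))" "int M \<le> int m - int n"
      then have "\<bar>sweight n i k m b - \<kappa>\<bar> \<le> e"
        by (intro M) (auto simp: nat_int_diff)
      then show "cmod (complex_of_real (sweight n i k m b) - of_real \<kappa>) \<le> e"
        by (metis norm_of_real of_real_diff)
    qed (use e in simp)
    moreover have "near e (tval [(of_real \<kappa>, i, k, l)]) (tval [(of_real \<kappa>, i, k, l)])"
      using e by (simp add: near_def)
    ultimately show "\<exists>xs. near e (tval [(of_real \<kappa>, i, k, l)]) (tval xs) \<and> tail (op_minus P ?T (tpop xs)) e"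
      by blast
  qed
  moreover have "good (star (fock_op_alg P) ?T) (\<lambda>z. ctranspose (tval [(of_real \<kappa>, i, k, l)] z))"
    unfolding good_def
  proof (intro allI impI)
    fix e :: real
    assume e: "0 < e"
    obtain M where M: "\<And>m b. n \<le> m \<Longrightarrow> M \<le> m - n \<Longrightarrow> (k, b) \<in> edges (mpow P (m - n)) \<Longrightarrow>
      \<bar>sweight n i k m b - \<kappa>\<bar> \<le> e"
      using sweight_limit[OF ik e] unfolding \<kappa>_def by blast
    \<comment> \<open>The adjoint has source level \<open>m + n\<close> for target level
      \<open>m\<close>; the threshold \<open>M + n\<close> for sources is thus the threshold
      \<open>M\<close> for \<open>m\<close>, where the weight is close to its limit.\<close>
    have "tail (op_minus P (wshift P k i (- int n) (wadj (int n) (\<lambda>m b. complex_of_real (sweight n i k m b))))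
      (tpop [(of_real \<kappa>, k, i, - l)])) e"
    proof (rule wshift_constant_tail[OF _ wbound_wadj[OF wbound_sweight]])
      fix m b
      assume "- int n \<le> int m" "(k, b) \<in> edges (mpow P m)" "int (M + n) \<le> int m - - int n"
      then have "\<bar>sweight n i k (m + n) b - \<kappa>\<bar> \<le> e"
        by (intro M) auto
      then show "cmod (wadj (int n) (\<lambda>m b. complex_of_real (sweight n i k m b)) m b - of_real \<kappa>) \<le> e"
        unfolding wadj_def
        by (metis complex_cnj_complex_of_real nat_int norm_of_real of_nat_add of_real_diff)
    qed (use e n in simp_all)
    moreover have "near e (\<lambda>z. ctranspose (tval [(of_real \<kappa>, i, k, l)] z)) (tval [(of_real \<kappa>, k, i, - l)])"
    proof -
      have "tval [(of_real \<kappa>, k, i, - l)] z = ctranspose (tval [(of_real \<kappa>, i, k, l)] z)" if "cmod z = 1" for z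
        using tval_tadj[OF that, of "[(of_real \<kappa>, i, k, l)]"] by (simp add: tadj_def)
      then show ?thesis
        using e by (simp add: near_def)
    qed
    ultimately show "\<exists>xs. near e (\<lambda>z. ctranspose (tval [(of_real \<kappa>, i, k, l)] z)) (tval xs) \<and>
      tail (op_minus P (star (fock_op_alg P) ?T) (tpop xs)) e"
      unfolding star_wshift[OF wbound_sweight] by blast
  qed
  ultimately show ?thesis
    using wshift_ops[OF wbound_sweight] unfolding symbol_of_def by blast
qed

text \<open>Operators with a symbol form a closed subalgebra containing the generators. The diagonal
  generators are combinations of unweighted shifts, the others of shifts with convergent
  weights.\<close>

lemma toeplitz_symbol:
  assumes "T \<in> toeplitz"
  shows "\<exists>F. symbol_of T F"
proof -
  let ?X = "{T. \<exists>F. symbol_of T F}"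
  note XD = cstar_subalgebraD[OF symbol_of_subalgebra]
  have "left_action P f \<in> ?X" for f
    unfolding left_action_eq_sum
  proof (rule ops_sum_mem[OF XD(1,2,3)])
    fix i
    have eq: "wshift P i i 0 (\<lambda>m b. 1) = tpop [(1, i, i, 0)]"
      by (rule ops_ext[of _ P])
        (simp_all add: wshift_ops[OF wbound_1] eop_ops op_apply eop_def cscale_1)
    have "wshift P i i 0 (\<lambda>m b. 1) \<in> ?X"
      unfolding eq using symbol_of_tpop by blast
    then show "f $ i \<odot>\<^bsub>fock_op_alg P\<^esub> wshift P i i 0 (\<lambda>m b. 1) \<in> ?X"
      by (rule XD(5))
  next
    show "finite (UNIV :: 'n set)"
      by simp
  qed
  moreover have "shift P n A \<in> ?X" if A: "A \<in> Arv P n" for n A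
    unfolding shift_eq_sum case_prod_unfold
  proof (rule ops_sum_mem[OF XD(1,2,3)])
    fix p :: "'n \<times> 'n"
    let ?W = "wshift P (fst p) (snd p) (int n) (\<lambda>m b. complex_of_real (sweight n (fst p) (snd p) m b))"
    show "A $ fst p $ snd p \<odot>\<^bsub>fock_op_alg P\<^esub> ?W \<in> ?X"
    \<comment> \<open>Convergence of weights is known only along edges; off the edges the
      coefficient of \<open>A\<close> vanishes.\<close>
    proof (cases "p \<in> edges (mpow P n)")
      case True
      then have "?W \<in> ?X"
        using symbol_of_wshift[of "fst p" "snd p" n] by simp
      then show ?thesis
        by (rule XD(5))
    next
      case False
      then have "A $ fst p $ snd p = 0"
        using Arv_eq0[OF A] by simp
      then have "A $ fst p $ snd p \<odot>\<^bsub>fock_op_alg P\<^esub> ?W = \<zero>\<^bsub>fock_op_alg P\<^esub>"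
        by (intro ops_ext[of _ P]) (simp_all add: wshift_ops[OF wbound_sweight] op_apply cscale_0)
      then show ?thesis
        using XD(2) by simp
    qed
  next
    show "finite (UNIV :: ('n \<times> 'n) set)"
      by simp
  qed
  ultimately have "toeplitz \<subseteq> ?X"
    unfolding toeplitz_def by (intro cstar_generated_subset[OF symbol_of_subalgebra]) auto
  then show ?thesis
    using assms by blast
qed

text \<open>Polynomials converging uniformly to \<open>F\<close> have operators converging in norm,
  by \<open>tpop_bound\<close>. The limit exists by completeness, lies in the Toeplitz algebra
  because that is closed, and has symbol \<open>F\<close>.\<close>

lemma symbol_surj:
  assumes F: "continuous_on (sphere 0 1) F"
  shows "\<exists>T\<in>toeplitz. symbol_of T F"
proof -
  let ?d = "real CARD('n \<times> 'n)"
  have d: "0 < ?d"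
    by simp
  have "\<exists>xs. near (inverse (Suc n)) F (tval xs)" for n
    by (rule tval_approx[OF F]) simp
  then obtain xs where xs: "\<And>n. near (inverse (Suc n)) F (tval (xs n))"
    by metis
  have near: "\<exists>N. \<forall>n\<ge>N. near e F (tval (xs n))" if e: "0 < e" for e
  proof -
    obtain N where N: "inverse (Suc N) < e"
      using reals_Archimedean[OF e] by blast
    have "inverse (Suc n) \<le> e" if "N \<le> n" for n
    proof -
      have "inverse (real (Suc n)) \<le> inverse (Suc N)"
        using that by (intro le_imp_inverse_le) auto
      then show ?thesis
        using N by linarith
    qed
    then show ?thesis
      using near_mono[OF xs] by blast
  qed
  have cauchy: "\<exists>N. \<forall>m\<ge>N. \<forall>n\<ge>N. opbound P (op_minus P (tpop (xs m)) (tpop (xs n))) e" if e: "0 < e" for e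
  proof -
    obtain N where N: "\<And>n. N \<le> n \<Longrightarrow> near (e / ?d / 2) F (tval (xs n))"
      using near[of "e / ?d / 2"] e d by auto
    have "opbound P (op_minus P (tpop (xs m)) (tpop (xs n))) e" if mn: "N \<le> m" "N \<le> n" for m n
    proof -
      have "opbound P (tpop (xs m @ tsmult (- 1) (xs n))) (?d * (e / ?d / 2 + e / ?d / 2))"
      proof (rule tpop_bound)
        fix z :: complex and i k
        assume z: "cmod z = 1"
        show "cmod (tval (xs m @ tsmult (- 1) (xs n)) z $ i $ k) \<le> e / ?d / 2 + e / ?d / 2"
          using nearD[OF near_trans[OF near_sym[OF N[OF mn(1)]] N[OF mn(2)]] z, of i k]
          by (simp add: tval_append tval_tsmult)
      qed
      then show ?thesis
        using d by (simp add: tpop_append tpop_tsmult)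
    qed
    then show ?thesis
      by blast
  qed
  obtain T where T: "T \<in> ops P" and lim: "\<forall>e>0. \<exists>N. \<forall>n\<ge>N. opbound P (op_minus P (tpop (xs n)) T) e"
    by (rule ops_complete[OF tpop_ops cauchy])
  have "T \<in> toeplitz"
  proof (rule cstar_subalgebra_limit[OF toeplitz_subalgebra T])
    show "\<exists>S\<in>toeplitz. opbound P (op_minus P S T) e" if "0 < e" for e
      using lim that tpop_toeplitz by blast
  qed
  moreover have "symbol_of T F"
  proof (rule symbol_of_limit[OF T])
    fix e :: real
    assume e: "0 < e"
    obtain N1 where N1: "\<And>n. N1 \<le> n \<Longrightarrow> opbound P (op_minus P (tpop (xs n)) T) e"
      using lim e by blast
    obtain N2 where N2: "\<And>n. N2 \<le> n \<Longrightarrow> near e F (tval (xs n))"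
      using near[OF e] by blast
    show "\<exists>S G. symbol_of S G \<and> near e F G \<and> opbound P (op_minus P S T) e"
      using symbol_of_tpop N1[of "max N1 N2"] N2[of "max N1 N2"] by auto
  qed
  ultimately show ?thesis
    by blast
qed

lemma toeplitz_ideal_iff:
  "T \<in> toeplitz_ideal P \<longleftrightarrow> T \<in> toeplitz \<and> (\<forall>e>0. \<exists>N. \<forall>n\<ge>N. opbound P (T \<otimes>\<^bsub>fock_op_alg P\<^esub> level_proj P n) e)"
proof (cases "T \<in> toeplitz")
  case True
  then have "T \<otimes>\<^bsub>fock_op_alg P\<^esub> level_proj P n \<in> ops P" for n
    using cstar_subalgebraD(1)[OF toeplitz_subalgebra] level_proj_ops by (intro op_closed) auto
  from nrm_tendsto_0_iff[OF this] show ?thesis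
    using True by (simp add: toeplitz_ideal_def toeplitz_alg_def)
next
  case False
  then show ?thesis
    by (simp add: toeplitz_ideal_def)
qed

text \<open>Membership in the ideal gives local boundedness with every positive constant, so the
  symbol vanishes by \<open>good_le\<close>. Conversely, approximating polynomials of a vanishing
  symbol are small, so their operators are small everywhere and \<open>T\<close> is small on high
  levels.\<close>

lemma toeplitz_ideal_symbol:
  assumes T: "T \<in> toeplitz" and F: "symbol_of T F"
  shows "T \<in> toeplitz_ideal P \<longleftrightarrow> (\<forall>z. cmod z = 1 \<longrightarrow> F z = 0)"
proof
  have TP: "T \<in> ops P" and good: "good T F"
    using F by (auto simp: symbol_of_def)
  {
    assume "T \<in> toeplitz_ideal P"
    then have small: "\<And>e. 0 < e \<Longrightarrow> \<exists>N. \<forall>n\<ge>N. opbound P (T \<otimes>\<^bsub>fock_op_alg P\<^esub> level_proj P n) e"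
      by (simp add: toeplitz_ideal_iff)
    have lb: "locally_bounded T e" if e: "0 < e" for e
      unfolding locally_bounded_def
    proof
      fix N :: nat
      \<comment> \<open>Each of at most \<open>N\<close> levels contributes this much;
        \<open>N + 1\<close> also covers \<open>N = 0\<close>.\<close>
      have "0 < e / (N + 1)"
        using e by simp
      from small[OF this] obtain K where K: "\<And>n. K \<le> n \<Longrightarrow> opbound P (T \<otimes>\<^bsub>fock_op_alg P\<^esub> level_proj P n) (e / (N + 1))"
        by blast
      have "hnorm (T \<xi>) \<le> e * hnorm \<xi>"
        if \<xi>: "\<xi> \<in> Fock P" "finite {m. \<xi> m \<noteq> 0}" "card {m. \<xi> m \<noteq> 0} \<le> N" "\<forall>m<K. \<xi> m = 0" for \<xi>
      proof -
        have "opbound P (T \<otimes>\<^bsub>fock_op_alg P\<^esub> level_proj P n) (e / (N + 1))" if "n \<in> {m. \<xi> m \<noteq> 0}" for n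
          using K \<xi>(4) that not_less by blast
        from restrict_levels_bound[OF TP \<xi>(1,2) this]
        have "hnorm (T (\<lambda>m. if m \<in> {m. \<xi> m \<noteq> 0} then \<xi> m else 0)) \<le> card {m. \<xi> m \<noteq> 0} * (e / (N + 1)) * hnorm \<xi>"
          by blast
        moreover have "(\<lambda>m. if m \<in> {m. \<xi> m \<noteq> 0} then \<xi> m else 0) = \<xi>"
          by auto
        moreover have "card {m. \<xi> m \<noteq> 0} * (e / (N + 1)) \<le> (N + 1) * (e / (N + 1))"
          using \<xi>(3) e by (intro mult_right_mono) auto
        then have "card {m. \<xi> m \<noteq> 0} * (e / (N + 1)) * hnorm \<xi> \<le> e * hnorm \<xi>"
          using hnorm_nonneg[OF \<xi>(1)] by (intro mult_right_mono) auto
        ultimately show ?thesis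
          by simp
      qed
      then show "\<exists>K. \<forall>\<xi>\<in>Fock P. finite {m. \<xi> m \<noteq> 0} \<longrightarrow> card {m. \<xi> m \<noteq> 0} \<le> N \<longrightarrow>
        (\<forall>m<K. \<xi> m = 0) \<longrightarrow> hnorm (T \<xi>) \<le> e * hnorm \<xi>"
        by blast
    qed
    show "\<forall>z. cmod z = 1 \<longrightarrow> F z = 0"
    proof (intro allI impI)
      fix z :: complex
      assume z: "cmod z = 1"
      have "cmod (F z $ i $ k) \<le> 0" for i k
        by (rule field_le_epsilon) (use good_le[OF TP good lb _ z] in simp)
      then show "F z = 0"
        by (simp add: vec_eq_iff)
    qed
  next
    assume F0: "\<forall>z. cmod z = 1 \<longrightarrow> F z = 0"
    let ?d = "real CARD('n \<times> 'n)"
    have "\<exists>N. \<forall>n\<ge>N. opbound P (T \<otimes>\<^bsub>fock_op_alg P\<^esub> level_proj P n) e" if e: "0 < e" for e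
    proof -
      \<comment> \<open>An error \<open>f\<close> on high levels and a polynomial of operator bound
        \<open>?d * f\<close> must add up to \<open>e\<close>.\<close>
      define f where "f = e / (1 + ?d)"
      have d: "0 < 1 + ?d"
        by (intro add_pos_nonneg) auto
      then have f: "0 < f"
        using e by (simp add: f_def)
      have "f + ?d * f = f * (1 + ?d)"
        by (simp add: distrib_left mult.commute)
      also have "\<dots> = e"
        using d unfolding f_def by (metis less_irrefl nonzero_eq_divide_eq)
      finally have fe: "f + ?d * f = e" .
      obtain xs where xs: "near f F (tval xs)" "tail (op_minus P T (tpop xs)) f"
        using goodD[OF good f] by blast
      have "cmod (tval xs z $ i $ k) \<le> f" if "cmod z = 1" for z i k
        using nearD[OF xs(1) that, of i k] F0 that by simp
      then have "opbound P (tpop xs) (?d * f)"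
        by (rule tpop_bound)
      then have "tail (op_minus P T (tpop xs) \<oplus>\<^bsub>fock_op_alg P\<^esub> tpop xs) (f + ?d * f)"
        by (intro tail_add xs(2) opbound_tail op_closed TP tpop_ops)
      moreover have "op_minus P T (tpop xs) \<oplus>\<^bsub>fock_op_alg P\<^esub> tpop xs = T"
        by (rule ops_ext[of _ P]) (simp_all add: TP tpop_ops op_apply cscale_minus1)
      ultimately have "tail T e"
        using fe by simp
      from tailD[OF this] obtain M
        where M: "\<And>\<xi>. \<xi> \<in> Fock P \<Longrightarrow> \<forall>m<M. \<xi> m = 0 \<Longrightarrow> hnorm (T \<xi>) \<le> e * hnorm \<xi>"
        by blast
      have "opbound P (T \<otimes>\<^bsub>fock_op_alg P\<^esub> level_proj P n) e" if n: "M \<le> n" for n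
        unfolding opbound_def
      proof (intro conjI ballI)
        fix \<xi>
        assume \<xi>: "\<xi> \<in> Fock P"
        have "hnorm (T (level_proj P n \<xi>)) \<le> e * hnorm (level_proj P n \<xi>)"
          by (rule M[OF ops_Fock[OF level_proj_ops \<xi>]]) (use n \<xi> in \<open>simp add: level_proj_def\<close>)
        also have "\<dots> \<le> e * hnorm \<xi>"
          using hnorm_level_proj[OF \<xi>] e by (intro mult_left_mono) auto
        finally show "hnorm ((T \<otimes>\<^bsub>fock_op_alg P\<^esub> level_proj P n) \<xi>) \<le> e * hnorm \<xi>"
          using \<xi> by (simp add: op_mult_apply)
      qed (use e in simp)
      then show ?thesis
        by blast
    qed
    then show "T \<in> toeplitz_ideal P"
      using T by (simp add: toeplitz_ideal_iff)
  }
qed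

end


section \<open>The tensor product and the isomorphism\<close>

lemma norm_le_sum_entries: "norm (A *v x) \<le> (\<Sum>i\<in>UNIV. \<Sum>j\<in>UNIV. cmod (A $ i $ j)) * norm x"
  for A :: "complex ^ 'd ^ 'd"
proof -
  have "norm (A *v x) \<le> (\<Sum>i\<in>UNIV. cmod ((A *v x) $ i))"
    unfolding norm_vec_def by (rule L2_set_le_sum) simp
  also have "\<dots> \<le> (\<Sum>i\<in>UNIV. \<Sum>j\<in>UNIV. cmod (A $ i $ j) * norm x)"
  proof (rule sum_mono)
    fix i
    show "cmod ((A *v x) $ i) \<le> (\<Sum>j\<in>UNIV. cmod (A $ i $ j) * norm x)"
      unfolding matrix_vector_mult_def vec_lambda_beta
      by (rule order_trans[OF norm_sum])
        (auto simp: norm_mult intro!: sum_mono mult_left_mono Finite_Cartesian_Product.norm_nth_le)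
  qed
  finally show ?thesis
    by (simp add: sum_distrib_right)
qed

lemma onorm_le_entries:
  fixes A :: "complex ^ 'd ^ 'd" and B :: real
  assumes "\<And>i j. cmod (A $ i $ j) \<le> B"
  shows "onorm ((*v) A) \<le> CARD('d) * (CARD('d) * B)"
proof -
  have "onorm ((*v) A) \<le> (\<Sum>i\<in>UNIV. \<Sum>j\<in>UNIV. cmod (A $ i $ j))"
    by (rule onorm_le) (rule norm_le_sum_entries)
  also have "\<dots> \<le> (\<Sum>i\<in>(UNIV :: 'd set). \<Sum>j\<in>(UNIV :: 'd set). B)"
    by (intro sum_mono assms)
  finally show ?thesis
    by simp
qed

lemma entry_le_onorm:
  fixes A :: "complex ^ 'd ^ 'd"
  shows "cmod (A $ i $ j) \<le> onorm ((*v) A)"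
proof -
  have "cmod (A $ i $ j) = cmod ((A *v axis j 1) $ i)"
    by (simp add: matrix_vector_mult_def axis_def if_distrib cong: if_cong)
  also have "\<dots> \<le> norm (A *v axis j 1)"
    by (rule Finite_Cartesian_Product.norm_nth_le)
  also have "\<dots> \<le> onorm ((*v) A) * norm (axis j 1 :: complex ^ 'd)"
    by (rule onorm) (rule matrix_vector_mul_bounded_linear)
  finally show ?thesis
    by (simp add: norm_axis_1)
qed

section \<open>Continuous matrix functions as the tensor product\<close>

abbreviation circle :: "complex set" where
  "circle \<equiv> sphere 0 1"

definition cont_mat :: "(complex \<Rightarrow> complex ^ 'd ^ 'd) set" where
  "cont_mat = {F \<in> extensional circle. continuous_on circle F}"

lemma continuous_matrix_iff:
  fixes F :: "complex \<Rightarrow> complex ^ 'd ^ 'd"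
  shows "continuous_on S F \<longleftrightarrow> (\<forall>i j. continuous_on S (\<lambda>z. F z $ i $ j))"
proof
  show "continuous_on S F" if "\<forall>i j. continuous_on S (\<lambda>z. F z $ i $ j)"
  proof -
    have "continuous_on S (\<lambda>z. \<chi> i j. F z $ i $ j)"
      using that by (intro continuous_on_vec_lambda) auto
    then show ?thesis
      by simp
  qed
qed (auto intro!: continuous_on_component)

lemma cont_mat_iff:
  "F \<in> cont_mat \<longleftrightarrow> F \<in> extensional circle \<and> (\<forall>i j. continuous_on circle (\<lambda>z. F z $ i $ j))"
  by (simp add: cont_mat_def continuous_matrix_iff)

lemma cont_mat_restrict: "(\<lambda>z\<in>circle. G z) \<in> cont_mat \<longleftrightarrow> (\<forall>i j. continuous_on circle (\<lambda>z. G z $ i $ j))"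
proof -
  have "continuous_on circle (\<lambda>z. (\<lambda>z\<in>circle. G z) z $ i $ j) \<longleftrightarrow> continuous_on circle (\<lambda>z. G z $ i $ j)" for i j
    by (rule continuous_on_cong) auto
  then show ?thesis
    by (simp add: cont_mat_iff)
qed

lemma cont_mat_closed:
  fixes F G :: "complex \<Rightarrow> complex ^ 'd ^ 'd"
  assumes "F \<in> cont_mat" "G \<in> cont_mat"
  shows "(\<lambda>z\<in>circle. F z + G z) \<in> cont_mat" "(\<lambda>z\<in>circle. F z ** G z) \<in> cont_mat"
    "(\<lambda>z\<in>circle. cscale a (F z)) \<in> cont_mat" "(\<lambda>z\<in>circle. ctranspose (F z)) \<in> cont_mat"
  using assms unfolding cont_mat_restrict unfolding cont_mat_iff
  by (auto simp: matrix_matrix_mult_def ctranspose_def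
      intro!: continuous_on_add continuous_on_mult continuous_on_sum continuous_on_cnj continuous_on_const)

lemma cont_mat_const: "(\<lambda>z\<in>circle. A) \<in> cont_mat"
  unfolding cont_mat_restrict by simp

lemma linf_mat_carrier:
  fixes F :: "complex \<Rightarrow> complex ^ 'd ^ 'd"
  shows "F \<in> carrier (linf_alg circle mat_alg) \<longleftrightarrow>
    F \<in> extensional circle \<and> (\<exists>B. \<forall>z\<in>circle. \<forall>i j. cmod (F z $ i $ j) \<le> B)"
proof -
  have "bdd_above ((\<lambda>z. onorm ((*v) (F z))) ` circle) \<longleftrightarrow> (\<exists>B. \<forall>z\<in>circle. \<forall>i j. cmod (F z $ i $ j) \<le> B)"
  proof
    assume "bdd_above ((\<lambda>z. onorm ((*v) (F z))) ` circle)"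
    then obtain B where "\<And>z. z \<in> circle \<Longrightarrow> onorm ((*v) (F z)) \<le> B"
      unfolding bdd_above_def by blast
    then show "\<exists>B. \<forall>z\<in>circle. \<forall>i j. cmod (F z $ i $ j) \<le> B"
      using order_trans[OF entry_le_onorm] by blast
  next
    assume "\<exists>B. \<forall>z\<in>circle. \<forall>i j. cmod (F z $ i $ j) \<le> B"
    then obtain B where B: "\<And>z i j. z \<in> circle \<Longrightarrow> cmod (F z $ i $ j) \<le> B"
      by blast
    show "bdd_above ((\<lambda>z. onorm ((*v) (F z))) ` circle)"
      by (rule bdd_aboveI2) (rule onorm_le_entries, rule B)
  qed
  then show ?thesis
    by (simp add: linf_alg_def mat_alg_def PiE_def)
qed

lemma cont_mat_bounded:
  fixes F :: "complex \<Rightarrow> complex ^ 'd ^ 'd"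
  assumes "F \<in> cont_mat"
  shows "\<exists>B. \<forall>z\<in>circle. \<forall>i j. cmod (F z $ i $ j) \<le> B"
proof -
  have "bounded (F ` circle)"
    using assms by (intro compact_imp_bounded compact_continuous_image) (auto simp: cont_mat_def)
  then obtain B where "\<And>z. z \<in> circle \<Longrightarrow> norm (F z) \<le> B"
    unfolding bounded_iff by blast
  then show ?thesis
    using order_trans[OF norm_entry_le] by blast
qed

lemma linf_mat_simps:
  "F \<oplus>\<^bsub>linf_alg circle mat_alg\<^esub> G = (\<lambda>z\<in>circle. F z + G z)"
  "F \<otimes>\<^bsub>linf_alg circle mat_alg\<^esub> G = (\<lambda>z\<in>circle. F z ** G z)"
  "a \<odot>\<^bsub>linf_alg circle mat_alg\<^esub> F = (\<lambda>z\<in>circle. cscale a (F z))"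
  "star (linf_alg circle mat_alg) F = (\<lambda>z\<in>circle. ctranspose (F z))"
  "\<zero>\<^bsub>linf_alg circle mat_alg\<^esub> = (\<lambda>z\<in>circle. 0)"
  "nrm (linf_alg circle mat_alg) F = (SUP z\<in>circle. onorm ((*v) (F z)))"
  by (simp_all add: linf_alg_def mat_alg_def)

text \<open>For closedness, entries are bounded by the operator norm, so norm limits are uniform
  limits of continuous entries. Boundedness of both functions is used to make the supremum in the
  norm meaningful.\<close>

lemma cont_mat_subalgebra:
  "cstar_subalgebra (linf_alg circle mat_alg) (cont_mat :: (complex \<Rightarrow> complex ^ 'd ^ 'd) set)"
  unfolding cstar_subalgebra_def linf_mat_simps
proof (intro conjI ballI allI impI)
  show "(cont_mat :: (complex \<Rightarrow> complex ^ 'd ^ 'd) set) \<subseteq> carrier (linf_alg circle mat_alg)"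
  proof
    fix F :: "complex \<Rightarrow> complex ^ 'd ^ 'd"
    assume "F \<in> cont_mat"
    then show "F \<in> carrier (linf_alg circle mat_alg)"
      using cont_mat_bounded by (simp add: linf_mat_carrier cont_mat_iff)
  qed
  fix s and F :: "complex \<Rightarrow> complex ^ 'd ^ 'd"
  assume F: "F \<in> carrier (linf_alg circle mat_alg)" and s: "\<forall>n. s n \<in> cont_mat"
    and lim: "(\<lambda>n. SUP z\<in>circle. onorm ((*v) ((\<lambda>z\<in>circle. s n z + (\<lambda>z\<in>circle. cscale (- 1) (F z)) z) z))) \<longlonglongrightarrow> 0"
  let ?D = "\<lambda>n. (\<lambda>z\<in>circle. s n z + (\<lambda>z\<in>circle. cscale (- 1) (F z)) z)"
  have entry: "cmod (s n z $ i $ j - F z $ i $ j) \<le> (SUP z\<in>circle. onorm ((*v) (?D n z)))"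
    if z: "z \<in> circle" for n z i j
  proof -
    obtain B where B: "\<And>z i j. z \<in> circle \<Longrightarrow> cmod (F z $ i $ j) \<le> B"
      using F unfolding linf_mat_carrier by blast
    obtain C where C: "\<And>z i j. z \<in> circle \<Longrightarrow> cmod (s n z $ i $ j) \<le> C"
      using cont_mat_bounded[of "s n"] s by blast
    have "cmod (s n z $ i $ j - F z $ i $ j) \<le> onorm ((*v) (s n z + cscale (- 1) (F z)))"
      using entry_le_onorm[of "s n z + cscale (- 1) (F z)" i j] by simp
    also have "\<dots> = onorm ((*v) (?D n z))"
      using z by simp
    also have "\<dots> \<le> (SUP z\<in>circle. onorm ((*v) (?D n z)))"
    proof (rule cSUP_upper[OF z])
      show "bdd_above ((\<lambda>z. onorm ((*v) (?D n z))) ` circle)"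
      proof (rule bdd_aboveI2, rule onorm_le_entries)
        fix z i j
        assume "z \<in> circle"
        then show "cmod (?D n z $ i $ j) \<le> C + B"
          using norm_triangle_mono[OF C[of z i j], of "- F z $ i $ j" B] B[of z i j] by simp
      qed
    qed
    finally show ?thesis .
  qed
  have "continuous_on circle (\<lambda>z. F z $ i $ j)" for i j
  proof (rule uniform_limit_theorem[where F = sequentially])
    show "\<forall>\<^sub>F n in sequentially. continuous_on circle (\<lambda>z. s n z $ i $ j)"
      using s by (auto simp: cont_mat_iff)
    show "uniform_limit circle (\<lambda>n z. s n z $ i $ j) (\<lambda>z. F z $ i $ j) sequentially"
      unfolding uniform_limit_sequentially_iff
    proof (intro allI impI)
      fix e :: real
      assume "0 < e"
      from LIMSEQ_D[OF lim this] obtain N where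
        N: "\<And>n. N \<le> n \<Longrightarrow> (SUP z\<in>circle. onorm ((*v) (?D n z))) < e"
        by (auto simp: abs_less_iff)
      have "dist (s n z $ i $ j) (F z $ i $ j) < e" if "N \<le> n" "z \<in> circle" for n z
        using entry[OF that(2), of n i j] N[OF that(1)] by (simp add: dist_norm)
      then show "\<exists>N. \<forall>n\<ge>N. \<forall>z\<in>circle. dist (s n z $ i $ j) (F z $ i $ j) < e"
        by blast
    qed
  qed simp
  then show "F \<in> cont_mat"
    using F by (simp add: cont_mat_iff linf_mat_carrier)
qed (auto intro: cont_mat_closed cont_mat_const)

text \<open>A continuous matrix function is the finite sum over positions of its entry functions
  times matrix units, so it lies in the algebra generated by elementary tensors. The converse holds
  because continuous matrix functions form a closed subalgebra.\<close>

lemma carrier_mat_tensor_circle: "carrier mat_tensor_circle = (cont_mat :: (complex \<Rightarrow> complex ^ 'd ^ 'd) set)"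
proof -
  let ?L = "linf_alg circle (mat_alg :: (complex ^ 'd ^ 'd) cstar)"
  let ?G = "{elem_tensor circle mat_alg a f |a f. a \<in> carrier (mat_alg :: (complex ^ 'd ^ 'd) cstar) \<and> f \<in> carrier (cont_alg circle)}"
  have cont: "continuous_on circle f" if "f \<in> carrier (cont_alg circle)" for f
    using that by (simp add: cont_alg_def)
  have "elem_tensor circle mat_alg a f \<in> cont_mat" if "f \<in> carrier (cont_alg circle)" for a :: "complex ^ 'd ^ 'd" and f
    using cont[OF that] unfolding elem_tensor_def cont_mat_restrict
    by (auto simp: mat_alg_def intro!: continuous_intros)
  then have G: "?G \<subseteq> cont_mat"
    by blast
  have sub: "cstar_subalgebra ?L (cstar_generated ?L ?G)"
  proof (rule cstar_subalgebra_generated)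
    show "?G \<subseteq> carrier ?L"
      using G cstar_subalgebraD(1)[OF cont_mat_subalgebra] by blast
    have bdd: "\<exists>B. \<forall>z\<in>circle. \<forall>i j. cmod ((F z + G z) $ i $ j) \<le> B"
      "\<exists>B. \<forall>z\<in>circle. \<forall>i j. cmod ((F z ** G z) $ i $ j) \<le> B"
      "\<exists>B. \<forall>z\<in>circle. \<forall>i j. cmod (cscale a (F z) $ i $ j) \<le> B"
      if FB: "\<exists>B. \<forall>z\<in>circle. \<forall>i j. cmod (F z $ i $ j) \<le> B" and GB: "\<exists>B. \<forall>z\<in>circle. \<forall>i j. cmod (G z $ i $ j) \<le> B"
      for F G :: "complex \<Rightarrow> complex ^ 'd ^ 'd" and a
    proof -
      obtain B C where B: "\<And>z i j. z \<in> circle \<Longrightarrow> cmod (F z $ i $ j) \<le> B"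
        and C: "\<And>z i j. z \<in> circle \<Longrightarrow> cmod (G z $ i $ j) \<le> C"
        using FB GB by blast
      show "\<exists>B. \<forall>z\<in>circle. \<forall>i j. cmod ((F z + G z) $ i $ j) \<le> B"
        using norm_triangle_mono[OF B C] by (intro exI[of _ "B + C"]) auto
      have "cmod ((F z ** G z) $ i $ j) \<le> CARD('d) * (B * C)" if z: "z \<in> circle" for z i j
      proof -
        have "cmod ((F z ** G z) $ i $ j) \<le> (\<Sum>k\<in>(UNIV :: 'd set). B * C)"
          unfolding matrix_matrix_mult_def vec_lambda_beta
        proof (rule order_trans[OF norm_sum sum_mono])
          fix k
          show "cmod (F z $ i $ k * G z $ k $ j) \<le> B * C"
            unfolding norm_mult using B[OF z] C[OF z]
            by (intro mult_mono) (auto intro: order_trans[OF norm_ge_zero])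
        qed
        then show ?thesis
          by simp
      qed
      then show "\<exists>B. \<forall>z\<in>circle. \<forall>i j. cmod ((F z ** G z) $ i $ j) \<le> B"
        by blast
      have "cmod (cscale a (F z) $ i $ j) \<le> cmod a * B" if "z \<in> circle" for z i j
        using B[OF that, of i j] by (simp add: norm_mult mult_left_mono)
      then show "\<exists>B. \<forall>z\<in>circle. \<forall>i j. cmod (cscale a (F z) $ i $ j) \<le> B"
        by blast
    qed
    have ctr: "\<exists>B. \<forall>z\<in>circle. \<forall>i j. cmod (ctranspose (F z) $ i $ j) \<le> B"
      if "\<exists>B. \<forall>z\<in>circle. \<forall>i j. cmod (F z $ i $ j) \<le> B" for F :: "complex \<Rightarrow> complex ^ 'd ^ 'd"
      using that by (auto simp: ctranspose_def)
    have restrict: "(\<lambda>z\<in>circle. F z) \<in> carrier ?L \<longleftrightarrow> (\<exists>B. \<forall>z\<in>circle. \<forall>i j. cmod (F z $ i $ j) \<le> B)" for F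
      by (simp add: linf_mat_carrier)
    show "cstar_subalgebra ?L (carrier ?L)"
      unfolding cstar_subalgebra_def linf_mat_simps
    proof (intro conjI ballI allI impI)
      fix F G
      assume "F \<in> carrier ?L" "G \<in> carrier ?L"
      then have F: "\<exists>B. \<forall>z\<in>circle. \<forall>i j. cmod (F z $ i $ j) \<le> B" and G: "\<exists>B. \<forall>z\<in>circle. \<forall>i j. cmod (G z $ i $ j) \<le> B"
        unfolding linf_mat_carrier by blast+
      show "(\<lambda>z\<in>circle. F z + G z) \<in> carrier ?L" "(\<lambda>z\<in>circle. F z ** G z) \<in> carrier ?L"
        unfolding restrict using bdd[OF F G] by blast+
    next
      fix a F
      assume "F \<in> carrier ?L"
      then have F: "\<exists>B. \<forall>z\<in>circle. \<forall>i j. cmod (F z $ i $ j) \<le> B"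
        unfolding linf_mat_carrier by blast
      show "(\<lambda>z\<in>circle. cscale a (F z)) \<in> carrier ?L"
        unfolding restrict by (rule bdd(3)[OF F F])
    next
      fix F
      assume "F \<in> carrier ?L"
      then have F: "\<exists>B. \<forall>z\<in>circle. \<forall>i j. cmod (F z $ i $ j) \<le> B"
        unfolding linf_mat_carrier by blast
      show "(\<lambda>z\<in>circle. ctranspose (F z)) \<in> carrier ?L"
        unfolding restrict by (rule ctr[OF F])
    next
      show "(\<lambda>z\<in>circle. 0) \<in> carrier ?L"
        unfolding restrict by (intro exI[of _ 0]) simp
    qed auto
  qed
  note SD = cstar_subalgebraD[OF sub, unfolded linf_mat_simps]
  have "F \<in> cstar_generated ?L ?G" if F: "F \<in> cont_mat" for F
  proof -
    define E :: "'d \<times> 'd \<Rightarrow> complex ^ 'd ^ 'd" where "E p = (\<chi> i j. if (i, j) = p then 1 else 0)" for p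
    define f where "f p = (\<lambda>z\<in>circle. F z $ fst p $ snd p)" for p :: "'d \<times> 'd"
    have "f p \<in> carrier (cont_alg circle)" for p
    proof -
      have "continuous_on circle (f p) \<longleftrightarrow> continuous_on circle (\<lambda>z. F z $ fst p $ snd p)"
        unfolding f_def by (rule continuous_on_cong) auto
      then have c: "continuous_on circle (f p)"
        using F by (simp add: cont_mat_iff)
      then have "bounded (f p ` circle)"
        by (intro compact_imp_bounded compact_continuous_image) auto
      then obtain B where "\<And>z. z \<in> circle \<Longrightarrow> cmod (f p z) \<le> B"
        unfolding bounded_iff by blast
      then have "bdd_above ((\<lambda>z. cmod (f p z)) ` circle)"
        by (rule bdd_aboveI2)
      then show ?thesis
        using c by (simp add: cont_alg_def linf_alg_def complex_alg_def PiE_def) (simp add: f_def)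
    qed
    then have gen: "elem_tensor circle mat_alg (E p) (f p) \<in> cstar_generated ?L ?G" for p
      by (intro subsetD[OF cstar_generated_superset] CollectI exI[of _ "E p"] exI[of _ "f p"] conjI refl)
        (simp_all add: mat_alg_def)
    have "(\<lambda>z\<in>circle. \<Sum>p\<in>I. elem_tensor circle mat_alg (E p) (f p) z) \<in> cstar_generated ?L ?G"
      if "finite I" for I
      using that
    proof (induction I)
      case empty
      then show ?case
        using SD(2) by (simp add: restrict_def)
    next
      case (insert p I)
      have eq: "(\<lambda>z\<in>circle. \<Sum>q\<in>insert p I. elem_tensor circle mat_alg (E q) (f q) z) =
        (\<lambda>z\<in>circle. elem_tensor circle mat_alg (E p) (f p) z +
          (\<lambda>z\<in>circle. \<Sum>q\<in>I. elem_tensor circle mat_alg (E q) (f q) z) z)"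
        using insert.hyps by (auto simp: fun_eq_iff)
      show ?case
        unfolding eq by (rule SD(3)[OF gen insert.IH])
    qed
    from this[of UNIV] have "(\<lambda>z\<in>circle. \<Sum>p\<in>UNIV. elem_tensor circle mat_alg (E p) (f p) z) \<in> cstar_generated ?L ?G"
      by simp
    moreover have "(\<lambda>z\<in>circle. \<Sum>p\<in>UNIV. elem_tensor circle mat_alg (E p) (f p) z) = F"
    proof (rule extensionalityI[of _ circle])
      fix z
      assume z: "z \<in> circle"
      have "(\<Sum>p\<in>UNIV. elem_tensor circle mat_alg (E p) (f p) z) $ i $ j = F z $ i $ j" for i j
      proof -
        have "elem_tensor circle mat_alg (E p) (f p) z $ i $ j = (if p = (i, j) then F z $ i $ j else 0)" for p
          using z by (auto simp: elem_tensor_def mat_alg_def E_def f_def)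
        then show ?thesis
          by simp
      qed
      then show "(\<lambda>z\<in>circle. \<Sum>p\<in>UNIV. elem_tensor circle mat_alg (E p) (f p) z) z = F z"
        using z by (simp add: vec_eq_iff)
    qed (use F in \<open>auto simp: cont_mat_iff\<close>)
    ultimately show ?thesis
      by simp
  qed
  moreover have "cstar_generated ?L ?G \<subseteq> cont_mat"
    by (rule cstar_generated_subset[OF cont_mat_subalgebra G])
  ultimately show ?thesis
    by (auto simp: mat_tensor_circle_def tensor_alg_def)
qed

lemma mat_tensor_circle_simps:
  "F \<oplus>\<^bsub>mat_tensor_circle\<^esub> G = (\<lambda>z\<in>circle. F z + G z)"
  "F \<otimes>\<^bsub>mat_tensor_circle\<^esub> G = (\<lambda>z\<in>circle. F z ** G z)"
  "a \<odot>\<^bsub>mat_tensor_circle\<^esub> F = (\<lambda>z\<in>circle. cscale a (F z))"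
  "star mat_tensor_circle F = (\<lambda>z\<in>circle. ctranspose (F z))"
  "\<zero>\<^bsub>mat_tensor_circle\<^esub> = (\<lambda>z\<in>circle. 0)"
  "\<one>\<^bsub>mat_tensor_circle\<^esub> = (\<lambda>z\<in>circle. mat 1)"
  by (simp_all add: mat_tensor_circle_def tensor_alg_def linf_alg_def mat_alg_def)

lemma ring_mat_tensor_circle: "ring (mat_tensor_circle :: (complex \<Rightarrow> complex ^ 'd ^ 'd) cstar)"
proof (rule ringI)
  note simps = mat_tensor_circle_simps carrier_mat_tensor_circle
  show "abelian_group (mat_tensor_circle :: (complex \<Rightarrow> complex ^ 'd ^ 'd) cstar)"
  proof (rule abelian_groupI, unfold simps)
    fix F G :: "complex \<Rightarrow> complex ^ 'd ^ 'd"
    assume F: "F \<in> cont_mat"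
    show "\<exists>G\<in>cont_mat. (\<lambda>z\<in>circle. G z + F z) = (\<lambda>z\<in>circle. 0)"
      using cont_mat_closed(3)[OF F F, of "- 1"]
      by (intro bexI[of _ "\<lambda>z\<in>circle. cscale (- 1) (F z)"]) (auto simp: cscale_minus1)
    show "(\<lambda>z\<in>circle. (\<lambda>z\<in>circle. 0) z + F z) = F"
      using F by (intro extensionalityI[of _ circle]) (auto simp: cont_mat_def)
    show "(\<lambda>z\<in>circle. F z + G z) \<in> cont_mat" if "G \<in> cont_mat"
      by (rule cont_mat_closed(1)[OF F that])
  qed (auto simp: fun_eq_iff add_ac intro: cont_mat_const)
  show "monoid (mat_tensor_circle :: (complex \<Rightarrow> complex ^ 'd ^ 'd) cstar)"
  proof (rule monoidI, unfold simps)
    fix F G :: "complex \<Rightarrow> complex ^ 'd ^ 'd"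
    assume F: "F \<in> cont_mat"
    show "(\<lambda>z\<in>circle. (\<lambda>z\<in>circle. mat 1) z ** F z) = F" "(\<lambda>z\<in>circle. F z ** (\<lambda>z\<in>circle. mat 1) z) = F"
      using F by (intro extensionalityI[of _ circle]; auto simp: cont_mat_def)+
    show "(\<lambda>z\<in>circle. F z ** G z) \<in> cont_mat" if "G \<in> cont_mat"
      by (rule cont_mat_closed(2)[OF F that])
  qed (auto simp: fun_eq_iff matrix_mul_assoc intro: cont_mat_const)
qed (auto simp: mat_tensor_circle_simps fun_eq_iff vec_eq_iff matrix_matrix_mult_def algebra_simps sum.distrib)

section \<open>Quotients by kernels\<close>

text \<open>The ring part is the first isomorphism theorem. Scalar multiplication and star on the
  quotient are unions over representatives; cosets are the fibres of \<open>h\<close>, so every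
  representative gives the same coset.\<close>

lemma star_isomorphic_quotient:
  fixes R :: "'a cstar" and S :: "'b cstar"
  assumes ring: "ring R" "ring S" and hom: "h \<in> ring_hom R S" and surj: "h ` carrier R = carrier S"
    and I: "I = {x \<in> carrier R. h x = \<zero>\<^bsub>S\<^esub>}"
    and smult: "\<And>a x. x \<in> carrier R \<Longrightarrow> a \<odot>\<^bsub>R\<^esub> x \<in> carrier R \<and> h (a \<odot>\<^bsub>R\<^esub> x) = a \<odot>\<^bsub>S\<^esub> h x"
    and star: "\<And>x. x \<in> carrier R \<Longrightarrow> star R x \<in> carrier R \<and> h (star R x) = star S (h x)"
  shows "star_isomorphic (cstar_quot R I) S"
proof -
  interpret ring_hom_ring R S h
    by (rule ring_hom_ringI2[OF ring hom])
  have I': "I = a_kernel R S h"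
    unfolding a_kernel_def' by (rule I)
  define \<phi> where "\<phi> X = the_elem (h ` X)" for X
  have "\<phi> \<in> ring_iso (R Quot I) S"
    unfolding \<phi>_def I' by (rule FactRing_iso_set[OF surj])
  then have iso: "\<phi> \<in> ring_iso (cstar_quot R I) S"
    by (simp add: ring_iso_def ring_hom_def cstar_quot_def)
  have coset: "I +>\<^bsub>R\<^esub> x = {y \<in> carrier R. h y = h x}" if "x \<in> carrier R" for x
    unfolding I' by (rule rcos_eq_homeq[OF that])
  have \<phi>: "\<phi> {y \<in> carrier R. h y = h x} = h x" if "x \<in> carrier R" for x
  proof -
    have "h ` {y \<in> carrier R. h y = h x} = {h x}"
      using that by auto
    then show ?thesis
      by (simp add: \<phi>_def)
  qed
  \<comment> \<open>One argument for both operations: \<open>k\<close> acts upstairs,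
    \<open>g\<close> in the target, and \<open>h\<close> intertwines them.\<close>
  have lift: "\<phi> (\<Union>x\<in>X. I +>\<^bsub>R\<^esub> k x) = g (\<phi> X)"
    if X: "X \<in> carrier (cstar_quot R I)" and k: "\<And>x. x \<in> carrier R \<Longrightarrow> k x \<in> carrier R \<and> h (k x) = g (h x)"
    for X k g
  proof -
    obtain x where x: "x \<in> carrier R" and "X = I +>\<^bsub>R\<^esub> x"
      using X by (auto simp: cstar_quot_def FactRing_def A_RCOSETS_def')
    then have X_eq: "X = {y \<in> carrier R. h y = h x}"
      using coset by simp
    have "I +>\<^bsub>R\<^esub> k y = {w \<in> carrier R. h w = h (k x)}" if "y \<in> X" for y
      using that coset[of "k y"] k x by (auto simp: X_eq)
    moreover have "x \<in> X"
      using x by (simp add: X_eq)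
    ultimately have eq: "(\<Union>x\<in>X. I +>\<^bsub>R\<^esub> k x) = {w \<in> carrier R. h w = h (k x)}"
      by auto
    have "\<phi> (\<Union>x\<in>X. I +>\<^bsub>R\<^esub> k x) = h (k x)"
      unfolding eq by (rule \<phi>) (use k[OF x] in blast)
    then show ?thesis
      using k[OF x] \<phi>[OF x] by (simp add: X_eq)
  qed
  have "\<phi> (a \<odot>\<^bsub>cstar_quot R I\<^esub> X) = a \<odot>\<^bsub>S\<^esub> \<phi> X" "\<phi> (star (cstar_quot R I) X) = star S (\<phi> X)"
    if "X \<in> carrier (cstar_quot R I)" for a X
    using lift[OF that, of "\<lambda>x. a \<odot>\<^bsub>R\<^esub> x" "\<lambda>x. a \<odot>\<^bsub>S\<^esub> x"] lift[OF that, of "star R" "star S"] smult star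
    by (simp_all add: cstar_quot_def)
  then have "\<phi> \<in> star_iso (cstar_quot R I) S"
    using iso by (simp add: star_iso_def)
  then show ?thesis
    by (auto simp: star_isomorphic_def)
qed

section \<open>The isomorphism\<close>

context chain
begin

text \<open>A choice, determined on the circle by \<open>symbol_of_unique\<close>; values elsewhere
  are arbitrary and are removed by restriction to the circle.\<close>

definition symbol :: "'n fock_op \<Rightarrow> complex \<Rightarrow> complex ^ 'n ^ 'n" where
  "symbol T = (SOME F. symbol_of T F)"

lemma symbol_of_symbol: "T \<in> toeplitz \<Longrightarrow> symbol_of T (symbol T)"
  unfolding symbol_def by (rule someI_ex[OF toeplitz_symbol])

lemma symbol_eq: "T \<in> toeplitz \<Longrightarrow> symbol_of T F \<Longrightarrow> cmod z = 1 \<Longrightarrow> symbol T z = F z"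
  using symbol_of_unique symbol_of_symbol by blast

lemma symbol_continuous: "T \<in> toeplitz \<Longrightarrow> continuous_on circle (symbol T)"
  using symbol_of_symbol good_continuous unfolding symbol_of_def by blast

lemma toeplitz_one: "\<one>\<^bsub>fock_op_alg P\<^esub> \<in> toeplitz"
proof -
  have eq: "left_action P (\<chi> i. 1) = \<one>\<^bsub>fock_op_alg P\<^esub>"
  proof (rule ops_ext[of _ P])
    show "left_action P (\<chi> i. 1) \<in> ops P"
      using generators_ops by blast
    have "diag_mat (\<chi> i. 1) = (mat 1 :: complex ^ 'n ^ 'n)"
      by (simp add: diag_mat_def mat_def vec_eq_iff)
    then show "left_action P (\<chi> i. 1) \<xi> m = \<one>\<^bsub>fock_op_alg P\<^esub> \<xi> m" if "\<xi> \<in> Fock P" for \<xi> m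
      using that by (simp add: left_action_def op_one_apply)
  qed simp
  show ?thesis
    unfolding toeplitz_def eq[symmetric] by (rule subsetD[OF cstar_generated_superset]) blast
qed

lemma toeplitz_alg_simps:
  "T \<oplus>\<^bsub>toeplitz_alg P\<^esub> S = T \<oplus>\<^bsub>fock_op_alg P\<^esub> S"
  "T \<otimes>\<^bsub>toeplitz_alg P\<^esub> S = T \<otimes>\<^bsub>fock_op_alg P\<^esub> S"
  "a \<odot>\<^bsub>toeplitz_alg P\<^esub> T = a \<odot>\<^bsub>fock_op_alg P\<^esub> T"
  "star (toeplitz_alg P) T = star (fock_op_alg P) T"
  "\<one>\<^bsub>toeplitz_alg P\<^esub> = \<one>\<^bsub>fock_op_alg P\<^esub>"
  by (simp_all add: toeplitz_alg_def)

lemma ring_toeplitz_alg: "ring (toeplitz_alg P)"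
proof -
  interpret ring "fock_op_alg P"
    by (rule ring_fock_op_alg)
  note TD = cstar_subalgebraD[OF toeplitz_subalgebra]
  have neg: "\<ominus>\<^bsub>fock_op_alg P\<^esub> T = (- 1) \<odot>\<^bsub>fock_op_alg P\<^esub> T" if "T \<in> ops P" for T
  proof (rule minus_equality)
    show "(- 1) \<odot>\<^bsub>fock_op_alg P\<^esub> T \<oplus>\<^bsub>fock_op_alg P\<^esub> T = \<zero>\<^bsub>fock_op_alg P\<^esub>"
      by (rule ops_ext[of _ P]) (simp_all add: that op_apply cscale_minus1)
  qed (simp_all add: that)
  have "subring toeplitz (fock_op_alg P)"
    using TD toeplitz_one by (intro subringI) (auto simp: neg subsetD[OF TD(1)])
  then have "ring ((fock_op_alg P)\<lparr>carrier := toeplitz\<rparr>)"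
    by (rule subring_is_ring)
  moreover have "(fock_op_alg P)\<lparr>carrier := toeplitz\<rparr> = toeplitz_alg P"
    by (simp add: toeplitz_alg_def)
  ultimately show ?thesis
    by simp
qed

text \<open>Some \<open>T\<close> has the constant identity matrix as symbol. Comparing symbols in
  the identity \<open>1 T = T\<close> then determines the symbol of the unit.\<close>

lemma symbol_one:
  assumes "cmod z = 1"
  shows "symbol \<one>\<^bsub>fock_op_alg P\<^esub> z = mat 1"
proof -
  obtain T where T: "T \<in> toeplitz" "symbol_of T (\<lambda>z. mat 1)"
    using symbol_surj[of "\<lambda>z. mat 1"] by auto
  have "\<one>\<^bsub>fock_op_alg P\<^esub> \<otimes>\<^bsub>fock_op_alg P\<^esub> T = T"
    using cstar_subalgebraD(1)[OF toeplitz_subalgebra] T(1)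
    by (intro ops_ext[of _ P]) (auto simp: op_apply)
  then have "symbol_of T (\<lambda>z. symbol \<one>\<^bsub>fock_op_alg P\<^esub> z ** mat 1)"
    using symbol_of_mult[OF symbol_of_symbol[OF toeplitz_one] T(2)] by simp
  from symbol_of_unique[OF this T(2) assms] show ?thesis
    by simp
qed

text \<open>States and matrix indices are different types of the same size. The bijection
  \<open>g\<close> relabels the entries of the symbol; it is compatible with matrix products because
  it only reindexes the inner sum.\<close>

lemma cuntz_pimsner_isomorphic:
  fixes g :: "'d::finite \<Rightarrow> 'n"
  assumes g: "bij g"
  shows "star_isomorphic (cuntz_pimsner_alg P) (mat_tensor_circle :: (complex \<Rightarrow> complex ^ 'd ^ 'd) cstar)"
proof -
  define h :: "'n fock_op \<Rightarrow> complex \<Rightarrow> complex ^ 'd ^ 'd"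
    where "h T = (\<lambda>z\<in>circle. \<chi> a b. symbol T z $ g a $ g b)" for T
  note TD = cstar_subalgebraD[OF toeplitz_subalgebra]
  have h_eq: "h T = (\<lambda>z\<in>circle. \<chi> a b. F z $ g a $ g b)" if "T \<in> toeplitz" "symbol_of T F" for T F
    unfolding h_def using symbol_eq[OF that] by (auto simp: fun_eq_iff restrict_def)
  have sum_g: "(\<Sum>b\<in>UNIV. f (g b)) = (\<Sum>k\<in>UNIV. f k)" for f :: "'n \<Rightarrow> complex"
    using sum.reindex_bij_betw[OF g] .
  have mem: "h T \<in> cont_mat" if "T \<in> toeplitz" for T
    using symbol_continuous[OF that] unfolding h_def cont_mat_restrict by (simp add: continuous_matrix_iff)
  show ?thesis
    unfolding cuntz_pimsner_alg_def
  proof (rule star_isomorphic_quotient[OF ring_toeplitz_alg ring_mat_tensor_circle, of h])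
    show "h \<in> ring_hom (toeplitz_alg P) mat_tensor_circle"
    proof (rule ring_hom_memI, unfold toeplitz_alg_simps mat_tensor_circle_simps carrier_mat_tensor_circle)
      fix T S
      assume T: "T \<in> toeplitz" and S: "S \<in> toeplitz"
      show "h (T \<otimes>\<^bsub>fock_op_alg P\<^esub> S) = (\<lambda>z\<in>circle. h T z ** h S z)"
        unfolding h_eq[OF TD(4)[OF T S] symbol_of_mult[OF symbol_of_symbol[OF T] symbol_of_symbol[OF S]]]
        by (auto simp: h_def fun_eq_iff vec_eq_iff matrix_matrix_mult_def
            sum_g[of "\<lambda>k. symbol T _ $ g _ $ k * symbol S _ $ k $ g _"])
      show "h (T \<oplus>\<^bsub>fock_op_alg P\<^esub> S) = (\<lambda>z\<in>circle. h T z + h S z)"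
        unfolding h_eq[OF TD(3)[OF T S] symbol_of_add[OF symbol_of_symbol[OF T] symbol_of_symbol[OF S]]]
        by (auto simp: h_def fun_eq_iff vec_eq_iff)
    next
      show "h \<one>\<^bsub>fock_op_alg P\<^esub> = (\<lambda>z\<in>circle. mat 1)"
        using bij_is_inj[OF g] symbol_one by (auto simp: h_def fun_eq_iff vec_eq_iff mat_def inj_eq)
    qed (rule mem)
    show "h ` toeplitz = carrier mat_tensor_circle"
      unfolding carrier_mat_tensor_circle
    proof
      show "h ` toeplitz \<subseteq> cont_mat"
        using mem by blast
      show "cont_mat \<subseteq> h ` toeplitz"
      proof
        fix F :: "complex \<Rightarrow> complex ^ 'd ^ 'd"
        assume F: "F \<in> cont_mat"
        define g' where "g' = inv_into UNIV g"
        have g': "g' (g a) = a" for a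
          unfolding g'_def using bij_is_inj[OF g] by (rule inv_into_f_f) simp
        define G :: "complex \<Rightarrow> complex ^ 'n ^ 'n" where "G z = (\<chi> i k. F z $ g' i $ g' k)" for z
        have "continuous_on circle G"
          using F unfolding continuous_matrix_iff cont_mat_iff G_def by simp
        then obtain T where T: "T \<in> toeplitz" "symbol_of T G"
          using symbol_surj by blast
        have "h T = F"
          unfolding h_eq[OF T]
        proof (rule extensionalityI[of _ circle])
          show "(\<lambda>z\<in>circle. \<chi> a b. G z $ g a $ g b) z = F z" if "z \<in> circle" for z
            using that by (simp add: G_def g' vec_eq_iff)
        qed (use F in \<open>simp_all add: cont_mat_iff\<close>)
        then show "F \<in> h ` toeplitz"
          using T(1) by blast
      qed
    qed
    show "toeplitz_ideal P = {T \<in> toeplitz. h T = \<zero>\<^bsub>mat_tensor_circle\<^esub>}"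
    proof -
      have "T \<in> toeplitz_ideal P \<longleftrightarrow> h T = (\<lambda>z\<in>circle. 0)" if T: "T \<in> toeplitz" for T
      proof -
        have "h T = (\<lambda>z\<in>circle. 0) \<longleftrightarrow> (\<forall>z. cmod z = 1 \<longrightarrow> symbol T z = 0)"
        proof
          assume h0: "h T = (\<lambda>z\<in>circle. 0)"
          show "\<forall>z. cmod z = 1 \<longrightarrow> symbol T z = 0"
          proof (intro allI impI)
            fix z :: complex
            assume "cmod z = 1"
            then have "symbol T z $ g a $ g b = 0" for a b
              using fun_cong[OF h0, of z] by (simp add: h_def vec_eq_iff)
            then have "symbol T z $ i $ k = 0" for i k
              using bij_is_surj[OF g] by (metis surjD)
            then show "symbol T z = 0"
              by (simp add: vec_eq_iff)
          qed
        qed (auto simp: h_def fun_eq_iff vec_eq_iff)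
        then show ?thesis
          using toeplitz_ideal_symbol[OF T symbol_of_symbol[OF T]] by blast
      qed
      moreover have "toeplitz_ideal P \<subseteq> toeplitz"
        by (auto simp: toeplitz_ideal_def)
      ultimately show ?thesis
        unfolding mat_tensor_circle_simps by blast
    qed
    fix T
    assume T: "T \<in> toeplitz"
    show "a \<odot>\<^bsub>toeplitz_alg P\<^esub> T \<in> toeplitz \<and> h (a \<odot>\<^bsub>toeplitz_alg P\<^esub> T) = a \<odot>\<^bsub>mat_tensor_circle\<^esub> h T" for a
      unfolding toeplitz_alg_simps mat_tensor_circle_simps
        h_eq[OF TD(5)[OF T] symbol_of_smult[OF symbol_of_symbol[OF T]]]
      using TD(5)[OF T] by (auto simp: h_def fun_eq_iff vec_eq_iff)
    show "star (toeplitz_alg P) T \<in> toeplitz \<and> h (star (toeplitz_alg P) T) = star mat_tensor_circle (h T)"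
      unfolding toeplitz_alg_simps mat_tensor_circle_simps
        h_eq[OF TD(6)[OF T] symbol_of_star[OF symbol_of_symbol[OF T]]]
      using TD(6)[OF T] by (auto simp: h_def fun_eq_iff vec_eq_iff ctranspose_def)
  qed
qed

end

theorem theorem2p1:
  fixes P :: "real ^ 'n ^ 'n" and d :: nat
  assumes "stochastic P" and "irreducible_mat P"
    and "CARD('n) = d" and "CARD('d) = d"
  shows "star_isomorphic (cuntz_pimsner_alg P)
           (mat_tensor_circle :: (complex \<Rightarrow> complex ^ 'd ^ 'd) cstar)"
proof -
  obtain g :: "'d \<Rightarrow> 'n" where g: "bij g"
    using finite_same_card_bij[of "UNIV :: 'd set" "UNIV :: 'n set"] assms(3,4) by auto
  obtain r :: nat and c :: "'n \<Rightarrow> int" and N where "0 < r"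
    "\<And>n i j. 0 < mpow P n $ i $ j \<Longrightarrow> int r dvd int n - (c j - c i)"
    "\<And>n i j. N \<le> n \<Longrightarrow> int r dvd int n - (c j - c i) \<Longrightarrow> 0 < mpow P n $ i $ j"
    using irreducible_periodic[OF assms(1,2)] by metis
  then interpret chain P r c N
    using assms(1) by unfold_locales
  show ?thesis
    by (rule cuntz_pimsner_isomorphic[OF g])
qed

end
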